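(* Let $\mathfrak{g}$ be a finite-dimensional restricted Lie algebra over $\mathbb{F}$ equipped with a symmetric invariant bilinear form $\langle\cdot,\cdot\rangle$. For any $\ell\in\mathbb{F}$, the vertex algebra $V^0_{\hat{\mathfrak g}}(\ell,0)$ has only finitely many irreducible $\mathbb{N}$-graded modules up to equivalence, and $V^0_{\hat{\mathfrak g}}(\ell,0)$ is $C_2$-cofinite.
   Context: $\mathbb{F}$ is an algebraically closed field of prime characteristic $p\ge 3$; all vector spaces are over $\mathbb{F}$. $\mathbb{N}$ and $\mathbb{Z}_+$ denote the nonnegative and the positive integers. Vertex algebras: a vertex algebra is a vector space $V$ with a linear map $Y(\cdot,x):V\to(\mathrm{End}\,V)[[x,x^{-1}]]$, $v\mapsto Y(v,x)=\sum_{n\in\mathbb{Z}}v_nx^{-n-1}$, and a vector $\mathbf 1\in V$ such that $Y(u,x)v\in V((x))$; $Y(\mathbf 1,x)=\mathrm{id}$; $Y(v,x)\mathbf 1\in V[[x]]$ with constant term $v$; and for $u,v,w\in V$ the Jacobi identity $x_0^{-1}\delta\left(\frac{x_1-x_2}{x_0}\right)Y(u,x_1)Y(v,x_2)w-x_0^{-1}\delta\left(\frac{x_2-x_1}{-x_0}\right)Y(v,x_2)Y(u,x_1)w=x_2^{-1}\delta\left(\frac{x_1-x_0}{x_2}\right)Y(Y(u,x_0)v,x_2)w$ holds, where $\delta(x)=\sum_{n\in\mathbb{Z}}x^n$ and $(x_1\pm x_2)^n$ is expanded in nonnegative powers of the second variable. A $V$-module is a vector space $W$ with a linear map $Y_W(\cdot,x):V\to(\mathrm{End}\,W)[[x,x^{-1}]]$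 with $Y_W(\mathbf 1,x)=1_W$, $Y_W(u,x)w\in W((x))$, and satisfying the analogous Jacobi identity on $W$. An ideal is a subspace $I$ with $v_nw,\,w_nv\in I$ for all $v\in V$, $w\in I$, $n\in\mathbb{Z}$. A $\mathbb{Z}$-graded vertex algebra is a vertex algebra with a grading $V=\bigoplus_{n\in\mathbb{Z}}V_{(n)}$ such that $\mathbf 1\in V_{(0)}$ and $u_kV_{(n)}\subset V_{(m+n-k-1)}$ for $u\in V_{(m)}$. Graded modules: an $\mathbb{N}$-graded $V$-module is a $V$-module $W=\bigoplus_{n\in\mathbb{Z}}W(n)$ with $W(n)=0$ for $n<0$ and $u_mW(n)\subset W(k+n-m-1)$ for $u\in V_{(k)}$. It is irreducible if it is nonzero and has no graded submodules other than $0$ and itself. Two graded modules $W_1,W_2$ are equivalent if there are a $V$-module isomorphism $\psi:W_1\to W_2$ and an integer $k$ with $\psi(W_1(n))=W_2(n+k)$ for all $n$. $C_2$-cofiniteness: $C_2(V)=\mathrm{span}\{u_{-2-n}v\mid u,v\in V,\ n\in\mathbb{N}\}$, and $V$ is $C_2$-cofinite if $\dim V/C_2(V)<\infty$. Affine vertex algebras: $\mathfrak{g}$ is a restricted Lie algebra in Jacobson's sense with $p$-mapping $a\mapsto a^{[p]}$. $\hat{\mathfrak g}=\mathfrak{g}\otimes\mathbb{F}[t,t^{-1}]\oplus\mathbb{F}\mathbf k$ with $\mathbf k$ central and $[a\otimes t^m,b\otimes t^n]=[a,b]\otimes t^{m+n}+m\langle a,b\rangle\delta_{m+n,0}\mathbf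 k$; write $a(n)$ for $a\otimes t^n$. $V_{\hat{\mathfrak g}}(\ell,0)=U(\hat{\mathfrak g})\otimes_{U(\mathfrak{g}[t]\oplus\mathbb{F}\mathbf k)}\mathbb{F}_\ell$, where on $\mathbb{F}_\ell=\mathbb{F}$ the algebra $\mathfrak{g}[t]$ acts trivially and $\mathbf k$ acts as $\ell$; $\mathbf 1=1\otimes1$, and $\mathfrak{g}$ is identified with a subspace via $a\mapsto a(-1)\mathbf 1$. It has a unique vertex algebra structure with vacuum $\mathbf 1$ and $Y(a,x)=\sum_{n}a(n)x^{-n-1}$ for $a\in\mathfrak{g}$, and is $\mathbb{Z}$-graded with $\deg\mathbf 1=0$, $\deg a(n)=-n$. $J_0$ is the $\hat{\mathfrak g}$-submodule of $V_{\hat{\mathfrak g}}(\ell,0)$ generated by $(a(-m)^p-a^{[p]}(-pm))\mathbf 1$ for $a\in\mathfrak{g}$, $m\in\mathbb{Z}_+$; it is a graded ideal, and $V^0_{\hat{\mathfrak g}}(\ell,0)=V_{\hat{\mathfrak g}}(\ell,0)/J_0$ with the induced grading. *)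

theory Defs
  imports
    "HOL-Computational_Algebra.Polynomial"
    "HOL-Library.Poly_Mapping"
    "HOL-Library.Product_Plus"
begin

section \<open>Restricted Lie algebras and invariant forms\<close>

locale lie_algebra = vector_space scale
  for scale :: "'f::field \<Rightarrow> 'g::ab_group_add \<Rightarrow> 'g" +
  fixes bracket :: "'g \<Rightarrow> 'g \<Rightarrow> 'g"
  assumes bracket_linear_left: "Vector_Spaces.linear scale scale (\<lambda>x. bracket x y)"
    and bracket_linear_right: "Vector_Spaces.linear scale scale (bracket x)"
    and bracket_self: "bracket x x = 0"
    and bracket_jacobi:
      "bracket x (bracket y z) + bracket y (bracket z x) + bracket z (bracket x y) = 0"

text \<open>With the indeterminate \<open>X\<close> of the polynomial type in the role of \<open>\<lambda>\<close>, \<open>ad_pencil bracket a b\<close>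
  is the operator \<open>ad (\<lambda> a + b)\<close> on polynomials in \<open>\<lambda>\<close> with coefficients in the Lie algebra.\<close>

definition ad_pencil :: "('g \<Rightarrow> 'g \<Rightarrow> 'g) \<Rightarrow> 'g \<Rightarrow> 'g \<Rightarrow> 'g poly \<Rightarrow> ('g::ab_group_add) poly" where
  "ad_pencil bracket a b q = pCons 0 (map_poly (bracket a) q) + map_poly (bracket b) q"

text \<open>Jacobson's \<open>s\<^sub>i(a, b)\<close>: the coefficient of \<open>\<lambda>\<^bsup>i-1\<^esup>\<close> in \<open>(ad (\<lambda> a + b))\<^bsup>p-1\<^esup> a\<close>
  is \<open>i s\<^sub>i(a, b)\<close>, for \<open>1 \<le> i \<le> p - 1\<close>.\<close>

definition jacobson_s ::
  "('f::field \<Rightarrow> 'g::ab_group_add \<Rightarrow> 'g) \<Rightarrow> ('g \<Rightarrow> 'g \<Rightarrow> 'g) \<Rightarrow> nat \<Rightarrow> 'g \<Rightarrow> 'g \<Rightarrow> 'g" where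
  "jacobson_s scale bracket i a b =
     scale (inverse (of_nat i))
       (coeff ((ad_pencil bracket a b ^^ (CHAR('f) - 1)) [:a:]) (i - 1))"

locale restricted_lie_algebra = lie_algebra scale bracket
  for scale :: "'f::field \<Rightarrow> 'g::ab_group_add \<Rightarrow> 'g" and bracket :: "'g \<Rightarrow> 'g \<Rightarrow> 'g" +
  fixes pmap :: "'g \<Rightarrow> 'g"
  assumes ad_pmap: "bracket (pmap a) b = (bracket a ^^ CHAR('f)) b"
    and pmap_scale: "pmap (scale c a) = scale (c ^ CHAR('f)) (pmap a)"
    and pmap_add:
      "pmap (a + b) = pmap a + pmap b + (\<Sum>i\<in>{1..<CHAR('f)}. jacobson_s scale bracket i a b)"

locale symmetric_invariant_form =
  fixes scale :: "'f::field \<Rightarrow> 'g::ab_group_add \<Rightarrow> 'g"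
    and bracket :: "'g \<Rightarrow> 'g \<Rightarrow> 'g"
    and form :: "'g \<Rightarrow> 'g \<Rightarrow> 'f"
  assumes form_linear: "Vector_Spaces.linear scale (*) (form a)"
    and form_sym: "form a b = form b a"
    and form_invariant: "form (bracket a b) c = form a (bracket b c)"


section \<open>Vertex algebras\<close>

text \<open>The binomial coefficient with an integer upper argument; the division is exact.\<close>

definition int_binomial :: "int \<Rightarrow> nat \<Rightarrow> int" where
  "int_binomial l i = (\<Prod>j<i. l - int j) div fact i"

lemma int_binomial_mult_fact: "int_binomial l i * fact i = (\<Prod>j<i. l - int j)"
  using gbinomial_int_mult_fact'[of l i]
  by (simp add: int_binomial_def gbinomial_prod_rev lessThan_atLeast0)

text \<open>\<open>Y u n v\<close> is \<open>u\<^sub>n v\<close>. Comparing the coefficients of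
  \<open>x\<^sub>0\<^bsup>-l-1\<^esup> x\<^sub>1\<^bsup>-m-1\<^esup> x\<^sub>2\<^bsup>-n-1\<^esup>\<close> on the two sides of the Jacobi identity
  gives the equation below; on the right the coefficient of \<open>x\<^sub>0\<^sup>i x\<^sub>1\<^bsup>-m-1\<^esup>\<close> in
  \<open>(x\<^sub>1 - x\<^sub>0)\<^bsup>i-m-1\<^esup>\<close> is \<open>(-1)\<^sup>i binom(i-m-1, i) = binom(m, i)\<close>. The binomial coefficients are formed in
  the integers and then mapped to the field. By the truncation condition (which is required wherever
  \<open>jacobi_identity\<close> is used) each of the three sums has only finitely many nonzero terms.\<close>

definition jacobi_identity ::
  "('f::field \<Rightarrow> 'w::ab_group_add \<Rightarrow> 'w) \<Rightarrow> ('v \<Rightarrow> int \<Rightarrow> 'v \<Rightarrow> 'v) \<Rightarrow> ('v \<Rightarrow> int \<Rightarrow> 'w \<Rightarrow> 'w)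
    \<Rightarrow> 'v \<Rightarrow> 'v \<Rightarrow> 'w \<Rightarrow> bool" where
  "jacobi_identity scale Y YW u v w \<longleftrightarrow> (\<forall>(l::int) (m::int) (n::int).
     Sum_any (\<lambda>i::nat. scale ((-1) ^ i * of_int (int_binomial l i))
        (YW u (m + l - int i) (YW v (n + int i) w)))
   - Sum_any (\<lambda>i::nat. scale ((-1) powi l * (-1) ^ i * of_int (int_binomial l i))
        (YW v (n + l - int i) (YW u (m + int i) w)))
   = Sum_any (\<lambda>i::nat. scale (of_int (int_binomial m i))
        (YW (Y u (l + int i) v) (m + n - int i) w)))"

locale vertex_algebra = vector_space scale
  for scale :: "'f::field \<Rightarrow> 'v::ab_group_add \<Rightarrow> 'v" +
  fixes Y :: "'v \<Rightarrow> int \<Rightarrow> 'v \<Rightarrow> 'v"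
    and vac :: 'v
  assumes Y_linear_left: "Vector_Spaces.linear scale scale (\<lambda>u. Y u n v)"
    and Y_linear_right: "Vector_Spaces.linear scale scale (Y u n)"
    and Y_truncation: "\<exists>N. \<forall>n\<ge>N. Y u n v = 0"
    and Y_vacuum: "Y vac n v = (if n = -1 then v else 0)"
    and Y_creation: "n \<ge> 0 \<Longrightarrow> Y v n vac = 0" "Y v (-1) vac = v"
    and Y_jacobi: "jacobi_identity scale Y Y u v w"

definition C2_space ::
  "('f::field \<Rightarrow> 'v::ab_group_add \<Rightarrow> 'v) \<Rightarrow> ('v \<Rightarrow> int \<Rightarrow> 'v \<Rightarrow> 'v) \<Rightarrow> 'v set" where
  "C2_space scale Y = module.span scale {Y u (-2 - int n) v | u v n. True}"

text \<open>\<open>dim V / C\<^sub>2(V) < \<infinity>\<close>: finitely many cosets \<open>b + C\<^sub>2(V)\<close> span the quotient.\<close>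

definition C2_cofinite ::
  "('f::field \<Rightarrow> 'v::ab_group_add \<Rightarrow> 'v) \<Rightarrow> ('v \<Rightarrow> int \<Rightarrow> 'v \<Rightarrow> 'v) \<Rightarrow> bool" where
  "C2_cofinite scale Y \<longleftrightarrow>
     (\<exists>B. finite B \<and> (\<forall>v. \<exists>b\<in>module.span scale B. v - b \<in> C2_space scale Y))"


section \<open>Graded modules\<close>

text \<open>The underlying space of a module is a subspace \<open>carrier W\<close> of the vector space given by the
  type \<open>'w\<close> and \<open>smult W\<close>; \<open>mode W v n\<close> is \<open>v\<^sub>n\<close> and \<open>comp W n\<close> is \<open>W(n)\<close>.
  Values of \<open>mode\<close> outside the carrier are irrelevant.\<close>

record ('f, 'v, 'w) graded_module =
  carrier :: "'w set"
  smult :: "'f \<Rightarrow> 'w \<Rightarrow> 'w"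
  mode :: "'v \<Rightarrow> int \<Rightarrow> 'w \<Rightarrow> 'w"
  comp :: "int \<Rightarrow> 'w set"

text \<open>\<open>S\<close> is the internal direct sum of the subspaces \<open>G n\<close>.\<close>

definition is_direct_sum ::
  "('f::field \<Rightarrow> 'w::ab_group_add \<Rightarrow> 'w) \<Rightarrow> 'w set \<Rightarrow> (int \<Rightarrow> 'w set) \<Rightarrow> bool" where
  "is_direct_sum scale S G \<longleftrightarrow>
     (\<forall>n. module.subspace scale (G n) \<and> G n \<subseteq> S) \<and>
     (\<forall>w\<in>S. \<exists>!f :: int \<Rightarrow>\<^sub>0 'w.
        (\<forall>n. Poly_Mapping.lookup f n \<in> G n) \<and>
        w = (\<Sum>n\<in>Poly_Mapping.keys f. Poly_Mapping.lookup f n))"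

locale vertex_algebra_module =
  fixes scale :: "'f::field \<Rightarrow> 'v::ab_group_add \<Rightarrow> 'v"
    and Y :: "'v \<Rightarrow> int \<Rightarrow> 'v \<Rightarrow> 'v"
    and vac :: 'v
    and W :: "('f, 'v, 'w::ab_group_add) graded_module"
  assumes smult_vector_space: "vector_space (smult W)"
    and carrier_subspace: "module.subspace (smult W) (carrier W)"
    and mode_closed: "w \<in> carrier W \<Longrightarrow> mode W v n w \<in> carrier W"
    and mode_add_left: "w \<in> carrier W \<Longrightarrow> mode W (u + v) n w = mode W u n w + mode W v n w"
    and mode_scale_left: "w \<in> carrier W \<Longrightarrow> mode W (scale c v) n w = smult W c (mode W v n w)"
    and mode_add_right: "w \<in> carrier W \<Longrightarrow> w' \<in> carrier W \<Longrightarrow>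
          mode W v n (w + w') = mode W v n w + mode W v n w'"
    and mode_scale_right: "w \<in> carrier W \<Longrightarrow> mode W v n (smult W c w) = smult W c (mode W v n w)"
    and mode_vacuum: "w \<in> carrier W \<Longrightarrow> mode W vac n w = (if n = -1 then w else 0)"
    and mode_truncation: "w \<in> carrier W \<Longrightarrow> \<exists>N. \<forall>n\<ge>N. mode W v n w = 0"
    and mode_jacobi: "w \<in> carrier W \<Longrightarrow> jacobi_identity (smult W) Y (mode W) u v w"

text \<open>\<open>VG k\<close> is the homogeneous component \<open>V\<^bsub>(k)\<^esub>\<close> of the vertex algebra.\<close>

locale nat_graded_module = vertex_algebra_module scale Y vac W
  for scale :: "'f::field \<Rightarrow> 'v::ab_group_add \<Rightarrow> 'v"
    and Y :: "'v \<Rightarrow> int \<Rightarrow> 'v \<Rightarrow> 'v"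
    and vac :: 'v
    and W :: "('f, 'v, 'w::ab_group_add) graded_module" +
  fixes VG :: "int \<Rightarrow> 'v set"
  assumes comp_direct_sum: "is_direct_sum (smult W) (carrier W) (comp W)"
    and comp_negative: "n < 0 \<Longrightarrow> comp W n = {0}"
    and mode_comp: "u \<in> VG k \<Longrightarrow> w \<in> comp W n \<Longrightarrow> mode W u m w \<in> comp W (k + n - m - 1)"

definition graded_submodule ::
  "('f::field, 'v, 'w::ab_group_add) graded_module \<Rightarrow> 'w set \<Rightarrow> bool" where
  "graded_submodule W S \<longleftrightarrow>
     module.subspace (smult W) S \<and> S \<subseteq> carrier W \<and>
     (\<forall>v n. \<forall>w\<in>S. mode W v n w \<in> S) \<and>
     is_direct_sum (smult W) S (\<lambda>n. S \<inter> comp W n)"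

definition irreducible_nat_graded_module ::
  "('f::field \<Rightarrow> 'v::ab_group_add \<Rightarrow> 'v) \<Rightarrow> ('v \<Rightarrow> int \<Rightarrow> 'v \<Rightarrow> 'v) \<Rightarrow> 'v \<Rightarrow> (int \<Rightarrow> 'v set)
    \<Rightarrow> ('f, 'v, 'w::ab_group_add) graded_module \<Rightarrow> bool" where
  "irreducible_nat_graded_module scale Y vac VG W \<longleftrightarrow>
     nat_graded_module scale Y vac W VG \<and> carrier W \<noteq> {0} \<and>
     (\<forall>S. graded_submodule W S \<longrightarrow> S = {0} \<or> S = carrier W)"

definition graded_module_equivalent ::
  "('f, 'v, 'w1::ab_group_add) graded_module \<Rightarrow> ('f, 'v, 'w2::ab_group_add) graded_module \<Rightarrow> bool"
  where
  "graded_module_equivalent W1 W2 \<longleftrightarrow> (\<exists>\<psi> k.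
     bij_betw \<psi> (carrier W1) (carrier W2) \<and>
     (\<forall>w\<in>carrier W1. \<forall>w'\<in>carrier W1. \<psi> (w + w') = \<psi> w + \<psi> w') \<and>
     (\<forall>c. \<forall>w\<in>carrier W1. \<psi> (smult W1 c w) = smult W2 c (\<psi> w)) \<and>
     (\<forall>v n. \<forall>w\<in>carrier W1. \<psi> (mode W1 v n w) = mode W2 v n (\<psi> w)) \<and>
     (\<forall>n. \<psi> ` comp W1 n = comp W2 (n + k)))"


section \<open>Affine Lie algebras and the vacuum module\<close>

text \<open>A pair \<open>(f, z)\<close> stands for \<open>\<Sum>\<^sub>n f(n) \<otimes> t\<^sup>n + z k\<close>.\<close>

type_synonym ('f, 'g) affine = "(int \<Rightarrow>\<^sub>0 'g) \<times> 'f"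

definition loop_elt :: "'g::ab_group_add \<Rightarrow> int \<Rightarrow> ('f::field, 'g) affine" where
  "loop_elt a n = (Poly_Mapping.single n a, 0)"

definition affine_scale ::
  "('f::field \<Rightarrow> 'g::ab_group_add \<Rightarrow> 'g) \<Rightarrow> 'f \<Rightarrow> ('f, 'g) affine \<Rightarrow> ('f, 'g) affine" where
  "affine_scale scale c x = (Poly_Mapping.map (scale c) (fst x), c * snd x)"

definition affine_bracket ::
  "('g::ab_group_add \<Rightarrow> 'g \<Rightarrow> 'g) \<Rightarrow> ('g \<Rightarrow> 'g \<Rightarrow> 'f::field)
    \<Rightarrow> ('f, 'g) affine \<Rightarrow> ('f, 'g) affine \<Rightarrow> ('f, 'g) affine" where
  "affine_bracket bracket form x y =
     (\<Sum>m\<in>Poly_Mapping.keys (fst x). \<Sum>n\<in>Poly_Mapping.keys (fst y).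
        (Poly_Mapping.single (m + n)
           (bracket (Poly_Mapping.lookup (fst x) m) (Poly_Mapping.lookup (fst y) n)),
         if m + n = 0
         then of_int m * form (Poly_Mapping.lookup (fst x) m) (Poly_Mapping.lookup (fst y) n)
         else 0))"

lemma affine_bracket_loop_elt:
  assumes "lie_algebra scale bracket" and "symmetric_invariant_form scale bracket form"
  shows "affine_bracket bracket form (loop_elt a m) (loop_elt b n) =
     loop_elt (bracket a b) (m + n) + (0, if m + n = 0 then of_int m * form a b else 0)"
proof -
  interpret A: lie_algebra scale bracket by fact
  interpret B: symmetric_invariant_form scale bracket form by fact
  have 1: "bracket 0 y = 0" "bracket y 0 = 0" for y
    using A.bracket_linear_left A.bracket_linear_right
    by (metis module_hom.zero Vector_Spaces.linear.axioms(3))+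
  have 2: "form y 0 = 0" for y
    using B.form_linear by (metis module_hom.zero Vector_Spaces.linear.axioms(3))
  have 3: "form 0 y = 0" for y using 2 B.form_sym by metis
  show ?thesis by (auto simp: affine_bracket_def loop_elt_def zero_prod_def 1 2 3)
qed

text \<open>The subalgebra \<open>g[t] \<oplus> F k\<close>; it acts on \<open>F\<^bsub>lev\<^esub>\<close> through the character \<open>x \<mapsto> lev * snd x\<close>.\<close>

definition affine_nonneg :: "('f::field, 'g::ab_group_add) affine set" where
  "affine_nonneg = {x. \<forall>n<0. Poly_Mapping.lookup (fst x) n = 0}"

locale affine_representation = vector_space scaleV
  for scale :: "'f::field \<Rightarrow> 'g::ab_group_add \<Rightarrow> 'g"
    and bracket :: "'g \<Rightarrow> 'g \<Rightarrow> 'g"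
    and form :: "'g \<Rightarrow> 'g \<Rightarrow> 'f"
    and scaleV :: "'f \<Rightarrow> 'v::ab_group_add \<Rightarrow> 'v" +
  fixes \<rho> :: "('f, 'g) affine \<Rightarrow> 'v \<Rightarrow> 'v"
  assumes rep_linear: "Vector_Spaces.linear scaleV scaleV (\<rho> x)"
    and rep_add: "\<rho> (x + y) v = \<rho> x v + \<rho> y v"
    and rep_scale: "\<rho> (affine_scale scale c x) v = scaleV c (\<rho> x v)"
    and rep_bracket: "\<rho> (affine_bracket bracket form x y) v = \<rho> x (\<rho> y v) - \<rho> y (\<rho> x v)"

text \<open>Finitely supported functions on words over \<open>X\<close> form the free associative algebra on the set \<open>X\<close>
  (the product, concatenation of words, is not needed as an operation).\<close>

type_synonym ('f, 'x) free_algebra = "'x list \<Rightarrow>\<^sub>0 'f"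

definition free_scale :: "'f::field \<Rightarrow> ('f, 'x) free_algebra \<Rightarrow> ('f, 'x) free_algebra" where
  "free_scale c u = Poly_Mapping.map ((*) c) u"

definition word :: "'x list \<Rightarrow> ('f::field, 'x) free_algebra" where
  "word xs = Poly_Mapping.single xs 1"

text \<open>The two-sided ideal whose quotient is the universal enveloping algebra of the affine algebra:
  words are made multilinear, and commutators are identified with brackets.\<close>

definition enveloping_relations ::
  "('f::field \<Rightarrow> 'g::ab_group_add \<Rightarrow> 'g) \<Rightarrow> ('g \<Rightarrow> 'g \<Rightarrow> 'g) \<Rightarrow> ('g \<Rightarrow> 'g \<Rightarrow> 'f)
    \<Rightarrow> ('f, ('f, 'g) affine) free_algebra set" where
  "enveloping_relations scale bracket form =
     {word (us @ [x + y] @ vs) - word (us @ [x] @ vs) - word (us @ [y] @ vs) | us vs x y. True} \<union>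
     {word (us @ [affine_scale scale c x] @ vs) - free_scale c (word (us @ [x] @ vs))
        | us vs c x. True} \<union>
     {word (us @ [x, y] @ vs) - word (us @ [y, x] @ vs)
        - word (us @ [affine_bracket bracket form x y] @ vs) | us vs x y. True}"

text \<open>As \<open>F\<^bsub>lev\<^esub>\<close> is one-dimensional, the tensor product of the enveloping algebra with \<open>F\<^bsub>lev\<^esub>\<close> over
  the enveloping algebra of \<open>g[t] \<oplus> F k\<close> is the quotient of the enveloping algebra by the balancing
  relations \<open>u b \<otimes> 1 = u \<otimes> b 1\<close>; these are spanned by the ones with \<open>u\<close> a word and
  \<open>b\<close> in \<open>g[t] \<oplus> F k\<close>.\<close>

definition balancing_relations :: "'f::field \<Rightarrow> ('f, ('f, 'g::ab_group_add) affine) free_algebra set" where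
  "balancing_relations lev =
     {word (us @ [b]) - free_scale (lev * snd b) (word us) | us b. b \<in> affine_nonneg}"

definition vacuum_relations ::
  "('f::field \<Rightarrow> 'g::ab_group_add \<Rightarrow> 'g) \<Rightarrow> ('g \<Rightarrow> 'g \<Rightarrow> 'g) \<Rightarrow> ('g \<Rightarrow> 'g \<Rightarrow> 'f) \<Rightarrow> 'f
    \<Rightarrow> ('f, ('f, 'g) affine) free_algebra set" where
  "vacuum_relations scale bracket form lev =
     module.span free_scale (enveloping_relations scale bracket form \<union> balancing_relations lev)"

text \<open>The map sending a word \<open>x\<^sub>1 \<dots> x\<^sub>r\<close> to \<open>x\<^sub>1 \<cdots> x\<^sub>r v\<close>.\<close>

definition word_action ::
  "('f::field \<Rightarrow> 'v::ab_group_add \<Rightarrow> 'v) \<Rightarrow> ('x \<Rightarrow> 'v \<Rightarrow> 'v) \<Rightarrow> 'v \<Rightarrow> ('f, 'x) free_algebra \<Rightarrow> 'v" where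
  "word_action scaleV \<rho> v u =
     (\<Sum>xs\<in>Poly_Mapping.keys u. scaleV (Poly_Mapping.lookup u xs) (foldr \<rho> xs v))"

lemma lookup_free_scale:
  "Poly_Mapping.lookup (free_scale c u) xs = c * Poly_Mapping.lookup u xs"
  by (simp add: free_scale_def map.rep_eq when_def)

lemma vector_space_free_scale: "vector_space free_scale"
  by unfold_locales (auto intro!: poly_mapping_eqI simp: lookup_free_scale lookup_add algebra_simps)

context
  fixes scaleV :: "'f::field \<Rightarrow> 'v::ab_group_add \<Rightarrow> 'v" and \<sigma> :: "'x \<Rightarrow> 'v \<Rightarrow> 'v" and w :: 'v
  assumes V: "vector_space scaleV"
begin

interpretation V: vector_space scaleV by (fact V)

lemma word_action_superset:
  assumes "finite K" "Poly_Mapping.keys u \<subseteq> K"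
  shows "word_action scaleV \<sigma> w u = (\<Sum>xs\<in>K. scaleV (Poly_Mapping.lookup u xs) (foldr \<sigma> xs w))"
  unfolding word_action_def
  by (rule sum.mono_neutral_left) (use assms in \<open>auto simp: in_keys_iff\<close>)

lemma linear_word_action: "Vector_Spaces.linear free_scale scaleV (word_action scaleV \<sigma> w)"
proof -
  interpret F: vector_space "free_scale :: 'f \<Rightarrow> ('f, 'x) free_algebra \<Rightarrow> _"
    by (rule vector_space_free_scale)
  show ?thesis
  proof unfold_locales
    fix u u' :: "('f, 'x) free_algebra"
    let ?K = "Poly_Mapping.keys u \<union> Poly_Mapping.keys u'"
    have "Poly_Mapping.keys (u + u') \<subseteq> ?K" by (rule Poly_Mapping.keys_add)
    then show "word_action scaleV \<sigma> w (u + u') = word_action scaleV \<sigma> w u + word_action scaleV \<sigma> w u'"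
      using word_action_superset[of ?K u] word_action_superset[of ?K u'] word_action_superset[of ?K "u + u'"]
      by (simp add: lookup_free_scale lookup_add V.scale_left_distrib sum.distrib)
  next
    fix c and u :: "('f, 'x) free_algebra"
    have "Poly_Mapping.keys (free_scale c u) \<subseteq> Poly_Mapping.keys u"
      by (auto simp: in_keys_iff lookup_free_scale)
    then show "word_action scaleV \<sigma> w (free_scale c u) = scaleV c (word_action scaleV \<sigma> w u)"
      using word_action_superset[of "Poly_Mapping.keys u" u]
        word_action_superset[of "Poly_Mapping.keys u" "free_scale c u"]
      by (simp add: lookup_free_scale V.scale_sum_right)
  qed
qed

lemma word_action_word [simp]: "word_action scaleV \<sigma> w (word xs) = foldr \<sigma> xs w"
  by (simp add: word_action_def word_def)

end

lemma free_algebra_span_words: "u \<in> module.span free_scale (range word)"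
proof -
  interpret F: vector_space "free_scale :: 'f::field \<Rightarrow> ('f, 'x) free_algebra \<Rightarrow> _"
    by (rule vector_space_free_scale)
  have "u = (\<Sum>xs\<in>Poly_Mapping.keys u. free_scale (Poly_Mapping.lookup u xs) (word xs))"
    by (rule poly_mapping_eqI)
       (simp add: lookup_free_scale lookup_sum word_def lookup_single when_def in_keys_iff if_distrib sum.delta cong: if_cong)
  also have "\<dots> \<in> F.span (range word)"
    by (intro F.span_sum F.span_scale F.span_base) auto
  finally show ?thesis .
qed

text \<open>The vacuum module of level \<open>lev\<close>, characterised up to unique isomorphism: a module \<open>V\<close> over the
  affine algebra with a vector \<open>vac\<close> for which \<open>u \<otimes> 1 \<mapsto> u vac\<close> is a well-defined isomorphism from the
  induced module onto \<open>V\<close>.\<close>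

locale vacuum_module = affine_representation scale bracket form scaleV \<rho>
  for scale :: "'f::field \<Rightarrow> 'g::ab_group_add \<Rightarrow> 'g"
    and bracket :: "'g \<Rightarrow> 'g \<Rightarrow> 'g"
    and form :: "'g \<Rightarrow> 'g \<Rightarrow> 'f"
    and scaleV :: "'f \<Rightarrow> 'v::ab_group_add \<Rightarrow> 'v"
    and \<rho> :: "('f, 'g) affine \<Rightarrow> 'v \<Rightarrow> 'v" +
  fixes lev :: 'f and vac :: 'v
  assumes induced_surj: "surj (word_action scaleV \<rho> vac)"
    and induced_kernel:
      "word_action scaleV \<rho> vac u = 0 \<longleftrightarrow> u \<in> vacuum_relations scale bracket form lev"

text \<open>Hence \<open>V\<close> has the universal property of the module induced from the character
  \<open>b \<mapsto> lev * snd b\<close> of \<open>g[t] \<oplus> F k\<close>.\<close>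

lemma (in affine_representation) vacuum_relations_act_trivially:
  assumes "\<And>b. b \<in> affine_nonneg \<Longrightarrow> \<rho> b w = scaleV (lev * snd b) w"
    and "u \<in> vacuum_relations scale bracket form lev"
  shows "word_action scaleV \<rho> w u = 0"
proof -
  note V = vector_space_axioms
  interpret F: vector_space "free_scale :: 'f \<Rightarrow> ('f, ('f, 'g) affine) free_algebra \<Rightarrow> _"
    by (rule vector_space_free_scale)
  interpret W: Vector_Spaces.linear free_scale scaleV "word_action scaleV \<rho> w"
    by (rule linear_word_action[OF V])
  interpret R: Vector_Spaces.linear scaleV scaleV "\<rho> x" for x by (rule rep_linear)
  have fold_lin: "Vector_Spaces.linear scaleV scaleV (foldr \<rho> us)" for us
  proof (induction us)
    case (Cons x us)
    then show ?case using Vector_Spaces.linear_compose[OF Cons.IH rep_linear[of x]] by (simp add: o_def)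
  qed (simp add: linear_ident)
  interpret G: Vector_Spaces.linear scaleV scaleV "foldr \<rho> us" for us by (rule fold_lin)
  have rep_add_pair: "\<rho> (a + a', b + b') v = \<rho> (a, b) v + \<rho> (a', b') v" for a a' b b' v
    using rep_add[of "(a, b)" "(a', b')"] by simp
  show ?thesis
    using assms(2) unfolding vacuum_relations_def
  proof (induction rule: F.span_induct)
    case base
    show ?case by (auto simp: F.subspace_def W.add W.scale W.zero)
  next
    case (step x)
    then show ?case
      by (auto simp: enveloping_relations_def balancing_relations_def W.diff W.scale
          word_action_word[OF V] rep_add_pair rep_scale rep_bracket G.add G.diff G.scale assms(1))
  qed
qed

lemma (in vacuum_module) induced_universal:
  fixes scaleM :: "'f \<Rightarrow> 'm::ab_group_add \<Rightarrow> 'm" and \<sigma> :: "('f, 'g) affine \<Rightarrow> 'm \<Rightarrow> 'm"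
  assumes M: "affine_representation scale bracket form scaleM \<sigma>"
    and w: "\<And>b. b \<in> affine_nonneg \<Longrightarrow> \<sigma> b w = scaleM (lev * snd b) w"
  shows "\<exists>!f. Vector_Spaces.linear scaleV scaleM f \<and> f vac = w \<and> (\<forall>x v. f (\<rho> x v) = \<sigma> x (f v))"
proof -
  interpret M: affine_representation scale bracket form scaleM \<sigma> by (fact M)
  note V = vector_space_axioms and MV = M.vector_space_axioms
  interpret F: vector_space "free_scale :: 'f \<Rightarrow> ('f, ('f, 'g) affine) free_algebra \<Rightarrow> _"
    by (rule vector_space_free_scale)
  let ?e = "word_action scaleV \<rho> vac" and ?h = "word_action scaleM \<sigma> w"
  interpret E: Vector_Spaces.linear free_scale scaleV ?e by (rule linear_word_action[OF V])
  interpret H: Vector_Spaces.linear free_scale scaleM ?h by (rule linear_word_action[OF MV])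
  have well: "?h u = ?h u'" if "?e u = ?e u'" for u u'
  proof -
    have "?e (u - u') = 0" using that by (simp add: E.diff)
    then have "?h (u - u') = 0"
      using M.vacuum_relations_act_trivially[OF w] induced_kernel by blast
    then show ?thesis by (simp add: H.diff)
  qed
  define f where "f v = ?h (inv ?e v)" for v
  have f: "f (?e u) = ?h u" for u
    unfolding f_def by (rule well) (simp add: surj_f_inv_f[OF induced_surj])
  have ex: "\<exists>u. v = ?e u" for v using induced_surj by (rule surjD)
  have lin: "Vector_Spaces.linear scaleV scaleM f"
  proof unfold_locales
    show "f (v + v') = f v + f v'" for v v'
      using ex[of v] ex[of v'] by (metis E.add H.add f)
    show "f (scaleV c v) = scaleM c (f v)" for c v
      using ex[of v] by (metis E.scale H.scale f)
  qed
  interpret f: Vector_Spaces.linear scaleV scaleM f by (rule lin)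
  interpret R: Vector_Spaces.linear scaleV scaleV "\<rho> x" for x by (rule rep_linear)
  interpret S: Vector_Spaces.linear scaleM scaleM "\<sigma> x" for x by (rule M.rep_linear)
  have span: "v \<in> span (range (\<lambda>xs. foldr \<rho> xs vac))" for v
  proof -
    obtain u where u: "v = ?e u" using ex by blast
    have "?e u \<in> ?e ` F.span (range word)" using free_algebra_span_words by blast
    also have "\<dots> = span (?e ` range word)" by (rule E.span_image[symmetric])
    finally show ?thesis by (simp add: u image_image word_action_word[OF V])
  qed
  have fw: "f (foldr \<rho> xs vac) = foldr \<sigma> xs w" for xs
    using f[of "word xs"] by (simp add: word_action_word[OF V] word_action_word[OF MV])
  have equiv: "f (\<rho> x v) = \<sigma> x (f v)" for x v
    using span[of v]
  proof (induction rule: span_induct)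
    case base
    show ?case by (auto simp: subspace_def R.add f.add S.add R.scale f.scale S.scale R.zero f.zero S.zero)
  next
    case (step y)
    then obtain xs where y: "y = foldr \<rho> xs vac" by auto
    show ?case using fw[of "x # xs"] fw[of xs] by (simp add: y)
  qed
  show ?thesis
  proof (rule ex1I[of _ f])
    show "Vector_Spaces.linear scaleV scaleM f \<and> f vac = w \<and> (\<forall>x v. f (\<rho> x v) = \<sigma> x (f v))"
      using lin equiv fw[of "[]"] by simp
  next
    fix g assume g: "Vector_Spaces.linear scaleV scaleM g \<and> g vac = w \<and> (\<forall>x v. g (\<rho> x v) = \<sigma> x (g v))"
    interpret g: Vector_Spaces.linear scaleV scaleM g using g by blast
    have gw: "g (foldr \<rho> xs vac) = foldr \<sigma> xs w" for xs by (induction xs) (use g in auto)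
    show "g = f"
    proof
      fix v
      show "g v = f v" using span[of v]
      proof (induction rule: span_induct)
        case base
        show ?case by (auto simp: subspace_def f.add g.add f.scale g.scale f.zero g.zero)
      qed (auto simp: fw gw)
    qed
  qed
qed

text \<open>Here the vacuum module carries its vertex algebra structure; \<open>Y_generator\<close> says that
  \<open>a = a(-1) vac\<close> has the field \<open>\<Sum>\<^sub>n a(n) x\<^bsup>-n-1\<^esup>\<close>.\<close>

locale affine_vertex_algebra =
  vacuum_module scale bracket form scaleV \<rho> lev vac + vertex_algebra scaleV Y vac
  for scale :: "'f::field \<Rightarrow> 'g::ab_group_add \<Rightarrow> 'g"
    and bracket :: "'g \<Rightarrow> 'g \<Rightarrow> 'g"
    and form :: "'g \<Rightarrow> 'g \<Rightarrow> 'f"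
    and lev :: 'f
    and scaleV :: "'f \<Rightarrow> 'v::ab_group_add \<Rightarrow> 'v"
    and \<rho> :: "('f, 'g) affine \<Rightarrow> 'v \<Rightarrow> 'v"
    and Y :: "'v \<Rightarrow> int \<Rightarrow> 'v \<Rightarrow> 'v"
    and vac :: 'v +
  assumes Y_generator: "Y (\<rho> (loop_elt a (-1)) vac) n v = \<rho> (loop_elt a n) v"

text \<open>The grading with \<open>deg vac = 0\<close> and \<open>deg a(n) = -n\<close>.\<close>

definition affine_component ::
  "('f::field \<Rightarrow> 'v::ab_group_add \<Rightarrow> 'v) \<Rightarrow> (('f, 'g::ab_group_add) affine \<Rightarrow> 'v \<Rightarrow> 'v) \<Rightarrow> 'v
    \<Rightarrow> int \<Rightarrow> 'v set" where
  "affine_component scaleV \<rho> vac n =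
     module.span scaleV
       {foldr (\<lambda>(a, m). \<rho> (loop_elt a m)) xs vac | xs. - (\<Sum>(a, m)\<leftarrow>xs. m) = n}"

text \<open>The submodule \<open>J\<^sub>0\<close> over the affine algebra.\<close>

definition p_ideal ::
  "('g::ab_group_add \<Rightarrow> 'g) \<Rightarrow> ('f::field \<Rightarrow> 'v::ab_group_add \<Rightarrow> 'v)
    \<Rightarrow> (('f, 'g) affine \<Rightarrow> 'v \<Rightarrow> 'v) \<Rightarrow> 'v \<Rightarrow> 'v set" where
  "p_ideal pmap scaleV \<rho> vac =
     (\<lambda>S. module.subspace scaleV S \<and> (\<forall>x. \<forall>v\<in>S. \<rho> x v \<in> S)) hull
       {(\<rho> (loop_elt a (- int m)) ^^ CHAR('f)) vac
          - \<rho> (loop_elt (pmap a) (- int (CHAR('f) * m))) vac | a m. m > 0}"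

text \<open>The quotient of a vertex algebra by an ideal \<open>J\<close>, characterised up to unique isomorphism by
  its quotient map \<open>\<pi>\<close>; its vacuum is \<open>\<pi> vac\<close>.\<close>

locale quotient_vertex_algebra =
  fixes scaleV :: "'f::field \<Rightarrow> 'v::ab_group_add \<Rightarrow> 'v"
    and Y :: "'v \<Rightarrow> int \<Rightarrow> 'v \<Rightarrow> 'v"
    and J :: "'v set"
    and scaleQ :: "'f \<Rightarrow> 'q::ab_group_add \<Rightarrow> 'q"
    and YQ :: "'q \<Rightarrow> int \<Rightarrow> 'q \<Rightarrow> 'q"
    and \<pi> :: "'v \<Rightarrow> 'q"
  assumes quotient_linear: "Vector_Spaces.linear scaleV scaleQ \<pi>"
    and quotient_surj: "surj \<pi>"
    and quotient_kernel: "\<pi> v = 0 \<longleftrightarrow> v \<in> J"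
    and quotient_Y: "\<pi> (Y u n v) = YQ (\<pi> u) n (\<pi> v)"

lemma (in quotient_vertex_algebra) quotient_is_vertex_algebra:
  assumes "vertex_algebra scaleV Y vac"
  shows "vertex_algebra scaleQ YQ (\<pi> vac)"
proof -
  interpret V: vertex_algebra scaleV Y vac by fact
  interpret P: Vector_Spaces.linear scaleV scaleQ \<pi> by (rule quotient_linear)
  interpret L: Vector_Spaces.linear scaleV scaleV "\<lambda>u. Y u n v" for n v by (rule V.Y_linear_left)
  interpret R: Vector_Spaces.linear scaleV scaleV "Y u n" for u n by (rule V.Y_linear_right)
  have ex: "\<exists>v. x = \<pi> v" for x using quotient_surj by (rule surjD)
  have PS: "\<pi> (Sum_any f) = Sum_any (\<lambda>i. \<pi> (f i))" if fin: "\<exists>N. \<forall>i\<ge>N. f i = 0" for f :: "nat \<Rightarrow> _"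
  proof -
    obtain N where N: "\<And>i. i \<ge> N \<Longrightarrow> f i = 0" using fin by blast
    then have sub: "{i. f i \<noteq> 0} \<subseteq> {..<N}" "{i. \<pi> (f i) \<noteq> 0} \<subseteq> {..<N}"
      by (auto simp: P.zero not_le[symmetric])
    show ?thesis
      by (simp add: Sum_any.expand_superset[OF _ sub(1)] Sum_any.expand_superset[OF _ sub(2)] P.sum)
  qed
  have tr: "\<exists>N. \<forall>i\<ge>N. scaleV (c i) (Y' (Y u (n + int i) v) i) = 0"
    if Y': "\<And>i. Y' 0 i = 0" for c Y' u n v
  proof -
    obtain N where N: "\<And>k. k \<ge> N \<Longrightarrow> Y u k v = 0" using V.Y_truncation by blast
    have "Y u (n + int i) v = 0" if "i \<ge> nat (N - n)" for i using that by (intro N) linarith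
    then show ?thesis using Y' by (metis V.scale_zero_right)
  qed
  show ?thesis
  proof unfold_locales
    fix a b x y n
    obtain x' y' b' where [simp]: "x = \<pi> x'" "y = \<pi> y'" "b = \<pi> b'" using ex by metis
    have lin_L_add: "Y (x' + y') n b' = Y x' n b' + Y y' n b'" by (rule L.add)
    have lin_L_scale: "Y (scaleV a x') n b' = scaleV a (Y x' n b')" by (rule L.scale)
    have lin_R_add: "Y b' n (x' + y') = Y b' n x' + Y b' n y'" by (rule R.add)
    have lin_R_scale: "Y b' n (scaleV a x') = scaleV a (Y b' n x')" by (rule R.scale)
    show "YQ (x + y) n b = YQ x n b + YQ y n b"
      using arg_cong[OF lin_L_add, of \<pi>] by (simp add: P.add quotient_Y)
    show "YQ (scaleQ a x) n b = scaleQ a (YQ x n b)"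
      using arg_cong[OF lin_L_scale, of \<pi>] by (simp add: P.scale quotient_Y)
    show "YQ b n (x + y) = YQ b n x + YQ b n y"
      using arg_cong[OF lin_R_add, of \<pi>] by (simp add: P.add quotient_Y)
    show "YQ b n (scaleQ a x) = scaleQ a (YQ b n x)"
      using arg_cong[OF lin_R_scale, of \<pi>] by (simp add: P.scale quotient_Y)
    obtain N where "\<And>k. k \<ge> N \<Longrightarrow> Y x' k y' = 0" using V.Y_truncation by blast
    then have "YQ x k y = 0" if "k \<ge> N" for k
      using that quotient_Y[of x' k y'] by (simp add: P.zero)
    then show "\<exists>N. \<forall>n\<ge>N. YQ x n y = 0" by blast
    show "YQ (\<pi> vac) n x = (if n = -1 then x else 0)"
      using arg_cong[OF V.Y_vacuum[of n x'], of \<pi>] by (simp add: quotient_Y P.zero split: if_splits)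
    show "YQ x n (\<pi> vac) = 0" if "n \<ge> 0"
      using arg_cong[OF V.Y_creation(1)[OF that, of x'], of \<pi>] by (simp add: quotient_Y P.zero)
    show "YQ x (-1) (\<pi> vac) = x"
      using arg_cong[OF V.Y_creation(2)[of x'], of \<pi>] by (simp add: quotient_Y)
  next
    fix x y z
    obtain u v w where [simp]: "x = \<pi> u" "y = \<pi> v" "z = \<pi> w" using ex by metis
    show "jacobi_identity scaleQ YQ YQ x y z"
      unfolding jacobi_identity_def
    proof (intro allI)
      fix l m n
      let ?A = "\<lambda>i. scaleV ((- 1) ^ i * of_int (int_binomial l i)) (Y u (m + l - int i) (Y v (n + int i) w))"
      let ?B = "\<lambda>i. scaleV ((- 1) powi l * (- 1) ^ i * of_int (int_binomial l i)) (Y v (n + l - int i) (Y u (m + int i) w))"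
      let ?C = "\<lambda>i. scaleV (of_int (int_binomial m i)) (Y (Y u (l + int i) v) (m + n - int i) w)"
      have "Sum_any ?A - Sum_any ?B = Sum_any ?C"
        using V.Y_jacobi[of u v w] unfolding jacobi_identity_def by blast
      then have "\<pi> (Sum_any ?A) - \<pi> (Sum_any ?B) = \<pi> (Sum_any ?C)"
        by (simp flip: P.diff)
      moreover have "\<exists>N. \<forall>i\<ge>N. ?A i = 0"
        by (rule tr[where Y' = "\<lambda>z i. Y u (m + l - int i) z"]) (simp add: R.zero)
      moreover have "\<exists>N. \<forall>i\<ge>N. ?B i = 0"
        by (rule tr[where Y' = "\<lambda>z i. Y v (n + l - int i) z"]) (simp add: R.zero)
      moreover have "\<exists>N. \<forall>i\<ge>N. ?C i = 0"
        by (rule tr[where Y' = "\<lambda>z i. Y z (m + n - int i) w"]) (simp add: L.zero)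
      ultimately show "Sum_any (\<lambda>i. scaleQ ((- 1) ^ i * of_int (int_binomial l i)) (YQ x (m + l - int i) (YQ y (n + int i) z)))
         - Sum_any (\<lambda>i. scaleQ ((- 1) powi l * (- 1) ^ i * of_int (int_binomial l i)) (YQ y (n + l - int i) (YQ x (m + int i) z)))
         = Sum_any (\<lambda>i. scaleQ (of_int (int_binomial m i)) (YQ (YQ x (l + int i) y) (m + n - int i) z))"
        by (simp add: PS P.scale quotient_Y)
    qed
  qed
qed

end

theory Submission
  imports Defs "HOL-Library.Function_Algebras" "HOL-Library.Countable_Set" "HOL-Library.Multiset"
    "HOL-Library.FuncSet"
begin

text \<open>
  Modulo \<open>C\<^sub>2\<close> the operators \<open>a(-1)\<close> commute and have vanishing \<open>p\<close>-th powers on the vacuum,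
  because \<open>a(-1)\<^sup>p vac = a\<^bsup>[p]\<^esup>(-p) vac\<close>; so finitely many monomials in a basis span the quotient.

  On the lowest component of a graded module the same relation gives \<open>a(0)\<^sup>p = a\<^bsup>[p]\<^esup>(0)\<close>. For
  pairwise inequivalent irreducible modules \<open>W\<^sub>i\<close> with lowest vectors \<open>w\<^sub>i\<close>, the module generated by
  the tuple \<open>(w\<^sub>i)\<close> contains, for each \<open>i\<close>, a tuple of lowest vectors with nonzero \<open>i\<close>-th coordinate and
  vanishing earlier coordinates (otherwise a submodule is the graph of an isomorphism between
  two of the modules). These tuples are linearly independent and lie in the span of the restricted
  monomials in the \<open>a(0)\<close> applied to \<open>(w\<^sub>i)\<close>, whose number depends only on \<open>p\<close> and \<open>dim g\<close>; so there
  are only finitely many classes. An irreducible module has countable dimension, so it has a copy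
  inside the finitely supported sequences.
\<close>

text \<open>The counting argument takes the place of a classification of the simple modules of the
  restricted enveloping algebra: its dimension, \<open>p\<close> to the power \<open>dim g\<close>,
  is the bound, and linear independence alone produces it. The relation
  \<open>a(0)^p = a^[p](0)\<close> is established on lowest components only, since its derivation
  discards every term that would fall below them; hence modules are compared through tuples of
  lowest vectors, with each module shifted so that its lowest component has degree 0. A product of
  infinitely many graded modules is in general not spanned by homogeneous tuples, so homogeneity is
  imposed on the subspaces of tuples that occur. Inside such a subspace the degree 0 part is
  isolated by triangular decomposition: positive modes kill lowest vectors and negative modes raise
  the degree. One spanning theorem relative to a stable subspace \<open>K\<close> serves both
  halves, with \<open>K\<close> equal to \<open>C2\<close> for cofiniteness and to
  \<open>{0}\<close> for the zero modes. The copies in finitely supported sequences give the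
  representatives a type that does not mention the type of the given modules.\<close>

lemma int_binomial_0_right [simp]: "int_binomial l 0 = 1"
  by (simp add: int_binomial_def)

lemma int_binomial_1_right [simp]: "int_binomial l (Suc 0) = l"
  by (simp add: int_binomial_def)

lemma int_binomial_0_left [simp]: "int_binomial 0 i = (if i = 0 then 1 else 0)"
proof (cases i)
  case (Suc j)
  have "(\<Prod>j<i. 0 - int j) = 0" by (rule prod_zero) (auto simp: Suc)
  then show ?thesis unfolding int_binomial_def by (simp only: div_0) (simp add: Suc)
qed simp

lemma Sum_any_single:
  assumes "\<And>i. i \<noteq> k \<Longrightarrow> f i = 0"
  shows "Sum_any f = f k"
proof -
  have "Sum_any f = (\<Sum>i\<in>{k}. f i)"
    by (rule Sum_any.expand_superset) (use assms in auto)
  then show ?thesis by simp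
qed

lemma (in module) Sum_any_in_subspace:
  assumes "subspace S" "\<And>i. f i \<in> S"
  shows "Sum_any f \<in> S"
  unfolding Sum_any.expand_set by (rule subspace_sum[OF assms(1)]) (rule assms(2))

section \<open>Internal direct sums\<close>

context vector_space
begin

text \<open>The sums of such families form a subspace that contains every \<open>G k\<close>.
  Families are finitely supported maps so that the result matches
  \<open>is_direct_sum\<close>.\<close>

lemma span_Union_subspaces:
  assumes G: "\<And>k :: 'i. subspace (G k)" and u: "u \<in> span (\<Union>k. G k)"
  shows "\<exists>f :: 'i \<Rightarrow>\<^sub>0 'b. (\<forall>k. Poly_Mapping.lookup f k \<in> G k) \<and> u = (\<Sum>k\<in>Poly_Mapping.keys f. Poly_Mapping.lookup f k)"
proof -
  \<comment> \<open>Sums over the supports of \<open>f\<close>, \<open>g\<close> and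
    \<open>f + g\<close> become comparable once all are extended to one finite set.\<close>
  have sup: "(\<Sum>k\<in>Poly_Mapping.keys f. Poly_Mapping.lookup f k) = (\<Sum>k\<in>K. Poly_Mapping.lookup f k)"
    if "finite K" "Poly_Mapping.keys f \<subseteq> K" for K and f :: "'i \<Rightarrow>\<^sub>0 'b"
    by (rule sum.mono_neutral_left) (use that in \<open>auto simp: in_keys_iff\<close>)
  let ?S = "{u. \<exists>f :: 'i \<Rightarrow>\<^sub>0 'b. (\<forall>k. Poly_Mapping.lookup f k \<in> G k) \<and> u = (\<Sum>k\<in>Poly_Mapping.keys f. Poly_Mapping.lookup f k)}"
  have "subspace ?S"
  proof (rule subspaceI)
    show "0 \<in> ?S" by (auto intro!: exI[of _ 0] subspace_0 G)
  next
    fix x y assume "x \<in> ?S" "y \<in> ?S"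
    then obtain f g where f: "\<forall>k. Poly_Mapping.lookup f k \<in> G k" "x = (\<Sum>k\<in>Poly_Mapping.keys f. Poly_Mapping.lookup f k)"
      and g: "\<forall>k. Poly_Mapping.lookup g k \<in> G k" "y = (\<Sum>k\<in>Poly_Mapping.keys g. Poly_Mapping.lookup g k)" by blast
    let ?K = "Poly_Mapping.keys f \<union> Poly_Mapping.keys g"
    have "x + y = (\<Sum>k\<in>Poly_Mapping.keys (f + g). Poly_Mapping.lookup (f + g) k)"
      using sup[of ?K f] sup[of ?K g] sup[of ?K "f + g"] f g keys_add[of f g]
      by (simp add: lookup_add sum.distrib)
    moreover have "\<forall>k. Poly_Mapping.lookup (f + g) k \<in> G k" using f g G by (simp add: lookup_add subspace_add)
    ultimately show "x + y \<in> ?S" by blast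
  next
    fix c x assume "x \<in> ?S"
    then obtain f where f: "\<forall>k. Poly_Mapping.lookup f k \<in> G k" "x = (\<Sum>k\<in>Poly_Mapping.keys f. Poly_Mapping.lookup f k)" by blast
    let ?g = "Poly_Mapping.map (scale c) f"
    have l: "Poly_Mapping.lookup ?g k = c *s Poly_Mapping.lookup f k" for k by (simp add: map.rep_eq when_def)
    have "Poly_Mapping.keys ?g \<subseteq> Poly_Mapping.keys f" by (auto simp: in_keys_iff l)
    then have "c *s x = (\<Sum>k\<in>Poly_Mapping.keys ?g. Poly_Mapping.lookup ?g k)"
      using sup[of "Poly_Mapping.keys f" ?g] f by (simp add: l scale_sum_right)
    moreover have "\<forall>k. Poly_Mapping.lookup ?g k \<in> G k" using f G by (simp add: l subspace_scale)
    ultimately show "c *s x \<in> ?S" by blast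
  qed
  moreover have "(\<Union>k. G k) \<subseteq> ?S"
  proof safe
    fix k x assume "x \<in> G k"
    then show "\<exists>f. (\<forall>k. Poly_Mapping.lookup f k \<in> G k) \<and> x = (\<Sum>k\<in>Poly_Mapping.keys f. Poly_Mapping.lookup f k)"
      by (intro exI[of _ "Poly_Mapping.single k x"]) (auto simp: lookup_single when_def subspace_0 G)
  qed
  ultimately show ?thesis using span_minimal u by blast
qed

lemma direct_sum_decompose:
  assumes "is_direct_sum scale S G" "u \<in> S"
  shows "u \<in> span (\<Union>k. G k)"
proof -
  obtain f where f: "\<forall>n. Poly_Mapping.lookup f n \<in> G n" "u = (\<Sum>n\<in>Poly_Mapping.keys f. Poly_Mapping.lookup f n)"
    using assms unfolding is_direct_sum_def by metis
  show ?thesis unfolding f(2) by (intro span_sum span_base) (use f in auto)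
qed

lemma direct_sum_unique:
  assumes ds: "is_direct_sum scale S G" and S: "subspace S"
    and f: "\<And>n. Poly_Mapping.lookup f n \<in> G n" and g: "\<And>n. Poly_Mapping.lookup g n \<in> G n"
    and eq: "(\<Sum>n\<in>Poly_Mapping.keys f. Poly_Mapping.lookup f n) = (\<Sum>n\<in>Poly_Mapping.keys g. Poly_Mapping.lookup g n)"
  shows "f = g"
proof -
  have "(\<Sum>n\<in>Poly_Mapping.keys f. Poly_Mapping.lookup f n) \<in> S"
    by (rule subspace_sum[OF S]) (use f ds in \<open>auto simp: is_direct_sum_def\<close>)
  with ds obtain h where "\<And>h'. (\<forall>n. Poly_Mapping.lookup h' n \<in> G n) \<and> (\<Sum>n\<in>Poly_Mapping.keys f. Poly_Mapping.lookup f n) = (\<Sum>n\<in>Poly_Mapping.keys h'. Poly_Mapping.lookup h' n) \<Longrightarrow> h' = h"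
    unfolding is_direct_sum_def by (metis (mono_tags, lifting))
  from this[of f] this[of g] f g eq show ?thesis by auto
qed

text \<open>The family \<open>f\<close> extended by zero and the family concentrated in degree
  \<open>m\<close> have the same sum, so uniqueness of the decomposition identifies them.\<close>

lemma direct_sum_component:
  assumes ds: "is_direct_sum scale S G" and S: "subspace S" and K: "finite K"
    and f: "\<And>k. k \<in> K \<Longrightarrow> f k \<in> G k" and m: "(\<Sum>k\<in>K. f k) \<in> G m" and k: "k \<in> K"
  shows "f k = (if k = m then (\<Sum>k\<in>K. f k) else 0)"
proof -
  have G: "subspace (G k)" for k using ds by (simp add: is_direct_sum_def)
  let ?f = "Abs_poly_mapping (\<lambda>k. if k \<in> K then f k else 0)"
  have "finite {k. (if k \<in> K then f k else 0) \<noteq> 0}"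
    by (rule finite_subset[OF _ K]) auto
  then have l: "Poly_Mapping.lookup ?f = (\<lambda>k. if k \<in> K then f k else 0)" by (rule lookup_Abs_poly_mapping)
  have "(\<Sum>n\<in>Poly_Mapping.keys ?f. Poly_Mapping.lookup ?f n) = (\<Sum>n\<in>K. Poly_Mapping.lookup ?f n)"
    by (rule sum.mono_neutral_left) (auto simp: K in_keys_iff l split: if_splits)
  also have "\<dots> = (\<Sum>k\<in>K. f k)" by (simp add: l)
  finally have "(\<Sum>n\<in>Poly_Mapping.keys ?f. Poly_Mapping.lookup ?f n) = (\<Sum>k\<in>K. f k)" .
  then have "?f = Poly_Mapping.single m (\<Sum>k\<in>K. f k)"
    by (intro direct_sum_unique[OF ds S]) (auto simp: l f m subspace_0 G lookup_single when_def)
  then have "Poly_Mapping.lookup ?f k = Poly_Mapping.lookup (Poly_Mapping.single m (\<Sum>k\<in>K. f k)) k" by simp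
  then show ?thesis using k by (simp add: l lookup_single when_def)
qed

text \<open>Uniqueness is inherited from \<open>S\<close>, so a subspace is graded as soon as its
  homogeneous elements span it.\<close>

lemma direct_sum_restrict:
  assumes ds: "is_direct_sum scale S G" and S: "subspace S" and T: "subspace T" "T \<subseteq> S"
    and sp: "T \<subseteq> span (\<Union>k. T \<inter> G k)"
  shows "is_direct_sum scale T (\<lambda>n. T \<inter> G n)"
  unfolding is_direct_sum_def
proof (intro conjI allI ballI)
  have G: "subspace (G k)" for k using ds by (simp add: is_direct_sum_def)
  show sub: "subspace (T \<inter> G n)" for n using G T by (simp add: subspace_inter)
  show "T \<inter> G n \<subseteq> T" for n by simp
  fix w assume "w \<in> T"
  then have "w \<in> span (\<Union>k. T \<inter> G k)" using sp by blast
  from span_Union_subspaces[OF sub this]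
  obtain f where f: "\<forall>n. Poly_Mapping.lookup f n \<in> T \<inter> G n" "w = (\<Sum>n\<in>Poly_Mapping.keys f. Poly_Mapping.lookup f n)" by auto
  show "\<exists>!f. (\<forall>n. Poly_Mapping.lookup f n \<in> T \<inter> G n) \<and> w = (\<Sum>n\<in>Poly_Mapping.keys f. Poly_Mapping.lookup f n)"
  proof (rule ex1I[of _ f])
    fix g assume "(\<forall>n. Poly_Mapping.lookup g n \<in> T \<inter> G n) \<and> w = (\<Sum>n\<in>Poly_Mapping.keys g. Poly_Mapping.lookup g n)"
    then show "g = f" using f by (intro direct_sum_unique[OF ds S]) auto
  qed (use f in simp)
qed

end

section \<open>Words in families of operators\<close>

text \<open>The operators need to be linear only on the subspace \<open>C\<close>, because the modes of a module are
  unspecified outside its carrier.\<close>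

locale linear_operators = vector_space scl
  for scl :: "'f::field \<Rightarrow> 'v::ab_group_add \<Rightarrow> 'v" +
  fixes C :: "'v set" and X :: "'x \<Rightarrow> 'v \<Rightarrow> 'v"
  assumes C_subspace: "subspace C"
    and X_closed: "v \<in> C \<Longrightarrow> X x v \<in> C"
    and X_add: "v \<in> C \<Longrightarrow> v' \<in> C \<Longrightarrow> X x (v + v') = X x v + X x v'"
    and X_scale: "v \<in> C \<Longrightarrow> X x (scl c v) = scl c (X x v)"
begin

lemma X_zero [simp]: "X x 0 = 0"
  using X_scale[of 0 x 0] subspace_0[OF C_subspace] by simp

lemma X_diff: "v \<in> C \<Longrightarrow> v' \<in> C \<Longrightarrow> X x (v - v') = X x v - X x v'"
  using X_add[of "v - v'" v' x] C_subspace by (simp add: subspace_diff)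

lemma X_span:
  assumes "S \<subseteq> C" "subspace T" "\<And>s. s \<in> S \<Longrightarrow> X x s \<in> T" "v \<in> span S"
  shows "X x v \<in> T"
proof -
  have "subspace {v \<in> C. X x v \<in> T}"
    using C_subspace assms(2) by (auto simp: subspace_def X_add X_scale)
  then have "span S \<subseteq> {v \<in> C. X x v \<in> T}"
    by (rule span_minimal[rotated]) (use assms in auto)
  then show ?thesis using assms by blast
qed

lemma word_closed: "v \<in> C \<Longrightarrow> foldr X xs v \<in> C"
  by (induction xs) (auto intro: X_closed)

end

text \<open>One word per multiset, with an arbitrary arrangement of its letters, so that no order on
  \<open>B\<close> has to be chosen. For finite \<open>B\<close> and positive \<open>p\<close> there
  are \<open>p ^ card B\<close> of them, as many as there are restricted monomials.\<close>

definition restricted_words :: "'x set \<Rightarrow> nat \<Rightarrow> 'x list set" where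
  "restricted_words B p =
     (\<lambda>M. SOME xs. mset xs = M) ` {M. set_mset M \<subseteq> B \<and> (\<forall>b. count M b < p)}"

lemma finite_restricted_words:
  assumes "finite B"
  shows "finite (restricted_words B p)"
proof -
  let ?S = "{M. set_mset M \<subseteq> B \<and> (\<forall>b. count M b < p)}"
  have "inj_on (\<lambda>M. restrict (count M) B) ?S"
  proof (rule inj_onI)
    fix M N assume M: "M \<in> ?S" and N: "N \<in> ?S" and eq: "restrict (count M) B = restrict (count N) B"
    show "M = N"
    proof (rule multiset_eqI)
      fix b
      show "count M b = count N b"
      proof (cases "b \<in> B")
        case True then show ?thesis using fun_cong[OF eq, of b] by simp
      next
        case False
        then have "b \<notin># M" "b \<notin># N" using M N by auto
        then show ?thesis by (metis count_eq_zero_iff)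
      qed
    qed
  qed
  moreover have "(\<lambda>M. restrict (count M) B) ` ?S \<subseteq> PiE B (\<lambda>_. {..<p})" by auto
  ultimately have "finite ?S" using assms finite_PiE[of B "\<lambda>_. {..<p}"]
    by (meson finite_imageD finite_lessThan finite_subset)
  then show ?thesis by (simp add: restricted_words_def)
qed

context linear_operators
begin

text \<open>The spanning half of the Poincare-Birkhoff-Witt theorem for restricted enveloping algebras,
  relative to a subspace \<open>K\<close>: if letters commute up to shorter words and the \<open>p\<close>-th powers of letters
  are combinations of shorter words, then finitely many words suffice.\<close>

theorem restricted_words_span:
  fixes w :: 'v and K :: "'v set" and B :: "'x set"
  defines "G \<equiv> \<lambda>k. span (K \<union> {foldr X xs w | xs. set xs \<subseteq> B \<and> length xs < k})"
  assumes w: "w \<in> C" and K: "K \<subseteq> C" "subspace K" "\<And>b v. b \<in> B \<Longrightarrow> v \<in> K \<Longrightarrow> X b v \<in> K"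
    and comm: "\<And>b c xs. b \<in> B \<Longrightarrow> c \<in> B \<Longrightarrow> set xs \<subseteq> B \<Longrightarrow>
        X b (X c (foldr X xs w)) - X c (X b (foldr X xs w)) \<in> G (length xs + 2)"
    and p: "0 < p" and pow: "\<And>b. b \<in> B \<Longrightarrow> (X b ^^ p) w \<in> G p"
    and xs: "set xs \<subseteq> B"
  shows "foldr X xs w \<in> span (K \<union> (\<lambda>xs. foldr X xs w) ` restricted_words B p)"
proof -
  have sub: "subspace (G k)" for k by (simp add: G_def subspace_span)
  have GC: "G k \<subseteq> C" for k
    unfolding G_def by (rule span_minimal) (use K w word_closed C_subspace in auto)
  \<comment> \<open>A letter raises the filtration by word length by at most one; \<open>K\<close>
    is stable and sits in every level.\<close>
  have XG: "X b v \<in> G (Suc k)" if "b \<in> B" "v \<in> G k" for b v k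
  proof (rule X_span[OF _ sub _ that(2)[unfolded G_def]])
    show "K \<union> {foldr X xs w |xs. set xs \<subseteq> B \<and> length xs < k} \<subseteq> C" using K w word_closed by auto
    fix s assume "s \<in> K \<union> {foldr X xs w |xs. set xs \<subseteq> B \<and> length xs < k}"
    then show "X b s \<in> G (Suc k)"
    proof
      assume "s \<in> K"
      then show ?thesis unfolding G_def using K that by (auto intro: span_base)
    next
      assume "s \<in> {foldr X xs w |xs. set xs \<subseteq> B \<and> length xs < k}"
      then obtain xs where "s = foldr X xs w" "set xs \<subseteq> B" "length xs < k" by blast
      then show ?thesis unfolding G_def using that
        by (intro span_base UnI2 CollectI exI[of _ "b # xs"]) auto
    qed
  qed
  have WG: "foldr X ys v \<in> G (length ys + k)" if "set ys \<subseteq> B" "v \<in> G k" for ys v k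
    using that by (induction ys) (auto intro: XG)
  \<comment> \<open>Carrying \<open>x\<close> through the prefix \<open>zs\<close> costs one
    commutator per letter crossed, and each of them is a combination of shorter words modulo
    \<open>K\<close>.\<close>
  have move: "X x (foldr X (zs @ ys) w) - foldr X (zs @ x # ys) w \<in> G (Suc (length zs + length ys))"
    if "x \<in> B" "set zs \<subseteq> B" "set ys \<subseteq> B" for x zs ys
    using that(2)
  proof (induction zs)
    case Nil then show ?case using sub by (simp add: subspace_0)
  next
    case (Cons z zs)
    let ?u = "foldr X (zs @ ys) w" and ?u' = "foldr X (zs @ x # ys) w"
    have C: "?u \<in> C" "?u' \<in> C" using w by (auto simp only: word_closed)
    have "X z (X x ?u - ?u') \<in> G (Suc (Suc (length zs + length ys)))"
      using Cons by (intro XG) auto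
    moreover have "X x (X z ?u) - X z (X x ?u) \<in> G (length (zs @ ys) + 2)"
      using Cons that by (intro comm) auto
    moreover have "X x (foldr X ((z # zs) @ ys) w) - foldr X ((z # zs) @ x # ys) w =
        (X x (X z ?u) - X z (X x ?u)) + X z (X x ?u - ?u')"
      using C by (simp add: X_diff X_closed del: foldr_append)
    ultimately show ?case by (simp add: subspace_add[OF sub] del: foldr.simps foldr_append diff_add_cancel add_diff_cancel)
  qed
  \<comment> \<open>Moving the first letter to its place in \<open>ys\<close> reduces the
    rearrangement to the tail, so the order of letters matters only modulo shorter words and
    \<open>K\<close>.\<close>
  have perm: "foldr X xs w - foldr X ys w \<in> G (length xs)" if "mset xs = mset ys" "set xs \<subseteq> B" for xs ys
    using that
  proof (induction xs arbitrary: ys)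
    case Nil then show ?case using sub by (simp add: subspace_0)
  next
    case (Cons x xs)
    have "x \<in> set ys" using Cons.prems by (metis list.set_intros(1) set_mset_mset)
    then obtain ys1 ys2 where ys: "ys = ys1 @ x # ys2" by (meson split_list)
    have m: "mset xs = mset (ys1 @ ys2)" using Cons.prems(1) by (simp add: ys)
    then have sy: "set xs = set (ys1 @ ys2)" and l: "length xs = length (ys1 @ ys2)"
      by (metis set_mset_mset, metis size_mset)
    have C: "foldr X xs w \<in> C" "foldr X (ys1 @ ys2) w \<in> C" using w by (auto simp only: word_closed)
    have "X x (foldr X xs w - foldr X (ys1 @ ys2) w) \<in> G (length (x # xs))"
      using Cons.IH[OF m] Cons.prems(2) XG by simp
    moreover have "X x (foldr X (ys1 @ ys2) w) - foldr X ys w \<in> G (length (x # xs))"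
      using move[of x ys1 ys2] Cons.prems(2) sy l by (simp add: ys)
    ultimately show ?case
      using subspace_add[OF sub, of "X x (foldr X xs w - foldr X (ys1 @ ys2) w)" "length (x # xs)"
          "X x (foldr X (ys1 @ ys2) w) - foldr X ys w"] C
      by (simp add: X_diff del: foldr_append)
  qed
  let ?T = "span (K \<union> (\<lambda>xs. foldr X xs w) ` restricted_words B p)"
  show ?thesis using xs
  proof (induction "length xs" arbitrary: xs rule: less_induct)
    case less
    have GT: "G (length xs) \<subseteq> ?T"
      unfolding G_def by (rule span_minimal) (use less(1) in \<open>auto intro: span_base\<close>)
    \<comment> \<open>This is the very word that \<open>restricted_words\<close> selects for the
      multiset of \<open>xs\<close>.\<close>
    define cs where "cs = (SOME ys. mset ys = mset xs)"
    have cs: "mset cs = mset xs" unfolding cs_def by (rule someI_ex) auto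
    show ?case
    proof (cases "\<forall>b. count (mset xs) b < p")
      case True
      then have "cs \<in> restricted_words B p" using less.prems unfolding restricted_words_def cs_def by auto
      then have "foldr X cs w \<in> ?T" by (intro span_base) auto
      moreover have "foldr X xs w - foldr X cs w \<in> ?T" using perm[of xs cs] cs less.prems GT by auto
      ultimately show ?thesis using span_add[of "foldr X cs w" _ "foldr X xs w - foldr X cs w"] by simp
    next
      case False
      then obtain b where b: "p \<le> count (mset xs) b" by (auto simp: not_less)
      \<comment> \<open>The \<open>p\<close> copies of \<open>b\<close> are gathered at the right
        end, next to \<open>w\<close>, because \<open>pow\<close> speaks of \<open>p\<close>-th
        powers applied to \<open>w\<close> alone.\<close>
      obtain ys where ys: "mset ys = mset xs - replicate_mset p b" using ex_mset by blast
      have m: "mset xs = mset (ys @ replicate p b)"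
        using b by (simp add: ys count_le_replicate_mset_subset_eq)
      have s: "set xs = set (ys @ replicate p b)" and l: "length xs = length ys + p"
        using m by (metis set_mset_mset, metis length_append length_replicate size_mset)
      have "foldr X (ys @ replicate p b) w \<in> G (length xs)"
      proof -
        have "b \<in> B" "set ys \<subseteq> B" using s less.prems p by auto
        moreover have "foldr X (replicate p b) w = (X b ^^ p) w" by (simp add: foldr_replicate)
        ultimately show ?thesis using WG[of ys "(X b ^^ p) w" p] pow by (simp add: l)
      qed
      then have "foldr X (ys @ replicate p b) w \<in> ?T" using GT by blast
      moreover have "foldr X xs w - foldr X (ys @ replicate p b) w \<in> ?T"
        using perm[OF m] less.prems GT by auto
      ultimately show ?thesis
        using span_add[of "foldr X (ys @ replicate p b) w" _ "foldr X xs w - foldr X (ys @ replicate p b) w"]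
        by simp
    qed
  qed
qed

end

section \<open>Currents and triangular decomposition\<close>

locale current_operators =
  linear_operators scl C X + g: vector_space scale
  for scl :: "'f::field \<Rightarrow> 'v::ab_group_add \<Rightarrow> 'v" and C
    and X :: "'g::ab_group_add \<times> int \<Rightarrow> 'v \<Rightarrow> 'v" and scale :: "'f \<Rightarrow> 'g \<Rightarrow> 'g" +
  fixes bracket :: "'g \<Rightarrow> 'g \<Rightarrow> 'g" and \<kappa> :: "'g \<Rightarrow> int \<Rightarrow> 'g \<Rightarrow> int \<Rightarrow> 'f"
  assumes letter_add: "u \<in> C \<Longrightarrow> X (a + b, n) u = X (a, n) u + X (b, n) u"
    and letter_scale: "u \<in> C \<Longrightarrow> X (scale c a, n) u = scl c (X (a, n) u)"
    and commute: "u \<in> C \<Longrightarrow>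
      X (a, m) (X (b, n) u) = X (b, n) (X (a, m) u) + X (bracket a b, m + n) u + scl (\<kappa> a m b n) u"
begin

lemma letter_span:
  assumes "a \<in> g.span B" "subspace T" "u \<in> C" "\<And>b. b \<in> B \<Longrightarrow> X (b, n) u \<in> T"
  shows "X (a, n) u \<in> T"
proof -
  have "X (0, n) u = 0" using letter_scale[OF assms(3), of 0] by simp
  then have "g.subspace {a. X (a, n) u \<in> T}"
    using assms(2,3) by (auto simp: g.subspace_def subspace_def letter_add letter_scale)
  then have "g.span B \<subseteq> {a. X (a, n) u \<in> T}"
    by (rule g.span_minimal[rotated]) (use assms in auto)
  then show ?thesis using assms by blast
qed

text \<open>What the negative half of the affine algebra makes out of \<open>Z\<close>; the empty
  word puts \<open>Z\<close> itself into it.\<close>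

definition negative_span :: "'v set \<Rightarrow> 'v set" where
  "negative_span Z = span {foldr X xs z | xs z. z \<in> Z \<and> (\<forall>(b, m)\<in>set xs. m < 0)}"

text \<open>A nonnegative mode is moved to the right through the negative ones until it meets
  \<open>Z\<close>. Each crossing leaves a bracket of index \<open>n + m\<close>, which is covered
  by the induction hypothesis if nonnegative and is one more negative letter otherwise.\<close>

lemma negative_span_closed:
  assumes Z: "Z \<subseteq> C" and nonneg: "\<And>a n z. 0 \<le> n \<Longrightarrow> z \<in> Z \<Longrightarrow> X (a, n) z \<in> Z"
    and v: "v \<in> negative_span Z"
  shows "X x v \<in> negative_span Z"
proof -
  let ?S = "{foldr X xs z | xs z. z \<in> Z \<and> (\<forall>(b, m)\<in>set xs. m < 0)}"
  let ?N = "negative_span Z"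
  have SC: "?S \<subseteq> C" using Z word_closed by auto
  have sub: "subspace ?N" unfolding negative_span_def by (rule subspace_span)
  have neg: "X (b, m) u \<in> ?N" if "m < 0" "u \<in> ?N" for b m u
  proof (rule X_span[OF SC sub _ that(2)[unfolded negative_span_def]])
    fix s assume "s \<in> ?S"
    then obtain xs z where "s = foldr X xs z" "z \<in> Z" "\<forall>(b, m)\<in>set xs. m < 0" by blast
    then show "X (b, m) s \<in> ?N" unfolding negative_span_def using that
      by (intro span_base CollectI exI[of _ "(b, m) # xs"] exI[of _ z]) auto
  qed
  have pos: "X (a, n) (foldr X xs z) \<in> ?N" if "0 \<le> n" "z \<in> Z" "\<forall>(b, m)\<in>set xs. m < 0" for a n xs z
    using that(1,3)
  proof (induction xs arbitrary: a n)
    case Nil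
    then show ?case unfolding negative_span_def using nonneg[OF _ that(2)]
      by (intro span_base CollectI exI[of _ "[]"]) auto
  next
    case (Cons y ys)
    obtain b m where y: "y = (b, m)" by force
    let ?u = "foldr X ys z"
    have m: "m < 0" and ys: "\<forall>(b, m)\<in>set ys. m < 0" using Cons.prems y by auto
    have u: "?u \<in> C" using Z that word_closed by blast
    have uN: "?u \<in> ?N" unfolding negative_span_def using that ys by (intro span_base) blast
    have "X (b, m) (X (a, n) ?u) \<in> ?N" using Cons ys m neg by blast
    moreover have "X (bracket a b, n + m) ?u \<in> ?N"
      using Cons.IH[of "n + m"] ys uN neg by (cases "0 \<le> n + m") auto
    moreover have "scl (\<kappa> a n b m) ?u \<in> ?N" using uN sub by (simp add: subspace_scale)
    ultimately show ?case using sub commute[OF u, of a n b m] by (simp add: y subspace_add)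
  qed
  obtain a n where x: "x = (a, n)" by force
  show ?thesis
  proof (cases "n < 0")
    case True then show ?thesis using neg v x by blast
  next
    case False
    show ?thesis
      by (rule X_span[OF SC sub _ v[unfolded negative_span_def]]) (use pos False x in auto)
  qed
qed

lemma negative_span_base: "z \<in> Z \<Longrightarrow> z \<in> negative_span Z"
  unfolding negative_span_def by (intro span_base CollectI exI[of _ "[]"]) auto

end

section \<open>Modules over a vertex algebra generated by currents\<close>

context vertex_algebra_module
begin

sublocale wsp: vector_space "smult W"
  by (rule smult_vector_space)

lemma mode_zero_right [simp]: "mode W v n 0 = 0"
  using mode_scale_right[of 0 v n 0] wsp.subspace_0[OF carrier_subspace] by simp

text \<open>The case \<open>l = 0\<close> of the Jacobi identity: \<open>int_binomial 0 i\<close>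
  leaves only \<open>i = 0\<close> in both sums on the left.\<close>

lemma mode_commutator:
  assumes "w \<in> carrier W"
  shows "mode W u m (mode W v n w) = mode W v n (mode W u m w) +
    Sum_any (\<lambda>i. smult W (of_int (int_binomial m i)) (mode W (Y u (int i) v) (m + n - int i) w))"
proof -
  have 1: "Sum_any (\<lambda>i::nat. smult W ((-1) ^ i * of_int (int_binomial 0 i))
        (mode W u (m + 0 - int i) (mode W v (n + int i) w))) = mode W u m (mode W v n w)"
    by (subst Sum_any_single[of 0]) auto
  have 2: "Sum_any (\<lambda>i::nat. smult W ((-1) powi 0 * (-1) ^ i * of_int (int_binomial 0 i))
        (mode W v (n + 0 - int i) (mode W u (m + int i) w))) = mode W v n (mode W u m w)"
    by (subst Sum_any_single[of 0]) auto
  show ?thesis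
    using mode_jacobi[OF assms, of u v, unfolded jacobi_identity_def, rule_format, of 0 m n]
    unfolding 1 2 by (simp add: algebra_simps)
qed

text \<open>The case \<open>m = 0\<close> of the Jacobi identity, where the sum on the right
  collapses. It expresses modes of \<open>Y u l v\<close> through those of \<open>u\<close> and
  \<open>v\<close>, which makes induction over generators possible.\<close>

lemma mode_iterate:
  assumes "w \<in> carrier W"
  shows "mode W (Y u l v) n w =
     Sum_any (\<lambda>i::nat. smult W ((-1) ^ i * of_int (int_binomial l i))
        (mode W u (l - int i) (mode W v (n + int i) w)))
   - Sum_any (\<lambda>i::nat. smult W ((-1) powi l * (-1) ^ i * of_int (int_binomial l i))
        (mode W v (n + l - int i) (mode W u (int i) w)))"
proof -
  have 1: "Sum_any (\<lambda>i::nat. smult W (of_int (int_binomial 0 i))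
        (mode W (Y u (l + int i) v) (0 + n - int i) w)) = mode W (Y u l v) n w"
    by (subst Sum_any_single[of 0]) auto
  show ?thesis
    using mode_jacobi[OF assms, of u v, unfolded jacobi_identity_def, rule_format, of l 0 n]
    unfolding 1 by simp
qed

end

text \<open>Makes the commutator and iterate formulas for modules available for the vertex algebra
  itself. The component function \<open>c\<close> is free because the claim concerns ungraded
  modules.\<close>

lemma (in vertex_algebra) adjoint_module:
  "vertex_algebra_module scale Y vac \<lparr>carrier = UNIV, smult = scale, mode = Y, comp = c\<rparr>"
proof -
  interpret L: Vector_Spaces.linear scale scale "\<lambda>u. Y u n v" for n v by (rule Y_linear_left)
  interpret R: Vector_Spaces.linear scale scale "Y u n" for u n by (rule Y_linear_right)
  show ?thesis
    by unfold_locales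
      (auto simp: scale_right_distrib scale_left_distrib L.add L.scale R.add R.scale
        Y_vacuum Y_truncation Y_jacobi)
qed

text \<open>What the argument uses of the quotient vertex algebra; \<open>gen a\<close> is the image of \<open>a(-1) vac\<close> and
  \<open>VG\<close> the grading.\<close>

locale restricted_current_algebra =
  vertex_algebra scaleQ Y vac + g: vector_space scale
  for scaleQ :: "'f::field \<Rightarrow> 'q::ab_group_add \<Rightarrow> 'q" and Y :: "'q \<Rightarrow> int \<Rightarrow> 'q \<Rightarrow> 'q" and vac :: 'q
    and scale :: "'f \<Rightarrow> 'g::ab_group_add \<Rightarrow> 'g" +
  fixes bracket :: "'g \<Rightarrow> 'g \<Rightarrow> 'g" and pmap :: "'g \<Rightarrow> 'g" and form :: "'g \<Rightarrow> 'g \<Rightarrow> 'f" and lev :: 'f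
    and gen :: "'g \<Rightarrow> 'q" and VG :: "int \<Rightarrow> 'q set" and B :: "'g set"
  assumes gen_add: "gen (a + b) = gen a + gen b"
    and gen_scale: "gen (scale c a) = scaleQ c (gen a)"
    and gen_0: "Y (gen a) 0 (gen b) = gen (bracket a b)"
    and gen_1: "Y (gen a) 1 (gen b) = scaleQ (lev * form a b) vac"
    and gen_ge_2: "n \<ge> 2 \<Longrightarrow> Y (gen a) n (gen b) = 0"
    and generated: "subspace S \<Longrightarrow> vac \<in> S \<Longrightarrow> (\<And>a n v. v \<in> S \<Longrightarrow> Y (gen a) n v \<in> S) \<Longrightarrow> v \<in> S"
    and gen_power: "(Y (gen a) (-1) ^^ CHAR('f)) vac = Y (gen (pmap a)) (- int CHAR('f)) vac"
    and gen_power_degree: "(Y (gen a) (-1) ^^ r) vac \<in> VG (int r)"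
    and finite_B: "finite B" and span_B: "g.span B = UNIV"
    and CHAR_odd: "odd CHAR('f)" and CHAR_gt_1: "1 < CHAR('f)"
begin

abbreviation current :: "('f, 'q, 'w::ab_group_add) graded_module \<Rightarrow> 'g \<times> int \<Rightarrow> 'w \<Rightarrow> 'w" where
  "current W x \<equiv> mode W (gen (fst x)) (snd x)"

lemma current_operators:
  assumes "vertex_algebra_module scaleQ Y vac W"
  shows "current_operators (smult W) (carrier W) (current W) scale bracket
    (\<lambda>a m b n. if m + n = 0 then of_int m * lev * form a b else 0)"
proof -
  interpret W: vertex_algebra_module scaleQ Y vac W by fact
  have zero: "mode W 0 n w = 0" if "w \<in> carrier W" for n w
    using W.mode_scale_left[OF that, of 0 0] by simp
  show ?thesis
  proof unfold_locales
    fix u a b and m n :: int assume u: "u \<in> carrier W"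
    let ?f = "\<lambda>i. smult W (of_int (int_binomial m i)) (mode W (Y (gen a) (int i) (gen b)) (m + n - int i) u)"
    \<comment> \<open>Only \<open>i = 0\<close> and \<open>i = 1\<close> contribute: the first gives
      the bracket, the second a multiple of the vacuum, whose mode of index \<open>m + n - 1\<close>
      is the identity exactly when \<open>m + n = 0\<close>.\<close>
    have "Sum_any ?f = (\<Sum>i\<in>{0,1}. ?f i)"
    proof (rule Sum_any.expand_superset)
      have "?f i = 0" if "i \<noteq> 0" "i \<noteq> 1" for i
        using gen_ge_2[of "int i" a b] zero[OF u] that by simp
      then show "{i. ?f i \<noteq> 0} \<subseteq> {0, 1}" by blast
    qed auto
    also have "\<dots> = mode W (gen (bracket a b)) (m + n) u +
        smult W (if m + n = 0 then of_int m * lev * form a b else 0) u"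
      using u by (simp add: gen_0 gen_1 W.mode_scale_left W.mode_vacuum mult.assoc)
    finally show "current W (a, m) (current W (b, n) u) = current W (b, n) (current W (a, m) u) +
        current W (bracket a b, m + n) u +
        smult W (if m + n = 0 then of_int m * lev * form a b else 0) u"
      using W.mode_commutator[OF u, of "gen a" m "gen b" n] by (simp add: add.assoc)
  qed (auto simp: W.carrier_subspace W.mode_closed W.mode_add_right W.mode_scale_right
      gen_add gen_scale W.mode_add_left W.mode_scale_left)
qed

text \<open>The vectors all of whose modes preserve \<open>S\<close> include the vacuum and, by
  \<open>mode_iterate\<close>, are closed under the modes of the generators, so they exhaust the
  algebra. Submodules can thus be tested on currents.\<close>

lemma closed_under_modes:
  assumes "vertex_algebra_module scaleQ Y vac W" and S: "module.subspace (smult W) S" "S \<subseteq> carrier W"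
    and cl: "\<And>a n w. w \<in> S \<Longrightarrow> mode W (gen a) n w \<in> S" and w: "w \<in> S"
  shows "mode W q n w \<in> S"
proof -
  interpret W: vertex_algebra_module scaleQ Y vac W by fact
  let ?S = "{q. \<forall>n. \<forall>w\<in>S. mode W q n w \<in> S}"
  have "q \<in> ?S"
  proof (rule generated)
    have "mode W 0 n w = 0" if "w \<in> S" for n w
      using W.mode_scale_left[of w 0 0 n] that S by auto
    then show "subspace ?S" using S
      by (auto simp: subspace_def W.wsp.subspace_def W.mode_add_left W.mode_scale_left subset_iff)
    show "vac \<in> ?S" using S by (auto simp: W.mode_vacuum subset_iff W.wsp.subspace_0)
    fix a l v assume v: "v \<in> ?S"
    have "mode W (Y (gen a) l v) n w \<in> S" if w: "w \<in> S" for n w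
    proof -
      have "w \<in> carrier W" using w S by blast
      then show ?thesis unfolding W.mode_iterate[OF \<open>w \<in> carrier W\<close>]
        using v w by (intro W.wsp.subspace_diff S W.wsp.Sum_any_in_subspace W.wsp.subspace_scale) (auto intro: cl)
    qed
    then show "Y (gen a) l v \<in> ?S" by blast
  qed
  then show ?thesis using w by blast
qed

theorem C2_cofinite: "C2_cofinite scaleQ Y"
proof -
  define A where "A = \<lparr>carrier = UNIV, smult = scaleQ, mode = Y, comp = (\<lambda>_::int. UNIV :: 'q set)\<rparr>"
  have A: "vertex_algebra_module scaleQ Y vac A" unfolding A_def by (rule adjoint_module)
  interpret M: vertex_algebra_module scaleQ Y vac A by (rule A)
  have [simp]: "carrier A = UNIV" "smult A = scaleQ" "mode A = Y" by (simp_all add: A_def)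
  interpret X: current_operators scaleQ UNIV "current A" scale bracket
    "\<lambda>a m b n. if m + n = 0 then of_int m * lev * form a b else 0"
    using current_operators[OF A] by simp
  let ?K = "C2_space scaleQ Y"
  have K: "subspace ?K" unfolding C2_space_def by (rule subspace_span)
  have C2: "Y u n v \<in> ?K" if "n \<le> -2" for u n v
    unfolding C2_space_def
    by (intro span_base CollectI exI[of _ u] exI[of _ v] exI[of _ "nat (-2 - n)"]) (use that in auto)
  \<comment> \<open>Only the operators \<open>a(-1)\<close> serve as letters; the modes of index at
    most \<open>-2\<close> already land in \<open>C2\<close>.\<close>
  interpret L: linear_operators scaleQ UNIV "\<lambda>a. Y (gen a) (-1)"
    by unfold_locales (use X.X_add[of _ _ "(a, -1)" for a] X.X_scale[of _ "(a, -1)" for a] in auto)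
  \<comment> \<open>Commuting the mode \<open>-1\<close> of \<open>u\<close> past the mode
    \<open>-2 - n\<close> of \<open>u'\<close> leaves the latter outermost, and the correction terms
    have index at most \<open>-3\<close>; all of this lies in \<open>C2\<close>.\<close>
  have closed: "Y u (-1) v \<in> ?K" if v: "v \<in> ?K" for u v
  proof -
    interpret L': linear_operators scaleQ UNIV "\<lambda>u. Y u (-1)"
      by unfold_locales (use M.mode_add_right M.mode_scale_right in auto)
    show ?thesis
    proof (rule L'.X_span[OF _ K _ v[unfolded C2_space_def]])
      fix s assume "s \<in> {Y u (- 2 - int n) v |u v n. True}"
      then obtain u' v' n where s: "s = Y u' (-2 - int n) v'" by blast
      show "Y u (-1) s \<in> ?K"
        using M.mode_commutator[of v' u "-1" u' "-2 - int n"]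
        by (auto simp: s intro!: subspace_add[OF K] Sum_any_in_subspace[OF K] subspace_scale[OF K] C2)
    qed auto
  qed
  let ?W = "(\<lambda>xs. foldr (\<lambda>a. Y (gen a) (-1)) xs vac)"
  let ?T = "span (?K \<union> ?W ` restricted_words B CHAR('f))"
  let ?T' = "span (?K \<union> ?W ` {xs. set xs \<subseteq> B})"
  have "?W xs \<in> ?T" if "set xs \<subseteq> B" for xs
  proof (rule L.restricted_words_span[OF _ _ K closed _ _ _ that])
    fix b c and xs :: "'g list" let ?v = "?W xs"
    \<comment> \<open>The central term is absent because the two indices do not sum to 0.\<close>
    have "Y (gen b) (-1) (Y (gen c) (-1) ?v) - Y (gen c) (-1) (Y (gen b) (-1) ?v) = Y (gen (bracket b c)) (-2) ?v"
      using X.commute[of ?v b "-1" c "-1"] by simp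
    then show "Y (gen b) (-1) (Y (gen c) (-1) ?v) - Y (gen c) (-1) (Y (gen b) (-1) ?v)
        \<in> span (?K \<union> {foldr (\<lambda>a. Y (gen a) (-1)) xsa vac |xsa. set xsa \<subseteq> B \<and> length xsa < length xs + 2})"
      using C2 by (intro span_base) simp
  next
    fix b
    \<comment> \<open>\<open>gen_power\<close> turns the power into a mode of index
      \<open>-p\<close>, which lies in \<open>C2\<close> because \<open>p\<close> is at least
      2.\<close>
    show "(Y (gen b) (-1) ^^ CHAR('f)) vac
        \<in> span (?K \<union> {foldr (\<lambda>a. Y (gen a) (-1)) xsa vac |xsa. set xsa \<subseteq> B \<and> length xsa < CHAR('f)})"
      unfolding gen_power using C2 CHAR_gt_1 by (intro span_base) simp
  qed (use CHAR_gt_1 in auto)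
  then have T'T: "?T' \<subseteq> ?T" by (intro span_minimal subspace_span) (auto intro: span_base)
  \<comment> \<open>The span of all words, unlike that of the restricted ones, is visibly stable
    under letters from \<open>B\<close>; linearity in the letter extends this to every
    \<open>a\<close>.\<close>
  have T'_m1: "Y (gen a) (-1) v \<in> ?T'" if v: "v \<in> ?T'" for a v
  proof -
    have "current A (a, -1) v \<in> ?T'"
    proof (rule X.letter_span[of a B])
      fix b assume b: "b \<in> B"
      have "Y (gen b) (-1) v \<in> ?T'"
      proof (rule L.X_span[OF _ subspace_span _ v])
        fix s assume "s \<in> ?K \<union> ?W ` {xs. set xs \<subseteq> B}"
        then show "Y (gen b) (- 1) s \<in> ?T'"
        proof
          assume "s \<in> ?W ` {xs. set xs \<subseteq> B}"
          then obtain xs where "s = ?W xs" "set xs \<subseteq> B" by auto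
          then have "Y (gen b) (-1) s = ?W (b # xs)" "b # xs \<in> {xs. set xs \<subseteq> B}" using b by auto
          then show ?thesis by (metis (no_types, lifting) UnI2 image_eqI span_base)
        qed (auto intro: span_base closed)
      qed auto
      then show "current A (b, -1) v \<in> ?T'" by simp
    qed (auto simp: span_B subspace_span)
    then show ?thesis by simp
  qed
  have T'_neg: "Y (gen a) n v \<in> ?T'" if "v \<in> ?T'" "n < 0" for a n v
    using T'_m1[OF that(1)] C2[of n] that(2) by (cases "n = -1") (auto intro: span_base)
  \<comment> \<open>Nonnegative modes kill the vacuum line, so its negative span is stable under all
    currents, and \<open>generated\<close> makes it the whole space.\<close>
  let ?N = "X.negative_span (span {vac})"
  have NT': "?N \<subseteq> ?T'" unfolding X.negative_span_def
  proof (rule span_minimal[OF _ subspace_span], safe)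
    fix xs :: "('g \<times> int) list" and z assume z: "z \<in> span {vac}" and "\<forall>(b, m)\<in>set xs. m < 0"
    have "vac \<in> ?T'" by (intro span_base UnI2 image_eqI[of _ _ "[]"]) auto
    then have "z \<in> ?T'" using z by (metis empty_subsetI insert_subset span_minimal subsetD subspace_span)
    then show "foldr (current A) xs z \<in> ?T'" using \<open>\<forall>(b, m)\<in>set xs. m < 0\<close>
      by (induction xs) (auto intro: T'_neg)
  qed
  have "v \<in> ?N" for v
  proof (rule generated)
    show "subspace ?N" unfolding X.negative_span_def by (rule subspace_span)
    show "vac \<in> ?N" by (rule X.negative_span_base) (simp add: span_base)
    fix a n v assume v: "v \<in> ?N"
    have "current A (a, n) v \<in> ?N"
    proof (rule X.negative_span_closed[OF _ _ v])
      fix a z and n :: int assume n: "0 \<le> n" and z: "z \<in> span {vac}"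
      have "current A (a, n) z \<in> span {0}"
        by (rule X.X_span[OF _ subspace_span _ z]) (use n in \<open>auto simp: Y_creation\<close>)
      then show "current A (a, n) z \<in> span {vac}" by (simp add: span_zero)
    qed auto
    then show "Y (gen a) n v \<in> ?N" by simp
  qed
  then have all: "v \<in> ?T" for v using NT' T'T by blast
  show ?thesis unfolding C2_cofinite_def
  proof (intro exI conjI allI)
    show "finite (?W ` restricted_words B CHAR('f))"
      by (intro finite_imageI finite_restricted_words finite_B)
    fix v
    obtain k b where "v = k + b" "k \<in> span ?K" "b \<in> span (?W ` restricted_words B CHAR('f))"
      using all[of v] unfolding span_Un by blast
    then show "\<exists>b\<in>span (?W ` restricted_words B CHAR('f)). v - b \<in> ?K"
      by (metis K add_diff_cancel_right' span_eq_iff)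
  qed
qed

end

text \<open>The condition on zeros makes the supports of \<open>f\<close> and of its image agree, so
  the identity persists where \<open>Sum_any\<close> takes its default value 0 on an infinite
  support.\<close>

lemma (in module) Sum_any_inj_additive:
  assumes C: "subspace C" and add: "\<And>x y. x \<in> C \<Longrightarrow> y \<in> C \<Longrightarrow> \<psi> (x + y) = \<psi> x + \<psi> y"
    and zero: "\<And>x. x \<in> C \<Longrightarrow> \<psi> x = 0 \<longleftrightarrow> x = 0" and f: "\<And>i. f i \<in> C"
  shows "\<psi> (Sum_any f) = Sum_any (\<lambda>i. \<psi> (f i))"
proof -
  have "\<psi> (sum f A) = (\<Sum>i\<in>A. \<psi> (f i))" for A
  proof (induction A rule: infinite_finite_induct)
    case (insert x A)
    then show ?case using add[OF f subspace_sum[OF C], of A f x] f by simp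
  qed (use zero subspace_0[OF C] in auto)
  moreover have "{i. \<psi> (f i) \<noteq> 0} = {i. f i \<noteq> 0}" using zero f by auto
  ultimately show ?thesis by (simp add: Sum_any.expand_set)
qed

section \<open>Irreducible graded modules\<close>

context restricted_current_algebra
begin

abbreviation irreducible :: "('f, 'q, 'w::ab_group_add) graded_module \<Rightarrow> bool" where
  "irreducible W \<equiv> irreducible_nat_graded_module scaleQ Y vac VG W"

lemma irreducible_graded: "irreducible W \<Longrightarrow> nat_graded_module scaleQ Y vac W VG"
  by (simp add: irreducible_nat_graded_module_def)

lemma irreducible_module: "irreducible W \<Longrightarrow> vertex_algebra_module scaleQ Y vac W"
  by (simp add: irreducible_nat_graded_module_def nat_graded_module_def)

text \<open>The working form of irreducibility: \<open>closed_under_modes\<close> reduces stability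
  to currents, and \<open>direct_sum_restrict\<close> reduces gradedness to spanning by homogeneous
  vectors.\<close>

lemma irreducible_full:
  assumes W: "irreducible W"
    and S: "module.subspace (smult W) S" "S \<subseteq> carrier W" "\<And>x w. w \<in> S \<Longrightarrow> current W x w \<in> S"
    and sp: "S \<subseteq> module.span (smult W) (\<Union>k. S \<inter> comp W k)" and ne: "\<exists>w\<in>S. w \<noteq> 0"
  shows "S = carrier W"
proof -
  interpret W: nat_graded_module scaleQ Y vac W VG by (rule irreducible_graded[OF W])
  have cl: "mode W (gen a) n w \<in> S" if "w \<in> S" for a n w using S(3)[OF that, of "(a, n)"] by simp
  have "graded_submodule W S" unfolding graded_submodule_def
    using S closed_under_modes[OF irreducible_module[OF W] S(1,2) cl]
      W.wsp.direct_sum_restrict[OF W.comp_direct_sum W.carrier_subspace S(1,2) sp] by blast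
  then show ?thesis using W ne unfolding irreducible_nat_graded_module_def by blast
qed

lemma irreducible_top:
  assumes W: "irreducible W"
  shows "\<exists>n w. w \<noteq> 0 \<and> w \<in> comp W n \<and> (\<forall>m<n. comp W m = {0})"
proof -
  interpret W: nat_graded_module scaleQ Y vac W VG by (rule irreducible_graded[OF W])
  have sub: "W.wsp.subspace (comp W k)" for k using W.comp_direct_sum by (simp add: is_direct_sum_def)
  have "\<exists>j::nat. comp W (int j) \<noteq> {0}"
  proof (rule ccontr)
    assume "\<not> ?thesis"
    then have "comp W k = {0}" for k using W.comp_negative[of k] by (metis nonneg_int_cases not_less)
    then have "w = 0" if "w \<in> carrier W" for w
      using W.wsp.direct_sum_decompose[OF W.comp_direct_sum that] by simp
    then have "carrier W = {0}" using W.wsp.subspace_0[OF W.carrier_subspace] by auto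
    then show False using W by (simp add: irreducible_nat_graded_module_def)
  qed
  then obtain j :: nat where j: "comp W (int j) \<noteq> {0}" "\<And>i. i < j \<Longrightarrow> comp W (int i) = {0}"
    using exists_least_iff[of "\<lambda>j. comp W (int j) \<noteq> {0}"] by blast
  have "comp W m = {0}" if "m < int j" for m
    using W.comp_negative[of m] j(2)[of "nat m"] that by (cases "m < 0") auto
  moreover obtain w where "w \<in> comp W (int j)" "w \<noteq> 0"
    using j(1) W.wsp.subspace_0[OF sub[of "int j"]] by auto
  ultimately show ?thesis by blast
qed

lemma gen_degree: "gen a \<in> VG 1"
  using gen_power_degree[where r = 1] by (simp add: Y_creation)

lemma current_degree:
  assumes "nat_graded_module scaleQ Y vac W VG" "w \<in> comp W k"
  shows "current W (a, n) w \<in> comp W (k - n)"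
  using nat_graded_module.mode_comp[OF assms(1) gen_degree assms(2), of a n] by simp

text \<open>As in \<open>closed_under_modes\<close>, the vectors whose modes commute with \<psi>
  include the vacuum and are closed under the generators. The sums in \<open>mode_iterate\<close>
  are carried over by \<open>Sum_any_inj_additive\<close>.\<close>

lemma equivalent_if_current_equivariant:
  assumes M1: "vertex_algebra_module scaleQ Y vac W1" and M2: "vertex_algebra_module scaleQ Y vac W2"
    and bij: "bij_betw \<psi> (carrier W1) (carrier W2)"
    and add: "\<And>x y. x \<in> carrier W1 \<Longrightarrow> y \<in> carrier W1 \<Longrightarrow> \<psi> (x + y) = \<psi> x + \<psi> y"
    and scl: "\<And>x c. x \<in> carrier W1 \<Longrightarrow> \<psi> (smult W1 c x) = smult W2 c (\<psi> x)"
    and cur: "\<And>x y. x \<in> carrier W1 \<Longrightarrow> \<psi> (current W1 y x) = current W2 y (\<psi> x)"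
    and deg: "\<And>n. \<psi> ` comp W1 n = comp W2 (n + k)"
  shows "graded_module_equivalent W1 W2"
proof -
  interpret W1: vertex_algebra_module scaleQ Y vac W1 by (rule M1)
  interpret W2: vertex_algebra_module scaleQ Y vac W2 by (rule M2)
  have zero1: "mode W1 0 n w = 0" if "w \<in> carrier W1" for n w
    using W1.mode_scale_left[OF that, of 0 0] by simp
  have zero2: "mode W2 0 n w = 0" if "w \<in> carrier W2" for n w
    using W2.mode_scale_left[OF that, of 0 0] by simp
  have p0: "\<psi> 0 = 0"
    using scl[of 0 0] W1.wsp.subspace_0[OF W1.carrier_subspace] by simp
  have pc: "\<psi> x \<in> carrier W2" if "x \<in> carrier W1" for x using bij that by (auto simp: bij_betw_def)
  have pz: "\<psi> x = 0 \<longleftrightarrow> x = 0" if "x \<in> carrier W1" for x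
    using bij that p0 W1.wsp.subspace_0[OF W1.carrier_subspace] unfolding bij_betw_def inj_on_def by metis
  have pdiff: "\<psi> (x - y) = \<psi> x - \<psi> y" if "x \<in> carrier W1" "y \<in> carrier W1" for x y
    using add[of "x - y" y] that W1.wsp.subspace_diff[OF W1.carrier_subspace] by simp
  note psum = W1.wsp.Sum_any_inj_additive[OF W1.carrier_subspace add pz]
  note cl1 = W1.mode_closed W1.wsp.subspace_scale[OF W1.carrier_subspace]
  have cur': "\<psi> (mode W1 (gen a) n x) = mode W2 (gen a) n (\<psi> x)" if "x \<in> carrier W1" for a n x
    using cur[OF that, of "(a, n)"] by simp
  let ?S = "{q. \<forall>n. \<forall>w\<in>carrier W1. \<psi> (mode W1 q n w) = mode W2 q n (\<psi> w)}"
  have all: "q \<in> ?S" for q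
  proof (rule generated)
    show "subspace ?S"
      by (auto simp: subspace_def zero1 zero2 p0 pc W1.mode_add_left W2.mode_add_left
          W1.mode_scale_left W2.mode_scale_left add scl W1.mode_closed)
    show "vac \<in> ?S" by (auto simp: W1.mode_vacuum W2.mode_vacuum pc p0)
    fix a l v assume "v \<in> ?S"
    then have v: "\<psi> (mode W1 v n w) = mode W2 v n (\<psi> w)" if "w \<in> carrier W1" for n w using that by blast
    have "\<psi> (mode W1 (Y (gen a) l v) n w) = mode W2 (Y (gen a) l v) n (\<psi> w)" if w: "w \<in> carrier W1" for n w
      unfolding W1.mode_iterate[OF w] W2.mode_iterate[OF pc[OF w]]
      by (subst pdiff)
        (use w in \<open>auto simp: psum cl1 scl cur' v intro!: W1.wsp.Sum_any_in_subspace W1.carrier_subspace\<close>)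
    then show "Y (gen a) l v \<in> ?S" by blast
  qed
  show ?thesis unfolding graded_module_equivalent_def
    using bij add scl deg all by (intro exI[of _ \<psi>] exI[of _ k]) blast
qed

text \<open>On a lowest component only one term of the iterate formula for \<open>(a(-1)\<^sup>r vac)\<^bsub>r-1\<^esub>\<close> survives,
  so this mode acts as \<open>a(0)\<^sup>r\<close>; likewise \<open>(b(-p) vac)\<^bsub>p-1\<^esub>\<close> acts as \<open>b(0)\<close> as \<open>p\<close> is odd.\<close>

lemma current_power_top:
  assumes gr: "nat_graded_module scaleQ Y vac W VG" and top: "\<And>m. m < n \<Longrightarrow> comp W m = {0}"
    and w: "w \<in> comp W n"
  shows "(current W (a, 0) ^^ CHAR('f)) w = current W (pmap a, 0) w"
proof -
  interpret W: nat_graded_module scaleQ Y vac W VG by (rule gr)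
  define v where "v r = (Y (gen a) (-1) ^^ r) vac" for r
  let ?p = "CHAR('f)"
  have car: "x \<in> comp W k \<Longrightarrow> x \<in> carrier W" for x k
    using W.comp_direct_sum by (auto simp: is_direct_sum_def)
  have pos: "mode W (gen b) (int i) x = 0" if "x \<in> comp W n" "i \<noteq> 0" for b x i
    using current_degree[OF gr that(1), of b "int i"] top[of "n - int i"] that(2) by simp
  have "mode W (v r) (int r - 1) x = (current W (a, 0) ^^ r) x" if "x \<in> comp W n" for r x
    using that
  proof (induction r arbitrary: x)
    case 0
    then show ?case using car by (simp add: v_def W.mode_vacuum)
  next
    case (Suc r)
    \<comment> \<open>\<open>v r\<close> has degree \<open>r\<close>, so these modes lower the
      degree by at least one and leave the lowest component; this removes the whole first sum of
      \<open>mode_iterate\<close>.\<close>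
    have vanish: "mode W (v r) (int r + int i) x = 0" for i
      using W.mode_comp[OF gen_power_degree[where a = a and r = r] Suc.prems, of "int r + int i"]
        top[of "n - int i - 1"] by (simp add: v_def algebra_simps)
    have x': "current W (a, 0) x \<in> comp W n" using current_degree[OF gr Suc.prems, of a 0] by simp
    have "mode W (v (Suc r)) (int (Suc r) - 1) x = mode W (Y (gen a) (-1) (v r)) (int r) x"
      by (simp add: v_def)
    also have "\<dots> = mode W (v r) (int r - 1) (current W (a, 0) x)"
      unfolding W.mode_iterate[OF car[OF Suc.prems]]
      by (simp only: vanish W.mode_zero_right W.wsp.scale_zero_right Sum_any.neutral,
          subst Sum_any_single[of 0]) (auto simp: pos[OF Suc.prems])
    also have "\<dots> = (current W (a, 0) ^^ Suc r) x" using Suc.IH[OF x'] by (simp add: funpow_swap1)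
    finally show ?case .
  qed
  from this[OF w, of ?p]
  have "(current W (a, 0) ^^ ?p) w = mode W (Y (gen (pmap a)) (- int ?p) vac) (int ?p - 1) w"
    by (simp add: v_def gen_power)
  also have "\<dots> = mode W (gen (pmap a)) 0 w"
  proof -
    \<comment> \<open>Only the mode \<open>-1\<close> of the vacuum is nonzero: the index
      \<open>p - 1 + i\<close> never equals \<open>-1\<close>, and the index \<open>-1 - i\<close>
      in the other sum does so for \<open>i = 0\<close> only.\<close>
    have 1: "mode W vac (int ?p - 1 + int i) w = 0" for i
      using CHAR_gt_1 car[OF w] by (simp add: W.mode_vacuum)
    have 2: "mode W vac (int ?p - 1 + - int ?p - int i) (mode W (gen (pmap a)) (int i) w)
        = (if i = 0 then mode W (gen (pmap a)) 0 w else 0)" for i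
      using car[OF w] by (simp add: W.mode_vacuum W.mode_closed)
    have s: "(-1 :: 'f) powi (- int ?p) = -1"
      using CHAR_odd by (simp add: power_int_minus)
    show ?thesis unfolding W.mode_iterate[OF car[OF w]] 1 2
      by (simp only: W.mode_zero_right W.wsp.scale_zero_right Sum_any.neutral,
          subst Sum_any_single[of 0]) (auto simp: s)
  qed
  finally show ?thesis by simp
qed

end

lemma sum_fun_apply: "(\<Sum>k\<in>K. f k) i = (\<Sum>k\<in>K. f k i)"
  by (induction K rule: infinite_finite_induct) auto

section \<open>Tuples from a sequence of irreducible modules\<close>

locale irreducible_sequence =
  restricted_current_algebra scaleQ Y vac scale bracket pmap form lev gen VG B
  for scaleQ :: "'f::field \<Rightarrow> 'q::ab_group_add \<Rightarrow> 'q" and Y :: "'q \<Rightarrow> int \<Rightarrow> 'q \<Rightarrow> 'q" and vac :: 'q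
    and scale :: "'f \<Rightarrow> 'g::ab_group_add \<Rightarrow> 'g" and bracket pmap form lev gen VG B +
  fixes W :: "nat \<Rightarrow> ('f, 'q, 'w::ab_group_add) graded_module" and low :: "nat \<Rightarrow> int" and w0 :: "nat \<Rightarrow> 'w"
  assumes irr: "irreducible (W i)"
    and w0_nonzero: "w0 i \<noteq> 0" and w0_comp: "w0 i \<in> comp (W i) (low i)"
    and below_low: "n < low i \<Longrightarrow> comp (W i) n = {0}"
begin

text \<open>The modules share the type \<open>'w\<close>, but each brings its own scalar
  multiplication, so scalars act through a different operation in each coordinate.\<close>

definition tuple_scale :: "'f \<Rightarrow> (nat \<Rightarrow> 'w) \<Rightarrow> nat \<Rightarrow> 'w" where
  "tuple_scale c u = (\<lambda>i. smult (W i) c (u i))"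

definition tuples :: "(nat \<Rightarrow> 'w) set" where
  "tuples = {u. \<forall>i. u i \<in> carrier (W i)}"

definition tuple_current :: "'g \<times> int \<Rightarrow> (nat \<Rightarrow> 'w) \<Rightarrow> nat \<Rightarrow> 'w" where
  "tuple_current x u = (\<lambda>i. current (W i) x (u i))"

text \<open>The shift by \<open>low i\<close> puts all lowest components into degree 0, so that a
  word in the currents applied to \<open>w0\<close> is homogeneous as a tuple.\<close>

definition tuple_comp :: "int \<Rightarrow> (nat \<Rightarrow> 'w) set" where
  "tuple_comp k = {u. \<forall>i. u i \<in> comp (W i) (low i + k)}"

sublocale M: nat_graded_module scaleQ Y vac "W i" VG for i
  by (rule irreducible_graded[OF irr])

lemma current_ops: "current_operators (smult (W i)) (carrier (W i)) (current (W i)) scale bracket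
    (\<lambda>a m b n. if m + n = 0 then of_int m * lev * form a b else 0)"
  by (rule current_operators[OF irreducible_module[OF irr]])

sublocale D: current_operators tuple_scale tuples tuple_current scale bracket
  "\<lambda>a m b n. if m + n = 0 then of_int m * lev * form a b else 0"
proof -
  interpret C: current_operators "smult (W i)" "carrier (W i)" "current (W i)" scale bracket
    "\<lambda>a m b n. if m + n = 0 then of_int m * lev * form a b else 0" for i
    by (rule current_ops)
  interpret T: vector_space tuple_scale
    by unfold_locales (auto simp: tuple_scale_def fun_eq_iff M.wsp.scale_right_distrib M.wsp.scale_left_distrib)
  show "current_operators tuple_scale tuples tuple_current scale bracket
      (\<lambda>a m b n. if m + n = 0 then of_int m * lev * form a b else 0)"
  proof unfold_locales
    show "T.subspace tuples" using C.C_subspace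
      by (auto simp: T.subspace_def M.wsp.subspace_def tuples_def tuple_scale_def)
    fix u a b and m n :: int assume u: "u \<in> tuples"
    show "tuple_current (a, m) (tuple_current (b, n) u) = tuple_current (b, n) (tuple_current (a, m) u) +
        tuple_current (bracket a b, m + n) u +
        tuple_scale (if m + n = 0 then of_int m * lev * form a b else 0) u"
    proof
      fix i
      have "u i \<in> carrier (W i)" using u by (simp add: tuples_def)
      from C.commute[OF this, of a m b n]
      show "tuple_current (a, m) (tuple_current (b, n) u) i = (tuple_current (b, n) (tuple_current (a, m) u) +
        tuple_current (bracket a b, m + n) u +
        tuple_scale (if m + n = 0 then of_int m * lev * form a b else 0) u) i"
        by (simp only: tuple_current_def tuple_scale_def plus_fun_apply)
    qed
  qed (auto simp: tuples_def tuple_current_def tuple_scale_def fun_eq_iff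
      C.X_closed C.X_add C.X_scale C.letter_add C.letter_scale simp del: fst_conv snd_conv)
qed

lemma comp_subspace: "M.wsp.subspace i (comp (W i) k)"
  using M.comp_direct_sum[of i] by (simp add: is_direct_sum_def)

lemma comp_carrier: "w \<in> comp (W i) k \<Longrightarrow> w \<in> carrier (W i)"
  using M.comp_direct_sum[of i] by (auto simp: is_direct_sum_def)

lemma tuple_comp_subspace: "D.subspace (tuple_comp k)"
  using comp_subspace
  by (simp add: D.subspace_def M.wsp.subspace_def tuple_comp_def tuple_scale_def)

lemma tuple_compD: "u \<in> tuple_comp k \<Longrightarrow> u i \<in> comp (W i) (low i + k)"
  by (simp only: tuple_comp_def mem_Collect_eq)

lemma tuple_comp_carrier: "u \<in> tuple_comp k \<Longrightarrow> u \<in> tuples"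
  using comp_carrier by (fastforce simp: tuple_comp_def tuples_def)

lemma tuple_current_degree: "u \<in> tuple_comp k \<Longrightarrow> tuple_current (a, n) u \<in> tuple_comp (k - n)"
  using current_degree[OF irreducible_graded[OF irr], of "u i" i "low i + k" a n for i]
  by (simp add: tuple_comp_def tuple_current_def algebra_simps)

lemma component_coordinate:
  assumes "finite K" "\<And>k. k \<in> K \<Longrightarrow> f k \<in> tuple_comp k"
    and "(\<Sum>k\<in>K. f k i) \<in> comp (W i) (low i + m)" and "k \<in> K"
  shows "f k i = (if k = m then \<Sum>k\<in>K. f k i else 0)"
proof -
  let ?f = "\<lambda>n. f (n - low i) i"
  have s: "(\<Sum>n\<in>(+) (low i) ` K. ?f n) = (\<Sum>k\<in>K. f k i)"
    by (subst sum.reindex) (auto simp: o_def)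
  have "?f (low i + k) = (if low i + k = low i + m then \<Sum>n\<in>(+) (low i) ` K. ?f n else 0)"
    by (rule M.wsp.direct_sum_component[OF M.comp_direct_sum M.carrier_subspace])
      (use assms s in \<open>auto simp: tuple_comp_def\<close>)
  then show ?thesis unfolding s by simp
qed

text \<open>Spanning by homogeneous tuples is demanded explicitly: a tuple whose coordinates have
  unbounded degrees is not a finite sum of homogeneous ones.\<close>

definition graded_sub :: "(nat \<Rightarrow> 'w) set \<Rightarrow> bool" where
  "graded_sub L \<longleftrightarrow> D.subspace L \<and> L \<subseteq> tuples \<and> (\<forall>x. \<forall>u\<in>L. tuple_current x u \<in> L) \<and>
     L \<subseteq> D.span (\<Union>k. L \<inter> tuple_comp k)"

lemma graded_sub_decompose:
  assumes "graded_sub L" "u \<in> L"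
  obtains K f where "finite K" "\<And>k. k \<in> K \<Longrightarrow> f k \<in> L \<inter> tuple_comp k" "u = (\<Sum>k\<in>K. f k)"
proof -
  have "D.subspace (L \<inter> tuple_comp k)" for k
    using assms(1) tuple_comp_subspace by (simp add: graded_sub_def D.subspace_inter)
  moreover have "u \<in> D.span (\<Union>k. L \<inter> tuple_comp k)" using assms by (auto simp: graded_sub_def)
  ultimately obtain f :: "int \<Rightarrow>\<^sub>0 (nat \<Rightarrow> 'w)" where
    "\<forall>k. Poly_Mapping.lookup f k \<in> L \<inter> tuple_comp k" "u = (\<Sum>k\<in>Poly_Mapping.keys f. Poly_Mapping.lookup f k)"
    using D.span_Union_subspaces[of "\<lambda>k. L \<inter> tuple_comp k" u] by metis
  then show ?thesis using that[of "Poly_Mapping.keys f"] by auto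
qed

text \<open>If \<open>u\<close> vanishes at \<open>j\<close>, so do all its homogeneous parts, by
  uniqueness of the decomposition in \<open>W j\<close>.\<close>

lemma graded_sub_kernel:
  assumes L: "graded_sub L"
  shows "graded_sub {u \<in> L. u j = 0}"
  unfolding graded_sub_def
proof (intro conjI)
  let ?L = "{u \<in> L. u j = 0}"
  have DL: "D.subspace L" using L by (simp add: graded_sub_def)
  show "D.subspace ?L" using DL by (auto simp: D.subspace_def tuple_scale_def)
  show "?L \<subseteq> tuples" "\<forall>x. \<forall>u\<in>?L. tuple_current x u \<in> ?L"
    using L by (auto simp: graded_sub_def tuple_current_def)
  show "?L \<subseteq> D.span (\<Union>k. ?L \<inter> tuple_comp k)"
  proof
    fix u assume u: "u \<in> ?L"
    then obtain K f where K: "finite K" and f: "\<And>k. k \<in> K \<Longrightarrow> f k \<in> L \<inter> tuple_comp k" and s: "u = (\<Sum>k\<in>K. f k)"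
      using graded_sub_decompose[OF L] by blast
    have "(\<Sum>k\<in>K. f k j) = 0" using u s by (simp add: sum_fun_apply)
    then have "f k j = 0" if "k \<in> K" for k
      using component_coordinate[of K f j 0 k] K f that M.wsp.subspace_0[OF comp_subspace] by auto
    then show "u \<in> D.span (\<Union>k. ?L \<inter> tuple_comp k)" unfolding s
      using f by (intro D.span_sum D.span_base) auto
  qed
qed

text \<open>The projection of \<open>L\<close> is a nonzero graded submodule of an irreducible
  module.\<close>

lemma graded_sub_surj:
  assumes L: "graded_sub L" and ne: "\<exists>u\<in>L. u i \<noteq> 0"
  shows "(\<lambda>u. u i) ` L = carrier (W i)"
proof (rule irreducible_full[OF irr])
  have DL: "D.subspace L" "L \<subseteq> tuples" using L by (simp_all add: graded_sub_def)
  have add: "u + v \<in> L" if "u \<in> L" "v \<in> L" for u v using DL that D.subspace_add by blast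
  have sc: "tuple_scale c u \<in> L" if "u \<in> L" for c u using DL that D.subspace_scale by blast
  have E: "\<exists>u. u \<in> L \<and> w = u i" if "w \<in> (\<lambda>u. u i) ` L" for w
    using that by (simp add: image_iff Bex_def)
  show "M.wsp.subspace i ((\<lambda>u. u i) ` L)"
  proof (rule M.wsp.subspaceI)
    have "(0::nat \<Rightarrow> 'w) i \<in> (\<lambda>u. u i) ` L" using D.subspace_0[OF DL(1)] by (rule imageI)
    then show "0 \<in> (\<lambda>u. u i) ` L" by (simp only: zero_fun_apply)
    show "x + y \<in> (\<lambda>u. u i) ` L" if xy: "x \<in> (\<lambda>u. u i) ` L" "y \<in> (\<lambda>u. u i) ` L" for x y
    proof -
      obtain u where u: "u \<in> L \<and> x = u i" using E[OF xy(1)] by (rule exE)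
      obtain v where v: "v \<in> L \<and> y = v i" using E[OF xy(2)] by (rule exE)
      then have "(u + v) i \<in> (\<lambda>u. u i) ` L" using u by (intro imageI add) simp_all
      then show ?thesis using u v by (simp only: plus_fun_apply)
    qed
    show "smult (W i) c x \<in> (\<lambda>u. u i) ` L" if x: "x \<in> (\<lambda>u. u i) ` L" for c x
    proof -
      obtain u where u: "u \<in> L \<and> x = u i" using E[OF x] by (rule exE)
      then have "tuple_scale c u i \<in> (\<lambda>u. u i) ` L" by (intro imageI sc) simp_all
      then show ?thesis using u by (simp only: tuple_scale_def)
    qed
  qed
  show "(\<lambda>u. u i) ` L \<subseteq> carrier (W i)" using DL by (auto simp: tuples_def)
  show "current (W i) x w \<in> (\<lambda>u. u i) ` L" if x: "w \<in> (\<lambda>u. u i) ` L" for x w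
  proof -
    obtain u where u: "u \<in> L \<and> w = u i" using E[OF x] by (rule exE)
    then have "tuple_current x u \<in> L" "tuple_current x u i = current (W i) x w"
      using L by (auto simp: graded_sub_def tuple_current_def)
    then show ?thesis by (metis imageI)
  qed
  show "\<exists>w\<in>(\<lambda>u. u i) ` L. w \<noteq> 0" using ne by auto
  show "(\<lambda>u. u i) ` L \<subseteq> M.wsp.span i (\<Union>k. (\<lambda>u. u i) ` L \<inter> comp (W i) k)"
  proof safe
    fix u assume "u \<in> L"
    then obtain K f where K: "finite K" and f: "\<And>k. k \<in> K \<Longrightarrow> f k \<in> L \<inter> tuple_comp k" and s: "u = (\<Sum>k\<in>K. f k)"
      using graded_sub_decompose[OF L] by blast
    show "u i \<in> M.wsp.span i (\<Union>k. (\<lambda>u. u i) ` L \<inter> comp (W i) k)"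
      unfolding s sum_fun_apply
    proof (intro M.wsp.span_sum M.wsp.span_base)
      fix k assume "k \<in> K"
      then have "f k i \<in> (\<lambda>u. u i) ` L \<inter> comp (W i) (low i + k)" using f by (auto simp: tuple_comp_def)
      then show "f k i \<in> (\<Union>k. (\<lambda>u. u i) ` L \<inter> comp (W i) k)" by blast
    qed
  qed
qed

text \<open>The witness is the part of \<open>u\<close> of degree \<open>m\<close>; if there is
  none, \<open>u j\<close> is 0 and the zero tuple serves.\<close>

lemma graded_sub_homogeneous:
  assumes L: "graded_sub L" and u: "u \<in> L" and m: "u j \<in> comp (W j) (low j + m)"
  shows "\<exists>v\<in>L \<inter> tuple_comp m. v j = u j"
proof -
  obtain K f where K: "finite K" and f: "\<And>k. k \<in> K \<Longrightarrow> f k \<in> L \<inter> tuple_comp k" and s: "u = (\<Sum>k\<in>K. f k)"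
    using graded_sub_decompose[OF L u] by blast
  have c: "f k j = (if k = m then u j else 0)" if "k \<in> K" for k
    using component_coordinate[of K f j m k] K f that m by (auto simp: s sum_fun_apply)
  show ?thesis
  proof (cases "m \<in> K")
    case True
    then show ?thesis using f c by (intro bexI[of _ "f m"]) auto
  next
    case False
    then have "u j = 0" unfolding s sum_fun_apply using c by (intro sum.neutral) auto
    moreover have "0 \<in> L \<inter> tuple_comp m"
      using L D.subspace_0 tuple_comp_subspace by (auto simp: graded_sub_def)
    ultimately show ?thesis by (intro bexI[of _ 0]) auto
  qed
qed

text \<open>A graded space of tuples whose \<open>j\<close>-th coordinates determine the \<open>i\<close>-th coordinates is the graph
  of a homomorphism.\<close>

lemma graded_sub_graph:
  assumes L: "graded_sub L" and ne: "\<exists>u\<in>L. u i \<noteq> 0" and det: "\<And>u. u \<in> L \<Longrightarrow> u j = 0 \<Longrightarrow> u i = 0"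
  shows "graded_module_equivalent (W j) (W i)"
proof -
  have DL: "D.subspace L" "L \<subseteq> tuples" using L by (simp_all add: graded_sub_def)
  have diff: "u - v \<in> L" if "u \<in> L" "v \<in> L" for u v using DL that D.subspace_diff by blast
  have add: "u + v \<in> L" if "u \<in> L" "v \<in> L" for u v using DL that D.subspace_add by blast
  have sc: "tuple_scale c u \<in> L" if "u \<in> L" for c u using DL that D.subspace_scale by blast
  have cl: "tuple_current y u \<in> L" if "u \<in> L" for y u using L that by (simp only: graded_sub_def)
  have nej: "\<exists>u\<in>L. u j \<noteq> 0" using ne det by blast
  have surj_i: "(\<lambda>u. u i) ` L = carrier (W i)" by (rule graded_sub_surj[OF L ne])
  have surj_j: "(\<lambda>u. u j) ` L = carrier (W j)" by (rule graded_sub_surj[OF L nej])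
  have lift_i: "\<exists>u. u \<in> L \<and> x = u i" if "x \<in> carrier (W i)" for x
    using that unfolding surj_i[symmetric] by (simp add: image_iff Bex_def)
  have lift_j: "\<exists>u. u \<in> L \<and> x = u j" if "x \<in> carrier (W j)" for x
    using that unfolding surj_j[symmetric] by (simp add: image_iff Bex_def)
  \<comment> \<open>The converse of \<open>det\<close>. If it failed, the tuples vanishing at
    \<open>i\<close> would still project onto \<open>W j\<close>, so a tuple with nonzero
    \<open>i\<close>-th coordinate could be corrected to vanish at \<open>j\<close> without changing
    that coordinate, against \<open>det\<close>.\<close>
  have det': "u j = 0" if u: "u \<in> L" "u i = 0" for u
  proof (rule ccontr)
    assume "u j \<noteq> 0"
    then have s: "(\<lambda>u. u j) ` {u \<in> L. u i = 0} = carrier (W j)"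
      using u by (intro graded_sub_surj[OF graded_sub_kernel[OF L]]) auto
    obtain v where v: "v \<in> L" "v i \<noteq> 0" using ne by blast
    have "v j \<in> carrier (W j)" using v(1) DL by (auto simp: tuples_def)
    then have "\<exists>v'. (v' \<in> L \<and> v' i = 0) \<and> v j = v' j" unfolding s[symmetric] by (simp add: image_iff Bex_def)
    then obtain v' where "(v' \<in> L \<and> v' i = 0) \<and> v j = v' j" by (rule exE)
    then have v': "v' \<in> L" "v' i = 0" "v' j = v j" by simp_all
    show False using det[OF diff[OF v(1) v'(1)]] v v' by simp
  qed
  have eq_i: "u i = v i" if "u \<in> L" "v \<in> L" "u j = v j" for u v
    using det[OF diff[OF that(1,2)]] that by simp
  have eq_j: "u j = v j" if "u \<in> L" "v \<in> L" "u i = v i" for u v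
    using det'[OF diff[OF that(1,2)]] that by simp
  \<comment> \<open>\<psi> reads off the \<open>i\<close>-th coordinate of some lift of
    \<open>x\<close>; by \<open>eq_i\<close> the choice of the lift does not matter.\<close>
  define \<psi> where "\<psi> x = (SOME u. u \<in> L \<and> u j = x) i" for x
  have \<psi>: "\<psi> (u j) = u i" if "u \<in> L" for u
  proof -
    have "(SOME v. v \<in> L \<and> v j = u j) \<in> L \<and> (SOME v. v \<in> L \<and> v j = u j) j = u j"
      by (rule someI[of _ u]) (use that in simp)
    then show ?thesis unfolding \<psi>_def using eq_i[of "SOME v. v \<in> L \<and> v j = u j" u] that by simp
  qed
  have inj: "inj_on \<psi> (carrier (W j))"
  proof (rule inj_onI)
    fix x y assume x: "x \<in> carrier (W j)" and y: "y \<in> carrier (W j)" and eq: "\<psi> x = \<psi> y"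
    obtain u where u: "u \<in> L \<and> x = u j" using lift_j[OF x] by (rule exE)
    obtain v where v: "v \<in> L \<and> y = v j" using lift_j[OF y] by (rule exE)
    show "x = y" using eq_j[of u v] eq \<psi>[of u] \<psi>[of v] u v by simp
  qed
  have img: "\<psi> ` carrier (W j) = carrier (W i)"
    unfolding surj_j[symmetric] surj_i[symmetric] image_image by (rule image_cong[OF refl \<psi>])
  have p_add: "\<psi> (x + y) = \<psi> x + \<psi> y" if xy: "x \<in> carrier (W j)" "y \<in> carrier (W j)" for x y
  proof -
    obtain u where u: "u \<in> L \<and> x = u j" using lift_j[OF xy(1)] by (rule exE)
    obtain v where v: "v \<in> L \<and> y = v j" using lift_j[OF xy(2)] by (rule exE)
    from u v show ?thesis using \<psi>[OF add, of u v] \<psi>[of u] \<psi>[of v] by simp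
  qed
  have p_scale: "\<psi> (smult (W j) c x) = smult (W i) c (\<psi> x)" if x: "x \<in> carrier (W j)" for c x
  proof -
    obtain u where "u \<in> L \<and> x = u j" using lift_j[OF x] by (rule exE)
    then show ?thesis using \<psi>[OF sc, of u c] \<psi>[of u] by (simp add: tuple_scale_def)
  qed
  have p_current: "\<psi> (current (W j) y x) = current (W i) y (\<psi> x)" if x: "x \<in> carrier (W j)" for y x
  proof -
    obtain u where u: "u \<in> L \<and> x = u j" using lift_j[OF x] by (rule exE)
    then have "\<psi> (tuple_current y u j) = tuple_current y u i" by (intro \<psi>[OF cl]) simp
    then show ?thesis using \<psi>[of u] u by (simp only: tuple_current_def)
  qed
  \<comment> \<open>Both components are projections of the tuples in \<open>L\<close> of degree
    \<open>n - low j\<close>, which accounts for the shift \<open>low i - low j\<close>.\<close>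
  have p_comp: "\<psi> ` comp (W j) n = comp (W i) (n + (low i - low j))" for n
  proof -
    have "\<psi> ` comp (W j) n = (\<lambda>u. u i) ` (L \<inter> tuple_comp (n - low j))"
    proof -
      have "comp (W j) n = (\<lambda>u. u j) ` (L \<inter> tuple_comp (n - low j))"
      proof
        show "comp (W j) n \<subseteq> (\<lambda>u. u j) ` (L \<inter> tuple_comp (n - low j))"
        proof
          fix x assume x: "x \<in> comp (W j) n"
          obtain u where u: "u \<in> L \<and> x = u j" using lift_j[OF comp_carrier[OF x]] by (rule exE)
          then have "\<exists>v\<in>L \<inter> tuple_comp (n - low j). v j = u j"
            using x by (intro graded_sub_homogeneous[OF L]) simp_all
          then obtain v where "v \<in> L \<inter> tuple_comp (n - low j)" "v j = u j" by (rule bexE)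
          then show "x \<in> (\<lambda>u. u j) ` (L \<inter> tuple_comp (n - low j))"
            using u by (intro image_eqI[of _ _ v]) simp_all
        qed
        show "(\<lambda>u. u j) ` (L \<inter> tuple_comp (n - low j)) \<subseteq> comp (W j) n"
        proof (rule image_subsetI)
          fix u assume "u \<in> L \<inter> tuple_comp (n - low j)"
          then have "u \<in> tuple_comp (n - low j)" by (rule IntD2)
          from tuple_compD[OF this, of j] show "u j \<in> comp (W j) n" by simp
        qed
      qed
      also have "\<psi> ` \<dots> = (\<lambda>u. u i) ` (L \<inter> tuple_comp (n - low j))"
        unfolding image_image
      proof (rule image_cong[OF refl])
        fix u assume "u \<in> L \<inter> tuple_comp (n - low j)"
        then have "u \<in> L" by (rule IntD1)
        then show "\<psi> (u j) = u i" by (rule \<psi>[of u])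
      qed
      finally show ?thesis .
    qed
    also have "\<dots> = comp (W i) (n + (low i - low j))"
    proof
      show "comp (W i) (n + (low i - low j)) \<subseteq> (\<lambda>u. u i) ` (L \<inter> tuple_comp (n - low j))"
      proof
        fix x assume x: "x \<in> comp (W i) (n + (low i - low j))"
        obtain u where u: "u \<in> L \<and> x = u i" using lift_i[OF comp_carrier[OF x]] by (rule exE)
        have "u i \<in> comp (W i) (low i + (n - low j))" using x u by (simp add: algebra_simps)
        then have "\<exists>v\<in>L \<inter> tuple_comp (n - low j). v i = u i"
          using u by (intro graded_sub_homogeneous[OF L]) simp_all
        then obtain v where "v \<in> L \<inter> tuple_comp (n - low j)" "v i = u i" by (rule bexE)
        then show "x \<in> (\<lambda>u. u i) ` (L \<inter> tuple_comp (n - low j))"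
          using u by (intro image_eqI[of _ _ v]) simp_all
      qed
      show "(\<lambda>u. u i) ` (L \<inter> tuple_comp (n - low j)) \<subseteq> comp (W i) (n + (low i - low j))"
      proof (rule image_subsetI)
        fix u assume "u \<in> L \<inter> tuple_comp (n - low j)"
        then have "u \<in> tuple_comp (n - low j)" by (rule IntD2)
        from tuple_compD[OF this, of i] show "u i \<in> comp (W i) (n + (low i - low j))" by (simp add: algebra_simps)
      qed
    qed
    finally show ?thesis .
  qed
  show ?thesis
    by (rule equivalent_if_current_equivariant[OF irreducible_module[OF irr] irreducible_module[OF irr]
      bij_betw_imageI[OF inj img] p_add p_scale p_current p_comp])
qed

end

section \<open>The module generated by the tuple of lowest vectors\<close>

context irreducible_sequence
begin

definition orbit :: "(nat \<Rightarrow> 'w) set" where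
  "orbit = D.span (range (\<lambda>xs. foldr tuple_current xs w0))"

lemma w0_tuple_comp: "w0 \<in> tuple_comp 0"
  using w0_comp by (simp add: tuple_comp_def)

lemma w0_tuples: "w0 \<in> tuples"
  by (rule tuple_comp_carrier[OF w0_tuple_comp])

lemma word_degree: "u \<in> tuple_comp k \<Longrightarrow> foldr tuple_current xs u \<in> tuple_comp (k - (\<Sum>(a, n)\<leftarrow>xs. n))"
proof (induction xs)
  case (Cons x xs)
  obtain a n where x: "x = (a, n)" by force
  show ?case
    using tuple_current_degree[OF Cons.IH[OF Cons.prems], of a n] by (simp add: x algebra_simps)
qed simp

lemma orbit_graded_sub: "graded_sub orbit"
  unfolding graded_sub_def
proof (intro conjI allI ballI)
  let ?R = "range (\<lambda>xs. foldr tuple_current xs w0)"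
  have R: "?R \<subseteq> tuples" using w0_tuples D.word_closed by blast
  show "D.subspace orbit" unfolding orbit_def by (rule D.subspace_span)
  show "orbit \<subseteq> tuples" unfolding orbit_def by (rule D.span_minimal[OF R D.C_subspace])
  show "tuple_current x u \<in> orbit" if u: "u \<in> orbit" for x u
  proof (rule D.X_span[OF R _ _ u[unfolded orbit_def]])
    fix s assume "s \<in> ?R"
    then obtain xs where "s = foldr tuple_current xs w0" by auto
    then have "tuple_current x s = foldr tuple_current (x # xs) w0" by simp
    then show "tuple_current x s \<in> orbit" unfolding orbit_def by (metis D.span_base rangeI)
  qed (simp add: orbit_def D.subspace_span)
  have "?R \<subseteq> (\<Union>k. orbit \<inter> tuple_comp k)"
  proof (rule image_subsetI)
    fix xs
    have "foldr tuple_current xs w0 \<in> orbit" unfolding orbit_def by (intro D.span_base rangeI)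
    moreover note word_degree[OF w0_tuple_comp, of xs]
    ultimately show "foldr tuple_current xs w0 \<in> (\<Union>k. orbit \<inter> tuple_comp k)" by blast
  qed
  then have "D.span ?R \<subseteq> D.span (\<Union>k. orbit \<inter> tuple_comp k)" by (rule D.span_mono)
  then show "orbit \<subseteq> D.span (\<Union>k. orbit \<inter> tuple_comp k)" unfolding orbit_def[symmetric] .
qed

lemma orbit_kernel_graded_sub:
  assumes "finite J"
  shows "graded_sub {u \<in> orbit. \<forall>j\<in>J. u j = 0}"
  using assms
proof induction
  case empty
  then show ?case using orbit_graded_sub by simp
next
  case (insert j J)
  have "{u \<in> orbit. \<forall>j\<in>insert j J. u j = 0} = {u \<in> {u \<in> orbit. \<forall>j\<in>J. u j = 0}. u j = 0}" by auto
  then show ?case using graded_sub_kernel[OF insert.IH, of j] by simp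
qed

text \<open>Induction on \<open>J\<close>. If no tuple vanishing on \<open>J\<close> and at
  \<open>j\<close> were nonzero at \<open>i\<close>, then among the tuples vanishing on
  \<open>J\<close> the \<open>j\<close>-th coordinate would determine the \<open>i\<close>-th, and
  \<open>graded_sub_graph\<close> would yield an equivalence.\<close>

lemma orbit_separates:
  assumes "finite J" "\<And>j. j \<in> J \<Longrightarrow> \<not> graded_module_equivalent (W j) (W i)"
  shows "\<exists>u\<in>orbit. (\<forall>j\<in>J. u j = 0) \<and> u i \<noteq> 0"
  using assms
proof induction
  case empty
  have "w0 \<in> orbit" unfolding orbit_def by (intro D.span_base image_eqI[of _ _ "[]"]) auto
  then show ?case using w0_nonzero by auto
next
  case (insert j J)
  let ?L = "{u \<in> orbit. \<forall>j\<in>J. u j = 0}"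
  show ?case
  proof (rule ccontr)
    assume "\<not> ?thesis"
    then have det: "u i = 0" if "u \<in> ?L" "u j = 0" for u using that by blast
    have "\<exists>u\<in>?L. u i \<noteq> 0" using insert.IH insert.prems by blast
    then have "graded_module_equivalent (W j) (W i)"
      by (rule graded_sub_graph[OF orbit_kernel_graded_sub[OF insert.hyps(1)] _ det])
    then show False using insert.prems by blast
  qed
qed

text \<open>The tuples vanishing on \<open>J\<close> project onto all of \<open>W i\<close>, so one
  of them hits \<open>w0 i\<close>; a homogeneous tuple of degree 0 with the same coordinate is then
  found among them.\<close>

lemma orbit_degree_0_separates:
  assumes J: "finite J" "\<And>j. j \<in> J \<Longrightarrow> \<not> graded_module_equivalent (W j) (W i)"
  shows "\<exists>u\<in>orbit \<inter> tuple_comp 0. (\<forall>j\<in>J. u j = 0) \<and> u i \<noteq> 0"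
proof -
  let ?L = "{u \<in> orbit. \<forall>j\<in>J. u j = 0}"
  note L = orbit_kernel_graded_sub[OF J(1)]
  have "(\<lambda>u. u i) ` ?L = carrier (W i)"
    using orbit_separates[OF J] by (intro graded_sub_surj[OF L]) auto
  then have "w0 i \<in> (\<lambda>u. u i) ` ?L" using comp_carrier[OF w0_comp] by simp
  then have "\<exists>u. u \<in> ?L \<and> w0 i = u i" by (simp only: image_iff Bex_def)
  then obtain u where u: "u \<in> ?L \<and> w0 i = u i" by (rule exE)
  then have "u i \<in> comp (W i) (low i + 0)" using w0_comp[of i] by simp
  then have "\<exists>v\<in>?L \<inter> tuple_comp 0. v i = u i" using u by (intro graded_sub_homogeneous[OF L]) auto
  then obtain v where "v \<in> ?L \<inter> tuple_comp 0" "v i = u i" by (rule bexE)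
  then show ?thesis using u w0_nonzero[of i] by (intro bexI[of _ v]) auto
qed

section \<open>Zero modes on lowest vectors and the dimension bound\<close>

definition zero_mode_words :: "'g list set \<Rightarrow> (nat \<Rightarrow> 'w) set" where
  "zero_mode_words A = (\<lambda>xs. foldr (\<lambda>b. tuple_current (b, 0)) xs w0) ` A"

abbreviation top_span :: "(nat \<Rightarrow> 'w) set" where
  "top_span \<equiv> D.span (zero_mode_words {xs. set xs \<subseteq> B})"

lemma zero_mode_ops: "linear_operators tuple_scale tuples (\<lambda>b. tuple_current (b, 0))"
  by unfold_locales (simp_all add: D.C_subspace D.X_closed D.X_add D.X_scale)

lemma top_span_comp: "top_span \<subseteq> tuple_comp 0"
proof (rule D.span_minimal[OF _ tuple_comp_subspace])
  have "foldr (\<lambda>b. tuple_current (b, 0)) xs w0 \<in> tuple_comp 0" for xs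
  proof (induction xs)
    case (Cons b xs)
    then show ?case using tuple_current_degree[of _ 0 b 0] by simp
  qed (simp add: w0_tuple_comp)
  then show "zero_mode_words {xs. set xs \<subseteq> B} \<subseteq> tuple_comp 0" by (auto simp: zero_mode_words_def)
qed

text \<open>Positive modes fall below the lowest components and give 0; zero modes are expanded in
  letters from \<open>B\<close>.\<close>

lemma top_span_closed:
  assumes n: "0 \<le> n" and z: "z \<in> top_span"
  shows "tuple_current (a, n) z \<in> top_span"
proof (cases "n = 0")
  case True
  let ?S = "zero_mode_words {xs. set xs \<subseteq> B}"
  have SC: "?S \<subseteq> tuples" using top_span_comp tuple_comp_carrier D.span_superset by blast
  show ?thesis unfolding True
  proof (rule D.letter_span[of _ B])
    show "a \<in> g.span B" by (simp add: span_B)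
    show "D.subspace top_span" by (rule D.subspace_span)
    show "z \<in> tuples" using z top_span_comp tuple_comp_carrier by blast
    fix b assume b: "b \<in> B"
    show "tuple_current (b, 0) z \<in> top_span"
    proof (rule D.X_span[OF SC D.subspace_span _ z])
      fix s assume "s \<in> ?S"
      then obtain xs where xs: "set xs \<subseteq> B" and s: "s = foldr (\<lambda>b. tuple_current (b, 0)) xs w0"
        by (auto simp: zero_mode_words_def)
      show "tuple_current (b, 0) s \<in> top_span" unfolding zero_mode_words_def
        by (intro D.span_base image_eqI[of _ _ "b # xs"]) (use xs s b in auto)
    qed
  qed
next
  case False
  have "z \<in> tuple_comp 0" using z top_span_comp by blast
  then have c: "tuple_current (a, n) z \<in> tuple_comp (0 - n)" by (rule tuple_current_degree)
  have "tuple_current (a, n) z = 0"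
  proof
    fix i
    show "tuple_current (a, n) z i = 0 i"
      using tuple_compD[OF c, of i] below_low[of "low i + (0 - n)" i] n False by simp
  qed
  then show ?thesis by (simp add: D.span_zero)
qed

text \<open>The orbit lies in the negative span of \<open>top_span\<close>, and every nonempty word
  in negative modes raises the degree, so degree 0 is left to \<open>top_span\<close>.\<close>

lemma orbit_degree_0: "orbit \<inter> tuple_comp 0 \<subseteq> top_span"
proof safe
  fix u assume u: "u \<in> orbit" "u \<in> tuple_comp 0"
  have ZC: "top_span \<subseteq> tuples" using top_span_comp tuple_comp_carrier by blast
  let ?N = "D.negative_span top_span"
  have w0: "w0 \<in> ?N"
    by (intro D.negative_span_base D.span_base) (auto simp: zero_mode_words_def intro!: image_eqI[of _ _ "[]"])
  have words: "foldr tuple_current xs w0 \<in> ?N" for xs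
  proof (induction xs)
    case (Cons x xs)
    then show ?case using D.negative_span_closed[OF ZC top_span_closed] by simp
  qed (simp add: w0)
  have "D.subspace ?N" unfolding D.negative_span_def by (rule D.subspace_span)
  then have "orbit \<subseteq> ?N" unfolding orbit_def by (rule D.span_minimal[OF image_subsetI[OF words]])
  then have uN: "u \<in> ?N" using u by blast
  \<comment> \<open>Positive degrees call for no precision: \<open>H\<close> admits every
    homogeneous tuple there and is sharp only in degree 0.\<close>
  define H where "H k = (if k = 0 then top_span else if 0 < k then tuple_comp k else {0})" for k :: int
  have Hsub: "D.subspace (H k)" for k
    by (simp add: H_def D.subspace_span tuple_comp_subspace D.subspace_0 D.subspace_single_0)
  have Hcomp: "H k \<subseteq> tuple_comp k" for k
    using top_span_comp D.subspace_0[OF tuple_comp_subspace] by (auto simp: H_def)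
  have neg: "\<exists>k. foldr tuple_current xs z \<in> H k" if z: "z \<in> top_span" and xs: "\<forall>(b, m)\<in>set xs. m < 0" for xs z
  proof (cases "xs = []")
    case True
    then show ?thesis using z by (intro exI[of _ 0]) (simp add: H_def)
  next
    case False
    have "(\<Sum>(a, n)\<leftarrow>ys. n) < 0" if "\<forall>(b, m)\<in>set ys. m < 0" "ys \<noteq> []" for ys :: "('g \<times> int) list"
      using that
    proof (induction ys)
      case (Cons y ys)
      then show ?case by (cases "ys = []") (auto split: prod.splits)
    qed simp
    from this[OF xs False] have "(\<Sum>(a, n)\<leftarrow>xs. n) < 0" .
    moreover have "foldr tuple_current xs z \<in> tuple_comp (0 - (\<Sum>(a, n)\<leftarrow>xs. n))"
      using z top_span_comp by (intro word_degree) blast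
    ultimately show ?thesis by (intro exI[of _ "- (\<Sum>(a, n)\<leftarrow>xs. n)"]) (simp add: H_def)
  qed
  have "?N \<subseteq> D.span (\<Union>k. H k)" unfolding D.negative_span_def
    by (rule D.span_mono) (use neg in blast)
  then have "u \<in> D.span (\<Union>k. H k)" using uN by blast
  from D.span_Union_subspaces[OF Hsub this] obtain f
    where f: "\<And>k. Poly_Mapping.lookup f k \<in> H k"
      and s: "u = (\<Sum>k\<in>Poly_Mapping.keys f. Poly_Mapping.lookup f k)" by blast
  have "Poly_Mapping.lookup f k = 0" if k: "k \<in> Poly_Mapping.keys f" "k \<noteq> 0" for k
  proof
    fix i
    have "(\<Sum>k\<in>Poly_Mapping.keys f. Poly_Mapping.lookup f k i) \<in> comp (W i) (low i + 0)"
      using tuple_compD[OF u(2), of i] by (simp only: s sum_fun_apply)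
    then show "Poly_Mapping.lookup f k i = 0 i"
      using component_coordinate[of "Poly_Mapping.keys f" "Poly_Mapping.lookup f" i 0 k] f Hcomp k by auto
  qed
  then have "Poly_Mapping.lookup f k \<in> top_span" if "k \<in> Poly_Mapping.keys f" for k
    using f[of k] that by (cases "k = 0") (auto simp: H_def D.span_zero)
  then show "u \<in> top_span" unfolding s by (rule D.span_sum)
qed

lemma w0_power: "(tuple_current (b, 0) ^^ CHAR('f)) w0 = tuple_current (pmap b, 0) w0"
proof
  fix i
  have "(tuple_current (b, 0) ^^ r) w0 i = (current (W i) (b, 0) ^^ r) (w0 i)" for r
    by (induction r) (simp_all add: tuple_current_def)
  moreover have "(current (W i) (b, 0) ^^ CHAR('f)) (w0 i) = current (W i) (pmap b, 0) (w0 i)"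
    by (rule current_power_top[OF irreducible_graded[OF irr] below_low w0_comp])
  ultimately show "(tuple_current (b, 0) ^^ CHAR('f)) w0 i = tuple_current (pmap b, 0) w0 i"
    by (simp only: tuple_current_def)
qed

text \<open>The spanning theorem with \<open>K = {0}\<close>: the commutator of two zero modes is a
  single zero mode without central term, and by \<open>w0_power\<close> the \<open>p\<close>-th
  power of a letter acts on \<open>w0\<close> as a single letter.\<close>

lemma top_span_finite: "top_span \<subseteq> D.span (zero_mode_words (restricted_words B CHAR('f)))"
proof (rule D.span_minimal[OF _ D.subspace_span])
  interpret Z: linear_operators tuple_scale tuples "\<lambda>b. tuple_current (b, 0)" by (rule zero_mode_ops)
  let ?w = "\<lambda>xs. foldr (\<lambda>b. tuple_current (b, 0)) xs w0"
  \<comment> \<open>Brackets and \<open>p\<close>-th powers of elements of \<open>B\<close> may lie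
    outside \<open>B\<close>; expanding \<open>a\<close> in \<open>B\<close> keeps the word
    length.\<close>
  have short: "tuple_current (a, 0) (?w xs) \<in> D.span ({0} \<union> {?w ys | ys. set ys \<subseteq> B \<and> length ys < k})"
    if "set xs \<subseteq> B" "length xs + 1 < k" for a xs k
  proof (rule D.letter_span[of _ B])
    show "?w xs \<in> tuples" by (rule Z.word_closed[OF w0_tuples])
    fix b assume "b \<in> B"
    then show "tuple_current (b, 0) (?w xs) \<in> D.span ({0} \<union> {?w ys | ys. set ys \<subseteq> B \<and> length ys < k})"
      using that by (intro D.span_base UnI2 CollectI exI[of _ "b # xs"]) auto
  qed (simp_all add: span_B D.subspace_span)
  have "?w xs \<in> D.span ({0} \<union> ?w ` restricted_words B CHAR('f))" if xs: "set xs \<subseteq> B" for xs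
  proof (rule Z.restricted_words_span[OF w0_tuples _ D.subspace_single_0 _ _ _ _ xs])
    show "{0} \<subseteq> tuples" using D.subspace_0[OF D.C_subspace] by simp
    show "tuple_current (b, 0) v \<in> {0}" if "v \<in> {0}" for b v using that by simp
    fix b c and xs :: "'g list" assume xs: "set xs \<subseteq> B"
    have "tuple_current (b, 0) (tuple_current (c, 0) (?w xs)) - tuple_current (c, 0) (tuple_current (b, 0) (?w xs))
        = tuple_current (bracket b c, 0) (?w xs)"
      using D.commute[OF Z.word_closed[OF w0_tuples], of b 0 c 0 xs] by simp
    then show "tuple_current (b, 0) (tuple_current (c, 0) (?w xs)) - tuple_current (c, 0) (tuple_current (b, 0) (?w xs))
        \<in> D.span ({0} \<union> {?w ys | ys. set ys \<subseteq> B \<and> length ys < length xs + 2})"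
      using short[OF xs, of "length xs + 2"] by simp
  next
    show "0 < CHAR('f)" using CHAR_gt_1 by simp
    fix b
    show "(tuple_current (b, 0) ^^ CHAR('f)) w0
        \<in> D.span ({0} \<union> {?w ys | ys. set ys \<subseteq> B \<and> length ys < CHAR('f)})"
      using short[of "[]" "CHAR('f)" "pmap b"] CHAR_gt_1 by (simp add: w0_power)
  qed
  then show "zero_mode_words {xs. set xs \<subseteq> B} \<subseteq> D.span (zero_mode_words (restricted_words B CHAR('f)))"
    by (auto simp: zero_mode_words_def)
qed

theorem equivalent_pair: "\<exists>j i. j < i \<and> graded_module_equivalent (W j) (W i)"
proof (rule ccontr)
  assume "\<not> ?thesis"
  then have neq: "\<not> graded_module_equivalent (W j) (W i)" if "j < i" for i j using that by blast
  have "\<exists>u\<in>orbit \<inter> tuple_comp 0. (\<forall>j\<in>{..<i}. u j = 0) \<and> u i \<noteq> 0" for i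
    by (rule orbit_degree_0_separates) (use neq in auto)
  then have "\<forall>i. \<exists>u. u \<in> orbit \<inter> tuple_comp 0 \<and> (\<forall>j\<in>{..<i}. u j = 0) \<and> u i \<noteq> 0"
    unfolding Bex_def by (rule allI)
  from choice[OF this] obtain v
    where "\<forall>i. v i \<in> orbit \<inter> tuple_comp 0 \<and> (\<forall>j\<in>{..<i}. v i j = 0) \<and> v i i \<noteq> 0"
    by (rule exE)
  then have v: "v i \<in> orbit \<inter> tuple_comp 0" "\<And>j. j < i \<Longrightarrow> v i j = 0" "v i i \<noteq> 0" for i
    by simp_all
  let ?F = "zero_mode_words (restricted_words B CHAR('f))"
  have fin: "finite ?F" unfolding zero_mode_words_def by (intro finite_imageI finite_restricted_words finite_B)
  have vF: "v i \<in> D.span ?F" for i using v[of i] orbit_degree_0 top_span_finite by blast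
  have coord: "D.subspace {u. u i = 0}" for i by (simp add: D.subspace_def tuple_scale_def)
  \<comment> \<open>Triangular shape: the later vectors all vanish at coordinate \<open>a\<close>,
    whereas \<open>v a\<close> does not, so the vector of smallest index is split off.\<close>
  have "D.independent (v ` {a..<a + n}) \<and> inj_on v {a..<a + n}" for a n
  proof (induction n arbitrary: a)
    case (Suc n)
    have e: "{a..<a + Suc n} = insert a {Suc a..<Suc a + n}" by auto
    have "D.span (v ` {Suc a..<Suc a + n}) \<subseteq> {u. u a = 0}"
      by (rule D.span_minimal[OF _ coord]) (use v in auto)
    then have n: "v a \<notin> D.span (v ` {Suc a..<Suc a + n})" using v[of a] by blast
    then have "v a \<notin> v ` {Suc a..<Suc a + n}" using D.span_base by blast
    then show ?case using Suc.IH[of "Suc a"] n unfolding e by (auto simp: D.independent_insert)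
  qed (simp add: D.independent_empty)
  \<comment> \<open>One vector more than the spanning set has elements.\<close>
  from this[of 0 "Suc (card ?F)"] have ind: "D.independent (v ` {0..<Suc (card ?F)})"
    and inj: "inj_on v {0..<Suc (card ?F)}" by simp_all
  have "card (v ` {0..<Suc (card ?F)}) \<le> card ?F"
    using D.independent_span_bound[OF fin ind] vF by blast
  then show False by (simp add: card_image[OF inj])
qed

end

section \<open>Finiteness of the set of classes\<close>

context restricted_current_algebra
begin

theorem finitely_many_irreducibles:
  "\<exists>R :: ('f, 'q, 'w::ab_group_add) graded_module set.
     finite R \<and> (\<forall>M\<in>R. irreducible M) \<and> (\<forall>W :: ('f, 'q, 'w) graded_module. irreducible W \<longrightarrow> (\<exists>M\<in>R. graded_module_equivalent M W))"
proof (rule ccontr)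
  assume neg: "\<not> ?thesis"
  \<comment> \<open>Each new module is inequivalent to all earlier ones, in the direction that
    \<open>equivalent_pair\<close> refutes. The condition involves all earlier choices, hence choice
    along a well-founded relation.\<close>
  define P where "P f n V \<longleftrightarrow> irreducible V \<and> (\<forall>m<n. \<not> graded_module_equivalent (f m) V)"
    for f :: "nat \<Rightarrow> ('f, 'q, 'w) graded_module" and n and V :: "('f, 'q, 'w) graded_module"
  have "\<exists>f. \<forall>n. P f n (f n)"
  proof (rule dependent_wf_choice[of less_than P])
    fix f g :: "nat \<Rightarrow> ('f, 'q, 'w) graded_module" and n V
    assume fg: "\<And>m. (m, n) \<in> less_than \<Longrightarrow> f m = g m"
    have "f m = g m" if "m < n" for m by (rule fg) (simp only: less_than_iff that)
    then show "P f n V = P g n V" unfolding P_def by metis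
  next
    fix n f assume f: "\<And>m. (m, n) \<in> less_than \<Longrightarrow> P f m (f m)"
    have irr: "irreducible (f m)" if "m < n" for m
    proof -
      have "P f m (f m)" by (rule f) (simp only: less_than_iff that)
      then show ?thesis unfolding P_def by (rule conjunct1)
    qed
    show "\<exists>V. P f n V"
    proof (rule ccontr)
      assume "\<not> ?thesis"
      then have "\<forall>V :: ('f, 'q, 'w) graded_module. irreducible V \<longrightarrow> (\<exists>m\<in>{..<n}. graded_module_equivalent (f m) V)"
        unfolding P_def by auto
      then have "\<forall>V :: ('f, 'q, 'w) graded_module. irreducible V \<longrightarrow> (\<exists>M\<in>f ` {..<n}. graded_module_equivalent M V)"
        by (simp only: bex_simps)
      moreover have "\<forall>M\<in>f ` {..<n}. irreducible M" using irr by blast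
      ultimately show False using neg by (meson finite_imageI finite_lessThan)
    qed
  qed simp
  then obtain W where "\<forall>n. P W n (W n)" by (rule exE)
  then have W: "irreducible (W n)" "\<And>m. m < n \<Longrightarrow> \<not> graded_module_equivalent (W m) (W n)" for n
    unfolding P_def by blast+
  have "\<exists>n w. w \<noteq> 0 \<and> w \<in> comp (W i) n \<and> (\<forall>m<n. comp (W i) m = {0})" for i
    by (rule irreducible_top[OF W(1)])
  then obtain low w0 where "\<forall>i. w0 i \<noteq> 0 \<and> w0 i \<in> comp (W i) (low i) \<and> (\<forall>m<low i. comp (W i) m = {0})"
    by metis
  then have lw: "w0 i \<noteq> 0" "w0 i \<in> comp (W i) (low i)" "\<And>m. m < low i \<Longrightarrow> comp (W i) m = {0}" for i
    by blast+
  interpret S: irreducible_sequence scaleQ Y vac scale bracket pmap form lev gen VG B W low w0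
    by unfold_locales (rule W lw; assumption)+
  show False using S.equivalent_pair W(2) by blast
qed

end

section \<open>Transport to a fixed space of countable dimension\<close>

lemma graded_module_equivalent_trans:
  assumes "graded_module_equivalent W1 W2" "graded_module_equivalent W2 W3"
  shows "graded_module_equivalent W1 W3"
proof -
  obtain \<psi> k where 1: "bij_betw \<psi> (carrier W1) (carrier W2)"
    "\<And>w w'. w \<in> carrier W1 \<Longrightarrow> w' \<in> carrier W1 \<Longrightarrow> \<psi> (w + w') = \<psi> w + \<psi> w'"
    "\<And>c w. w \<in> carrier W1 \<Longrightarrow> \<psi> (smult W1 c w) = smult W2 c (\<psi> w)"
    "\<And>v n w. w \<in> carrier W1 \<Longrightarrow> \<psi> (mode W1 v n w) = mode W2 v n (\<psi> w)"
    "\<And>n. \<psi> ` comp W1 n = comp W2 (n + k)"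
    using assms(1) unfolding graded_module_equivalent_def by auto
  obtain \<phi> l where 2: "bij_betw \<phi> (carrier W2) (carrier W3)"
    "\<And>w w'. w \<in> carrier W2 \<Longrightarrow> w' \<in> carrier W2 \<Longrightarrow> \<phi> (w + w') = \<phi> w + \<phi> w'"
    "\<And>c w. w \<in> carrier W2 \<Longrightarrow> \<phi> (smult W2 c w) = smult W3 c (\<phi> w)"
    "\<And>v n w. w \<in> carrier W2 \<Longrightarrow> \<phi> (mode W2 v n w) = mode W3 v n (\<phi> w)"
    "\<And>n. \<phi> ` comp W2 n = comp W3 (n + l)"
    using assms(2) unfolding graded_module_equivalent_def by auto
  have c: "\<psi> w \<in> carrier W2" if "w \<in> carrier W1" for w using 1(1) that by (auto simp: bij_betw_def)
  show ?thesis unfolding graded_module_equivalent_def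
  proof (intro exI[of _ "\<lambda>w. \<phi> (\<psi> w)"] exI[of _ "k + l"] conjI ballI allI)
    show "bij_betw (\<lambda>w. \<phi> (\<psi> w)) (carrier W1) (carrier W3)"
      using bij_betw_trans[OF 1(1) 2(1)] by (simp add: o_def)
    show "(\<lambda>w. \<phi> (\<psi> w)) ` comp W1 n = comp W3 (n + (k + l))" for n
      using 1(5)[of n] 2(5)[of "n + k"] by (simp add: image_image[symmetric] add.assoc)
  qed (simp_all add: 1(2-4) 2(2-4) c)
qed

lemma graded_module_equivalent_sym:
  assumes "nat_graded_module scale Y vac W1 VG" "nat_graded_module scale Y vac W2 VG"
    and "graded_module_equivalent W1 W2"
  shows "graded_module_equivalent W2 W1"
proof -
  interpret W1: nat_graded_module scale Y vac W1 VG by fact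
  interpret W2: nat_graded_module scale Y vac W2 VG by fact
  obtain \<psi> k where 1: "bij_betw \<psi> (carrier W1) (carrier W2)"
    "\<And>w w'. w \<in> carrier W1 \<Longrightarrow> w' \<in> carrier W1 \<Longrightarrow> \<psi> (w + w') = \<psi> w + \<psi> w'"
    "\<And>c w. w \<in> carrier W1 \<Longrightarrow> \<psi> (smult W1 c w) = smult W2 c (\<psi> w)"
    "\<And>v n w. w \<in> carrier W1 \<Longrightarrow> \<psi> (mode W1 v n w) = mode W2 v n (\<psi> w)"
    "\<And>n. \<psi> ` comp W1 n = comp W2 (n + k)"
    using assms(3) unfolding graded_module_equivalent_def by auto
  define \<phi> where "\<phi> = inv_into (carrier W1) \<psi>"
  have bij: "bij_betw \<phi> (carrier W2) (carrier W1)" unfolding \<phi>_def by (rule bij_betw_inv_into[OF 1(1)])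
  have \<phi>\<psi>: "\<phi> (\<psi> w) = w" if "w \<in> carrier W1" for w
    unfolding \<phi>_def using 1(1) that by (rule bij_betw_inv_into_left)
  have ex: "\<exists>w. w \<in> carrier W1 \<and> x = \<psi> w" if "x \<in> carrier W2" for x
    using 1(1) that by (auto simp: bij_betw_def)
  have comp: "comp W1 n \<subseteq> carrier W1" for n using W1.comp_direct_sum by (auto simp: is_direct_sum_def)
  note cl = W1.wsp.subspace_add[OF W1.carrier_subspace] W1.wsp.subspace_scale[OF W1.carrier_subspace] W1.mode_closed
  show ?thesis unfolding graded_module_equivalent_def
  proof (intro exI[of _ \<phi>] exI[of _ "-k"] conjI ballI allI bij)
    fix x y assume x: "x \<in> carrier W2" and y: "y \<in> carrier W2"
    obtain w where w: "w \<in> carrier W1 \<and> x = \<psi> w" using ex[OF x] by (rule exE)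
    obtain w' where w': "w' \<in> carrier W1 \<and> y = \<psi> w'" using ex[OF y] by (rule exE)
    show "\<phi> (x + y) = \<phi> x + \<phi> y" using w w' by (simp add: 1(2)[symmetric] \<phi>\<psi> cl)
  next
    fix c x assume x: "x \<in> carrier W2"
    obtain w where w: "w \<in> carrier W1 \<and> x = \<psi> w" using ex[OF x] by (rule exE)
    show "\<phi> (smult W2 c x) = smult W1 c (\<phi> x)" using w by (simp add: 1(3)[symmetric] \<phi>\<psi> cl)
  next
    fix v n x assume x: "x \<in> carrier W2"
    obtain w where w: "w \<in> carrier W1 \<and> x = \<psi> w" using ex[OF x] by (rule exE)
    show "\<phi> (mode W2 v n x) = mode W1 v n (\<phi> x)" using w by (simp add: 1(4)[symmetric] \<phi>\<psi> cl)
  next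
    fix n
    have "comp W2 n = \<psi> ` comp W1 (n - k)" using 1(5)[of "n - k"] by simp
    then have "\<phi> ` comp W2 n = (\<lambda>w. \<phi> (\<psi> w)) ` comp W1 (n - k)" by (simp add: image_image)
    also have "\<dots> = comp W1 (n - k)" using comp \<phi>\<psi> by (force simp: image_iff)
    finally show "\<phi> ` comp W2 n = comp W1 (n + - k)" by simp
  qed
qed

lemma (in vector_space) is_direct_sumI:
  assumes G: "\<And>n. subspace (G n)" "\<And>n. G n \<subseteq> S" and sp: "S \<subseteq> span (\<Union>n. G n)"
    and indep: "\<And>f k. (\<And>n. Poly_Mapping.lookup f n \<in> G n) \<Longrightarrow>
      (\<Sum>n\<in>Poly_Mapping.keys f. Poly_Mapping.lookup f n) = 0 \<Longrightarrow> Poly_Mapping.lookup f k = 0"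
  shows "is_direct_sum scale S G"
  unfolding is_direct_sum_def
proof (intro conjI allI ballI)
  fix w assume "w \<in> S"
  then have "w \<in> span (\<Union>n. G n)" using sp by blast
  from span_Union_subspaces[OF G(1) this] obtain f where
    f: "\<forall>n. Poly_Mapping.lookup f n \<in> G n" "w = (\<Sum>n\<in>Poly_Mapping.keys f. Poly_Mapping.lookup f n)" by blast
  show "\<exists>!f. (\<forall>n. Poly_Mapping.lookup f n \<in> G n) \<and> w = (\<Sum>n\<in>Poly_Mapping.keys f. Poly_Mapping.lookup f n)"
  proof (rule ex1I[of _ f])
    fix g assume g: "(\<forall>n. Poly_Mapping.lookup g n \<in> G n) \<and> w = (\<Sum>n\<in>Poly_Mapping.keys g. Poly_Mapping.lookup g n)"
    have sup: "(\<Sum>k\<in>Poly_Mapping.keys h. Poly_Mapping.lookup h k) = (\<Sum>k\<in>K. Poly_Mapping.lookup h k)"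
      if "finite K" "Poly_Mapping.keys h \<subseteq> K" for K and h :: "int \<Rightarrow>\<^sub>0 'b"
      by (rule sum.mono_neutral_left) (use that in \<open>auto simp: in_keys_iff\<close>)
    let ?K = "Poly_Mapping.keys f \<union> Poly_Mapping.keys g"
    have "(\<Sum>n\<in>Poly_Mapping.keys (g - f). Poly_Mapping.lookup (g - f) n) = 0"
      using sup[of ?K f] sup[of ?K g] sup[of ?K "g - f"] keys_diff[of g f] f g
      by (simp add: lookup_minus sum_subtractf Un_commute)
    then have "Poly_Mapping.lookup (g - f) k = 0" for k
      using f g G(1) by (intro indep) (auto simp: lookup_minus intro: subspace_diff)
    then show "g = f" by (intro poly_mapping_eqI) (simp add: lookup_minus)
  qed (use f in simp)
qed (use G in blast)+

text \<open>The scalars \<open>s\<close> are prescribed because the copy has to be a subspace of a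
  given vector space; modes are pulled back along \<tau>, which is meaningful on its image.\<close>

definition transport :: "('w \<Rightarrow> 'u) \<Rightarrow> ('f \<Rightarrow> 'u \<Rightarrow> 'u) \<Rightarrow> ('f, 'v, 'w) graded_module \<Rightarrow> ('f, 'v, 'u) graded_module"
  where "transport \<tau> s W = \<lparr>carrier = \<tau> ` carrier W, smult = s,
    mode = (\<lambda>v n x. \<tau> (mode W v n (inv_into (carrier W) \<tau> x))), comp = (\<lambda>n. \<tau> ` comp W n)\<rparr>"

lemma transport_simps [simp]:
  "carrier (transport \<tau> s W) = \<tau> ` carrier W" "smult (transport \<tau> s W) = s"
  "comp (transport \<tau> s W) n = \<tau> ` comp W n"
  by (simp_all add: transport_def)

context
  fixes scale :: "'f::field \<Rightarrow> 'v::ab_group_add \<Rightarrow> 'v" and Y :: "'v \<Rightarrow> int \<Rightarrow> 'v \<Rightarrow> 'v" and vac :: 'v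
    and VG :: "int \<Rightarrow> 'v set" and W :: "('f, 'v, 'w::ab_group_add) graded_module"
    and s :: "'f \<Rightarrow> 'u::ab_group_add \<Rightarrow> 'u" and \<tau> :: "'w \<Rightarrow> 'u"
  assumes W: "nat_graded_module scale Y vac W VG"
    and \<tau>: "Vector_Spaces.linear (smult W) s \<tau>" and inj: "inj_on \<tau> (carrier W)"
begin

interpretation W: nat_graded_module scale Y vac W VG by (rule W)
interpretation \<tau>: Vector_Spaces.linear "smult W" s \<tau> by (rule \<tau>)

lemma transport_mode: "w \<in> carrier W \<Longrightarrow> mode (transport \<tau> s W) v n (\<tau> w) = \<tau> (mode W v n w)"
  using inj by (simp add: transport_def)

lemma transport_zero: "w \<in> carrier W \<Longrightarrow> \<tau> w = 0 \<longleftrightarrow> w = 0"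
  using inj W.wsp.subspace_0[OF W.carrier_subspace] \<tau>.zero unfolding inj_on_def by metis

lemma comp_in_carrier: "w \<in> comp W n \<Longrightarrow> w \<in> carrier W"
  using W.comp_direct_sum by (auto simp: is_direct_sum_def)

lemma transport_module: "vertex_algebra_module scale Y vac (transport \<tau> s W)"
proof -
  note cl = W.wsp.subspace_add[OF W.carrier_subspace] W.wsp.subspace_scale[OF W.carrier_subspace] W.mode_closed
  have add: "mode (transport \<tau> s W) v n (\<tau> w + \<tau> w') = \<tau> (mode W v n w) + \<tau> (mode W v n w')"
    if "w \<in> carrier W" "w' \<in> carrier W" for v n w w'
    using that transport_mode[of "w + w'" v n] by (simp add: \<tau>.add cl W.mode_add_right)
  have scl: "mode (transport \<tau> s W) v n (s c (\<tau> w)) = s c (\<tau> (mode W v n w))" if "w \<in> carrier W" for v n c w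
    using that transport_mode[of "smult W c w" v n] by (simp add: \<tau>.scale cl W.mode_scale_right)
  have jac: "jacobi_identity s Y (mode (transport \<tau> s W)) u v (\<tau> w)" if w: "w \<in> carrier W" for u v w
    unfolding jacobi_identity_def
  proof (intro allI)
    fix l m n
    let ?A = "\<lambda>i. smult W ((- 1) ^ i * of_int (int_binomial l i)) (mode W u (m + l - int i) (mode W v (n + int i) w))"
    let ?B = "\<lambda>i. smult W ((- 1) powi l * (- 1) ^ i * of_int (int_binomial l i)) (mode W v (n + l - int i) (mode W u (m + int i) w))"
    let ?C = "\<lambda>i. smult W (of_int (int_binomial m i)) (mode W (Y u (l + int i) v) (m + n - int i) w)"
    have "Sum_any ?A - Sum_any ?B = Sum_any ?C"
      using W.mode_jacobi[OF w, of u v] unfolding jacobi_identity_def by blast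
    then have "\<tau> (Sum_any ?A) - \<tau> (Sum_any ?B) = \<tau> (Sum_any ?C)" by (simp flip: \<tau>.diff)
    moreover note psum = W.wsp.Sum_any_inj_additive[OF W.carrier_subspace, of \<tau>, OF \<tau>.add transport_zero]
    have "\<tau> (Sum_any ?A) = Sum_any (\<lambda>i. \<tau> (?A i))" by (rule psum) (auto intro!: cl w)
    moreover have "\<tau> (Sum_any ?B) = Sum_any (\<lambda>i. \<tau> (?B i))" by (rule psum) (auto intro!: cl w)
    moreover have "\<tau> (Sum_any ?C) = Sum_any (\<lambda>i. \<tau> (?C i))" by (rule psum) (auto intro!: cl w)
    ultimately show "Sum_any (\<lambda>i. s ((- 1) ^ i * of_int (int_binomial l i))
          (mode (transport \<tau> s W) u (m + l - int i) (mode (transport \<tau> s W) v (n + int i) (\<tau> w))))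
      - Sum_any (\<lambda>i. s ((- 1) powi l * (- 1) ^ i * of_int (int_binomial l i))
          (mode (transport \<tau> s W) v (n + l - int i) (mode (transport \<tau> s W) u (m + int i) (\<tau> w))))
      = Sum_any (\<lambda>i. s (of_int (int_binomial m i)) (mode (transport \<tau> s W) (Y u (l + int i) v) (m + n - int i) (\<tau> w)))"
      using w by (simp add: transport_mode \<tau>.scale cl)
  qed
  show ?thesis
  proof unfold_locales
    fix w v assume "w \<in> carrier (transport \<tau> s W)"
    then obtain x where x: "x \<in> carrier W" "w = \<tau> x" by auto
    obtain N where "\<forall>n\<ge>N. mode W v n x = 0" using W.mode_truncation[OF x(1)] by blast
    then show "\<exists>N. \<forall>n\<ge>N. mode (transport \<tau> s W) v n w = 0"
      using x by (intro exI[of _ N]) (auto simp: transport_mode)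
  qed (auto simp: transport_mode cl add scl jac W.mode_add_left W.mode_scale_left W.mode_vacuum \<tau>.add \<tau>.scale
      \<tau>.vs2.scale_right_distrib \<tau>.vs2.scale_left_distrib \<tau>.subspace_image W.carrier_subspace)
qed

lemma transport_nat_graded: "nat_graded_module scale Y vac (transport \<tau> s W) VG"
proof -
  interpret T: vertex_algebra_module scale Y vac "transport \<tau> s W" by (rule transport_module)
  have sub: "W.wsp.subspace (comp W n)" for n using W.comp_direct_sum by (simp add: is_direct_sum_def)
  have ds: "is_direct_sum s (\<tau> ` carrier W) (\<lambda>n. \<tau> ` comp W n)"
  proof (rule \<tau>.vs2.is_direct_sumI)
    show "\<tau>.vs2.subspace (\<tau> ` comp W n)" for n by (rule \<tau>.subspace_image[OF sub])
    show "\<tau> ` comp W n \<subseteq> \<tau> ` carrier W" for n using comp_in_carrier by blast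
    have "carrier W \<subseteq> W.wsp.span (\<Union>n. comp W n)"
      using W.wsp.direct_sum_decompose[OF W.comp_direct_sum] by blast
    then have "\<tau> ` carrier W \<subseteq> \<tau>.vs2.span (\<tau> ` (\<Union>n. comp W n))" using \<tau>.span_image by blast
    then show "\<tau> ` carrier W \<subseteq> \<tau>.vs2.span (\<Union>n. \<tau> ` comp W n)" by (simp add: image_UN)
    fix f :: "int \<Rightarrow>\<^sub>0 'u" and k
    assume f: "\<And>n. Poly_Mapping.lookup f n \<in> \<tau> ` comp W n"
      and z: "(\<Sum>n\<in>Poly_Mapping.keys f. Poly_Mapping.lookup f n) = 0"
    \<comment> \<open>The homogeneous parts are lifted to \<open>W\<close>, where their sum is 0 by
      injectivity; the direct sum in \<open>W\<close> then makes every lift 0.\<close>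
    have "\<forall>n. \<exists>w. w \<in> comp W n \<and> \<tau> w = Poly_Mapping.lookup f n" using f by (metis imageE)
    from choice[OF this] obtain h where h: "\<And>n. h n \<in> comp W n" "\<And>n. \<tau> (h n) = Poly_Mapping.lookup f n" by blast
    let ?K = "Poly_Mapping.keys f"
    have "sum h ?K \<in> carrier W" using h comp_in_carrier by (intro W.wsp.subspace_sum[OF W.carrier_subspace]) blast
    moreover have "\<tau> (sum h ?K) = 0" using z by (simp add: \<tau>.sum h)
    ultimately have h0: "sum h ?K = 0" by (simp add: transport_zero)
    show "Poly_Mapping.lookup f k = 0"
    proof (cases "k \<in> ?K")
      case True
      \<comment> \<open>The sum is 0 and so lies in every component; comparing with degree 0 is an
        arbitrary choice.\<close>
      have "h k = (if k = 0 then sum h ?K else 0)"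
        by (rule W.wsp.direct_sum_component[OF W.comp_direct_sum W.carrier_subspace])
          (use h True W.wsp.subspace_0[OF sub] in \<open>auto simp: h0\<close>)
      then have "h k = 0" by (simp add: h0)
      then show ?thesis using h(2)[of k] by simp
    qed (simp add: in_keys_iff)
  qed
  show ?thesis
  proof unfold_locales
    show "is_direct_sum (smult (transport \<tau> s W)) (carrier (transport \<tau> s W)) (comp (transport \<tau> s W))"
      using ds by (simp add: transport_def)
    show "comp (transport \<tau> s W) n = {0}" if "n < 0" for n using W.comp_negative[OF that] by simp
    show "mode (transport \<tau> s W) u m w \<in> comp (transport \<tau> s W) (k + n - m - 1)"
      if "u \<in> VG k" "w \<in> comp (transport \<tau> s W) n" for u k w n m
      using that W.mode_comp[OF that(1)] comp_in_carrier by (auto simp: transport_mode)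
  qed
qed

lemma transport_equivalent: "graded_module_equivalent W (transport \<tau> s W)"
  unfolding graded_module_equivalent_def
  by (rule exI[of _ \<tau>], rule exI[of _ 0])
    (auto simp: transport_mode \<tau>.add \<tau>.scale inj_on_imp_bij_betw[OF inj])

lemma transport_irreducible:
  assumes irr: "irreducible_nat_graded_module scale Y vac VG W"
  shows "irreducible_nat_graded_module scale Y vac VG (transport \<tau> s W)"
  unfolding irreducible_nat_graded_module_def
proof (intro conjI allI impI)
  show "nat_graded_module scale Y vac (transport \<tau> s W) VG" by (rule transport_nat_graded)
  show "carrier (transport \<tau> s W) \<noteq> {0}"
  proof
    assume "carrier (transport \<tau> s W) = {0}"
    then have "\<forall>w\<in>carrier W. w = 0" using transport_zero by auto
    then have "carrier W = {0}" using W.wsp.subspace_0[OF W.carrier_subspace] by blast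
    then show False using irr by (simp add: irreducible_nat_graded_module_def)
  qed
  fix S assume "graded_submodule (transport \<tau> s W) S"
  then have S: "\<tau>.vs2.subspace S" "S \<subseteq> \<tau> ` carrier W"
      "\<And>v n w. w \<in> S \<Longrightarrow> mode (transport \<tau> s W) v n w \<in> S"
      "is_direct_sum s S (\<lambda>n. S \<inter> \<tau> ` comp W n)"
    by (simp_all add: graded_submodule_def)
  define S' where "S' = {w \<in> carrier W. \<tau> w \<in> S}"
  have img: "\<tau> ` S' = S" using S(2) by (auto simp: S'_def)
  have sub: "W.wsp.subspace S'"
    using S(1) W.carrier_subspace
    by (auto simp: S'_def W.wsp.subspace_def \<tau>.vs2.subspace_def \<tau>.add \<tau>.scale)
  \<comment> \<open>A decomposition of \<open>\<tau> w\<close> is the image of a decomposition of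
    some \<open>x\<close> in the carrier, and injectivity gives \<open>w = x\<close>.\<close>
  have sp: "S' \<subseteq> W.wsp.span (\<Union>k. S' \<inter> comp W k)"
  proof
    fix w assume w: "w \<in> S'"
    have img_comp: "S \<inter> \<tau> ` comp W n = \<tau> ` (S' \<inter> comp W n)" for n
      using comp_in_carrier by (auto simp: S'_def)
    have "\<tau> w \<in> S" using w by (simp add: S'_def)
    from \<tau>.vs2.direct_sum_decompose[OF S(4) this]
    have "\<tau> w \<in> \<tau>.vs2.span (\<tau> ` (\<Union>k. S' \<inter> comp W k))" by (simp only: img_comp image_UN)
    then have "\<tau> w \<in> \<tau> ` W.wsp.span (\<Union>k. S' \<inter> comp W k)" by (simp add: \<tau>.span_image)
    then obtain x where x: "x \<in> W.wsp.span (\<Union>k. S' \<inter> comp W k)" "\<tau> w = \<tau> x" by blast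
    have "W.wsp.span (\<Union>k. S' \<inter> comp W k) \<subseteq> carrier W"
      by (rule W.wsp.span_minimal[OF _ W.carrier_subspace]) (auto simp: S'_def)
    then have "w = x" using x w inj by (auto simp: S'_def inj_on_def)
    then show "w \<in> W.wsp.span (\<Union>k. S' \<inter> comp W k)" using x by simp
  qed
  have "graded_submodule W S'" unfolding graded_submodule_def
  proof (intro conjI allI ballI sub)
    show "S' \<subseteq> carrier W" by (auto simp: S'_def)
    then show "is_direct_sum (smult W) S' (\<lambda>n. S' \<inter> comp W n)"
      by (rule W.wsp.direct_sum_restrict[OF W.comp_direct_sum W.carrier_subspace sub _ sp])
    fix v n w assume "w \<in> S'"
    then show "mode W v n w \<in> S'" using S(3)[of "\<tau> w" v n] by (simp add: S'_def transport_mode W.mode_closed)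
  qed
  then have "S' = {0} \<or> S' = carrier W" using irr by (simp add: irreducible_nat_graded_module_def)
  then show "S = {0} \<or> S = carrier (transport \<tau> s W)" using img by auto
qed

end

section \<open>Embedding spaces of countable dimension into finitely supported sequences\<close>

definition coord_scale :: "'f::field \<Rightarrow> (nat \<Rightarrow>\<^sub>0 'f) \<Rightarrow> nat \<Rightarrow>\<^sub>0 'f" where
  "coord_scale c u = Poly_Mapping.map ((*) c) u"

lemma lookup_coord_scale: "Poly_Mapping.lookup (coord_scale c u) n = c * Poly_Mapping.lookup u n"
  by (simp add: coord_scale_def map.rep_eq when_def)

lemma vector_space_coord_scale: "vector_space coord_scale"
  by unfold_locales (auto intro!: poly_mapping_eqI simp: lookup_coord_scale lookup_add algebra_simps)

text \<open>A basis of the span is countable and goes to distinct unit sequences. The map is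
  extended linearly to the whole space, with injectivity on the span only.\<close>

lemma (in vector_space) countable_span_embedding:
  assumes S: "countable S"
  shows "\<exists>\<tau>. Vector_Spaces.linear scale coord_scale \<tau> \<and> inj_on \<tau> (span S)"
proof -
  interpret P: vector_space coord_scale by (rule vector_space_coord_scale)
  interpret pair: vector_space_pair scale coord_scale ..
  obtain B where B: "B \<subseteq> S" "independent B" "S \<subseteq> span B" using maximal_independent_subset by blast
  have cB: "countable B" using B(1) S countable_subset by blast
  define e :: "'b \<Rightarrow> nat \<Rightarrow>\<^sub>0 'a" where "e b = Poly_Mapping.single (to_nat_on B b) 1" for b
  obtain \<tau> where \<tau>: "Vector_Spaces.linear scale coord_scale \<tau>" "\<And>b. b \<in> B \<Longrightarrow> \<tau> b = e b"
    using pair.linear_independent_extend[OF B(2), of e] by blast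
  interpret \<tau>: Vector_Spaces.linear scale coord_scale \<tau> by (rule \<tau>(1))
  have inj: "x = 0" if x: "x \<in> span B" "\<tau> x = 0" for x
  proof -
    obtain F r where F: "finite F" "F \<subseteq> B" "x = (\<Sum>a\<in>F. r a *s a)" using x(1) unfolding span_explicit by blast
    have "r b = 0" if b: "b \<in> F" for b
    proof -
      have "0 = Poly_Mapping.lookup (\<tau> x) (to_nat_on B b)" by (simp add: x(2))
      also have "\<dots> = (\<Sum>a\<in>F. r a * Poly_Mapping.lookup (e a) (to_nat_on B b))"
        using F by (simp add: \<tau>.sum \<tau>.scale lookup_sum lookup_coord_scale \<tau>(2) subset_iff cong: sum.cong)
      also have "\<dots> = (\<Sum>a\<in>F. if a = b then r a else 0)"
      proof (rule sum.cong[OF refl])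
        fix a assume "a \<in> F"
        then show "r a * Poly_Mapping.lookup (e a) (to_nat_on B b) = (if a = b then r a else 0)"
          using F(2) b to_nat_on_inj[OF cB, of a b] by (auto simp: e_def lookup_single when_def)
      qed
      also have "\<dots> = r b" using F(1) b by simp
      finally show ?thesis by simp
    qed
    then show ?thesis using F(3) by simp
  qed
  have "span S \<subseteq> span B" using B(3) by (rule span_minimal) (rule subspace_span)
  moreover have "inj_on \<tau> (span B)"
  proof (rule inj_onI)
    fix x y assume "x \<in> span B" "y \<in> span B" "\<tau> x = \<tau> y"
    then show "x = y" using inj[of "x - y"] by (simp add: span_diff \<tau>.diff)
  qed
  ultimately show ?thesis using \<tau>(1) inj_on_subset by blast
qed

section \<open>Copies of irreducible modules\<close>

context restricted_current_algebra
begin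

text \<open>A homogeneous vector generates the module, so words with letters from \<open>B\<close>
  and integer indices span it; \<open>B\<close> is finite, hence there are countably many.\<close>

lemma irreducible_countable_span:
  assumes W: "irreducible W"
  shows "\<exists>S. countable S \<and> carrier W = module.span (smult W) S"
proof -
  interpret W: nat_graded_module scaleQ Y vac W VG by (rule irreducible_graded[OF W])
  interpret X: current_operators "smult W" "carrier W" "current W" scale bracket
    "\<lambda>a m b n. if m + n = 0 then of_int m * lev * form a b else 0"
    by (rule current_operators[OF irreducible_module[OF W]])
  obtain n w where w: "w \<noteq> 0" "w \<in> comp W n" using irreducible_top[OF W] by blast
  have wc: "w \<in> carrier W" using w(2) W.comp_direct_sum by (auto simp: is_direct_sum_def)
  let ?S = "(\<lambda>xs. foldr (current W) xs w) ` lists (B \<times> UNIV)"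
  have SC: "?S \<subseteq> carrier W" using X.word_closed[OF wc] by blast
  have "countable ?S"
    by (intro countable_image countable_lists countable_SIGMA countable_finite[OF finite_B]) simp_all
  moreover have "W.wsp.span ?S = carrier W"
  proof (rule irreducible_full[OF W W.wsp.subspace_span])
    show "W.wsp.span ?S \<subseteq> carrier W" by (rule W.wsp.span_minimal[OF SC W.carrier_subspace])
    fix x :: "'g \<times> int" and u assume u: "u \<in> W.wsp.span ?S"
    obtain a m where x: "x = (a, m)" by force
    show "current W x u \<in> W.wsp.span ?S" unfolding x
    proof (rule X.letter_span[of a B])
      show "u \<in> carrier W" using u \<open>W.wsp.span ?S \<subseteq> carrier W\<close> by blast
      fix b assume b: "b \<in> B"
      show "current W (b, m) u \<in> W.wsp.span ?S"
      proof (rule X.X_span[OF SC W.wsp.subspace_span _ u])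
        fix y assume "y \<in> ?S"
        then obtain xs where "xs \<in> lists (B \<times> UNIV)" "y = foldr (current W) xs w" by blast
        then have "current W (b, m) y = foldr (current W) ((b, m) # xs) w" "(b, m) # xs \<in> lists (B \<times> UNIV)"
          using b by auto
        then show "current W (b, m) y \<in> W.wsp.span ?S" by (metis (no_types, lifting) W.wsp.span_base imageI)
      qed
    qed (simp_all add: span_B W.wsp.subspace_span)
  next
    have deg: "\<exists>k. foldr (current W) xs w \<in> comp W k" for xs
    proof (induction xs)
      case (Cons x xs)
      obtain a m where x: "x = (a, m)" by force
      show ?case using Cons.IH current_degree[OF irreducible_graded[OF W], of _ _ a m] by (auto simp: x)
    qed (use w in auto)
    have "?S \<subseteq> (\<Union>k. W.wsp.span ?S \<inter> comp W k)"
    proof (rule image_subsetI)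
      fix xs assume "xs \<in> lists (B \<times> (UNIV :: int set))"
      then have "foldr (current W) xs w \<in> W.wsp.span ?S" by (intro W.wsp.span_base imageI)
      then show "foldr (current W) xs w \<in> (\<Union>k. W.wsp.span ?S \<inter> comp W k)" using deg[of xs] by blast
    qed
    then show "W.wsp.span ?S \<subseteq> W.wsp.span (\<Union>k. W.wsp.span ?S \<inter> comp W k)" by (rule W.wsp.span_mono)
    have "w \<in> ?S" by (rule image_eqI[of _ _ "[]"]) auto
    then have "w \<in> W.wsp.span ?S" by (rule W.wsp.span_base)
    then show "\<exists>w\<in>W.wsp.span ?S. w \<noteq> 0" by (rule bexI[rotated]) (rule w(1))
  qed
  ultimately show ?thesis by (intro exI[of _ ?S] conjI) simp_all
qed

lemma irreducible_copy:
  assumes W: "irreducible W"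
  shows "\<exists>M :: ('f, 'q, nat \<Rightarrow>\<^sub>0 'f) graded_module. irreducible M \<and> graded_module_equivalent W M"
proof -
  interpret W: nat_graded_module scaleQ Y vac W VG by (rule irreducible_graded[OF W])
  obtain S where S: "countable S" "carrier W = W.wsp.span S" using irreducible_countable_span[OF W] by blast
  obtain \<tau> where \<tau>: "Vector_Spaces.linear (smult W) coord_scale \<tau>" "inj_on \<tau> (carrier W)"
    using W.wsp.countable_span_embedding[OF S(1)] S(2) by auto
  note T = irreducible_graded[OF W] \<tau>
  show ?thesis using transport_irreducible[OF T W] transport_equivalent[OF T] by blast
qed

text \<open>Representatives are found among the modules on \<open>'w\<close> and then replaced by
  their copies; symmetry and transitivity bring the equivalences into the required
  direction.\<close>

theorem finitely_many_irreducible_copies: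
  "\<exists>R :: ('f, 'q, nat \<Rightarrow>\<^sub>0 'f) graded_module set. finite R \<and> (\<forall>M\<in>R. irreducible M) \<and>
     (\<forall>W :: ('f, 'q, 'w::ab_group_add) graded_module. irreducible W \<longrightarrow> (\<exists>M\<in>R. graded_module_equivalent W M))"
proof -
  obtain R :: "('f, 'q, 'w) graded_module set" where R: "finite R" "\<And>M. M \<in> R \<Longrightarrow> irreducible M"
    "\<And>W :: ('f, 'q, 'w) graded_module. irreducible W \<Longrightarrow> \<exists>M\<in>R. graded_module_equivalent M W"
    using finitely_many_irreducibles[where 'w = 'w] by blast
  have "\<forall>W\<in>R. \<exists>M :: ('f, 'q, nat \<Rightarrow>\<^sub>0 'f) graded_module. irreducible M \<and> graded_module_equivalent W M"
    using irreducible_copy R(2) by blast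
  from bchoice[OF this] obtain c :: "('f, 'q, 'w) graded_module \<Rightarrow> ('f, 'q, nat \<Rightarrow>\<^sub>0 'f) graded_module"
    where c: "\<And>W. W \<in> R \<Longrightarrow> irreducible (c W)" "\<And>W. W \<in> R \<Longrightarrow> graded_module_equivalent W (c W)" by blast
  show ?thesis
  proof (intro exI[of _ "c ` R"] conjI allI impI ballI)
    show "finite (c ` R)" using R(1) by (rule finite_imageI)
    show "irreducible M" if "M \<in> c ` R" for M using that c(1) by blast
    fix W :: "('f, 'q, 'w) graded_module" assume W: "irreducible W"
    obtain V where V: "V \<in> R" "graded_module_equivalent V W" using R(3)[OF W] by blast
    have "graded_module_equivalent W V"
      by (rule graded_module_equivalent_sym[OF irreducible_graded irreducible_graded V(2)]) (use R(2) V(1) W in blast)+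
    then have "graded_module_equivalent W (c V)" using c(2)[OF V(1)] by (rule graded_module_equivalent_trans)
    then show "\<exists>M\<in>c ` R. graded_module_equivalent W M" using V(1) by blast
  qed
qed

end

section \<open>The quotient of the affine vertex algebra\<close>

lemma quotient_restricted_current_algebra:
  fixes scale :: "'f::field \<Rightarrow> 'g::ab_group_add \<Rightarrow> 'g"
  assumes p: "prime CHAR('f)" "CHAR('f) \<ge> 3"
    and lie: "restricted_lie_algebra scale bracket pmap"
    and B: "finite_dimensional_vector_space scale B"
    and sym: "symmetric_invariant_form scale bracket form"
    and va: "affine_vertex_algebra scale bracket form lev scaleV \<rho> Y vac"
    and quot: "quotient_vertex_algebra scaleV Y (p_ideal pmap scaleV \<rho> vac) scaleQ YQ \<pi>"
  shows "restricted_current_algebra scaleQ YQ (\<pi> vac) scale bracket pmap form lev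
    (\<lambda>a. \<pi> (\<rho> (loop_elt a (-1)) vac)) (\<lambda>n. \<pi> ` affine_component scaleV \<rho> vac n) B"
proof -
  interpret g: restricted_lie_algebra scale bracket pmap by (rule lie)
  interpret gB: finite_dimensional_vector_space scale B by (rule B)
  interpret V: affine_vertex_algebra scale bracket form lev scaleV \<rho> Y vac by (rule va)
  interpret Q: quotient_vertex_algebra scaleV Y "p_ideal pmap scaleV \<rho> vac" scaleQ YQ \<pi> by (rule quot)
  interpret \<pi>: Vector_Spaces.linear scaleV scaleQ \<pi> by (rule Q.quotient_linear)
  interpret R: Vector_Spaces.linear scaleV scaleV "\<rho> x" for x by (rule V.rep_linear)
  interpret QV: vertex_algebra scaleQ YQ "\<pi> vac"
    by (rule Q.quotient_is_vertex_algebra[OF V.vertex_algebra_axioms])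
  let ?gen = "\<lambda>a. \<pi> (\<rho> (loop_elt a (-1)) vac)"
  have gen: "YQ (?gen a) n (\<pi> v) = \<pi> (\<rho> (loop_elt a n) v)" for a n v
    by (simp add: Q.quotient_Y[symmetric] V.Y_generator)
  have kill: "\<rho> (loop_elt a n) vac = 0" if "0 \<le> n" for a n
    using V.Y_generator[of a n vac] V.Y_creation(1)[OF that] by simp
  have loop_add: "loop_elt (a + b) n = loop_elt a n + loop_elt b n" for a b :: 'g and n
    by (simp add: loop_elt_def single_add)
  have loop_scale: "affine_scale scale c (loop_elt a n) = loop_elt (scale c a) n" for c a n
    by (auto simp: affine_scale_def loop_elt_def intro!: poly_mapping_eqI
        simp: map.rep_eq lookup_single when_def)
  have rho0: "\<rho> 0 v = 0" for v using V.rep_add[of 0 0 v] by simp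
  have words: "v \<in> V.span (range (\<lambda>xs. foldr \<rho> xs vac))" for v
  proof -
    let ?e = "word_action scaleV \<rho> vac"
    interpret E: Vector_Spaces.linear free_scale scaleV ?e by (rule linear_word_action[OF V.vector_space_axioms])
    obtain u where u: "v = ?e u" using V.induced_surj by (rule surjE)
    have "?e u \<in> ?e ` module.span free_scale (range word)" using free_algebra_span_words by blast
    also have "\<dots> = V.span (?e ` range word)" by (rule E.span_image[symmetric])
    finally show ?thesis by (simp add: u image_image word_action_word[OF V.vector_space_axioms])
  qed
  have words_induct: "v \<in> T" if T: "V.subspace T" "vac \<in> T" "\<And>x v. v \<in> T \<Longrightarrow> \<rho> x v \<in> T" for T v
  proof -
    have "foldr \<rho> xs vac \<in> T" for xs by (induction xs) (use T in auto)
    then have "V.span (range (\<lambda>xs. foldr \<rho> xs vac)) \<subseteq> T" by (intro V.span_minimal T(1)) auto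
    then show ?thesis using words by blast
  qed
  \<comment> \<open>The balancing relation for the empty word and \<open>b = (0, z)\<close> fixes
    the level on the vacuum.\<close>
  have central_vac: "\<rho> (0, z) vac = scaleV (lev * z) vac" for z
  proof -
    let ?u = "word [(0, z)] - free_scale (lev * z) (word [])
      :: ('f, ('f, 'g) affine) free_algebra"
    interpret E: Vector_Spaces.linear free_scale scaleV "word_action scaleV \<rho> vac"
      by (rule linear_word_action[OF V.vector_space_axioms])
    have "?u \<in> balancing_relations lev" unfolding balancing_relations_def
      by (intro CollectI exI[of _ "[]"] exI[of _ "(0, z)"]) (auto simp: affine_nonneg_def)
    then have "?u \<in> vacuum_relations scale bracket form lev"
      unfolding vacuum_relations_def by (intro E.vs1.span_base UnI2)
    then have "word_action scaleV \<rho> vac ?u = 0" by (simp add: V.induced_kernel)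
    then show ?thesis by (simp add: E.diff E.scale word_action_word[OF V.vector_space_axioms])
  qed
  \<comment> \<open>The scalar action spreads from the vacuum to all words because
    \<open>(0, z)\<close> is central.\<close>
  have central: "\<rho> (0, z) v = scaleV (lev * z) v" for z v
  proof -
    let ?T = "{v. \<rho> (0, z) v = scaleV (lev * z) v}"
    have "v \<in> ?T"
    proof (rule words_induct)
      show "V.subspace ?T"
        by (auto simp: V.subspace_def R.add R.scale V.scale_right_distrib V.scale_left_commute)
      show "vac \<in> ?T" by (simp add: central_vac)
      fix x v assume "v \<in> ?T"
      moreover have "affine_bracket bracket form (0, z) x = 0" by (simp add: affine_bracket_def)
      ultimately show "\<rho> x v \<in> ?T"
        using V.rep_bracket[of "(0, z)" x v] by (simp add: rho0 R.scale)
    qed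
    then show ?thesis by simp
  qed
  \<comment> \<open>\<open>a(n)\<close> kills the vacuum, so only its commutator with
    \<open>b(-1)\<close> remains, and the central term of that occurs for \<open>n = 1\<close>
    alone.\<close>
  have brk: "YQ (?gen a) n (?gen b) = \<pi> (\<rho> (loop_elt (bracket a b) (n - 1)) vac)
      + \<pi> (scaleV (lev * (if n = 1 then of_int n * form a b else 0)) vac)" if n: "0 \<le> n" for a b n
  proof -
    have "\<rho> (loop_elt a n) (\<rho> (loop_elt b (-1)) vac)
        = \<rho> (affine_bracket bracket form (loop_elt a n) (loop_elt b (-1))) vac"
      unfolding V.rep_bracket by (simp add: kill[OF n] R.zero)
    also have "\<dots> = \<rho> (loop_elt (bracket a b) (n - 1)) vac
        + scaleV (lev * (if n = 1 then of_int n * form a b else 0)) vac"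
      unfolding affine_bracket_loop_elt[OF g.lie_algebra_axioms sym] V.rep_add central by simp
    finally show ?thesis by (simp add: gen \<pi>.add)
  qed
  have power: "(YQ (?gen a) (-1) ^^ r) (\<pi> vac) = \<pi> ((\<rho> (loop_elt a (-1)) ^^ r) vac)" for a r
    by (induction r) (simp_all add: gen)
  show ?thesis
  proof unfold_locales
    show "?gen (a + b) = ?gen a + ?gen b" for a b by (simp add: loop_add V.rep_add \<pi>.add)
    show "?gen (scale c a) = scaleQ c (?gen a)" for c a
      by (simp add: loop_scale[symmetric] V.rep_scale \<pi>.scale)
    show "YQ (?gen a) 0 (?gen b) = ?gen (bracket a b)" for a b by (simp add: brk \<pi>.zero)
    show "YQ (?gen a) 1 (?gen b) = scaleQ (lev * form a b) (\<pi> vac)" for a b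
      by (simp add: brk kill \<pi>.zero \<pi>.scale)
    show "YQ (?gen a) n (?gen b) = 0" if "2 \<le> n" for n a b using that by (simp add: brk kill \<pi>.zero)
    show "v \<in> S" if S: "\<pi>.vs2.subspace S" "\<pi> vac \<in> S" "\<And>a n v. v \<in> S \<Longrightarrow> YQ (?gen a) n v \<in> S" for S v
    proof -
      let ?T = "{v. \<pi> v \<in> S}"
      have T: "V.subspace ?T" using S(1)
        by (auto simp: V.subspace_def \<pi>.vs2.subspace_def \<pi>.zero \<pi>.add \<pi>.scale)
      have "u \<in> ?T" for u
      proof (rule words_induct[OF T])
        show "vac \<in> ?T" using S(2) by simp
        fix x :: "('f, 'g) affine" and u assume u: "u \<in> ?T"
        have loop: "\<rho> (Poly_Mapping.single k a, 0) u \<in> ?T" for k a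
          using S(3)[of "\<pi> u" a k] u unfolding gen by (simp add: loop_elt_def)
        \<comment> \<open>\<open>S\<close> is known to be stable only under the \<open>a(n)\<close>,
          so a general element of the affine algebra is split into finitely many loop elements and a
          central part.\<close>
        let ?f = "\<lambda>k. (Poly_Mapping.single k (Poly_Mapping.lookup (fst x) k), 0) :: ('f, 'g) affine"
        let ?K = "Poly_Mapping.keys (fst x)"
        have "\<rho> (sum ?f K) u \<in> ?T" for K
        proof (induction K rule: infinite_finite_induct)
          case (insert k K)
          then show ?case
            unfolding sum.insert[OF insert.hyps] V.rep_add by (intro V.subspace_add[OF T] loop)
        qed (use V.subspace_0[OF T] in \<open>simp_all add: rho0\<close>)
        moreover have "\<rho> (0, snd x) u \<in> ?T" unfolding central using u by (intro V.subspace_scale[OF T])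
        ultimately have "\<rho> (sum ?f ?K + (0, snd x)) u \<in> ?T"
          unfolding V.rep_add by (rule V.subspace_add[OF T])
        moreover have "sum ?f ?K + (0, snd x) = x"
        proof (rule prod_eqI)
          have "(\<Sum>k\<in>?K. Poly_Mapping.single k (Poly_Mapping.lookup (fst x) k)) = fst x"
            by (rule poly_mapping_eqI)
               (simp add: lookup_sum lookup_single when_def in_keys_iff if_distrib sum.delta cong: if_cong)
          then show "fst (sum ?f ?K + (0, snd x)) = fst x" by (simp add: fst_sum)
        qed (simp add: snd_sum)
        ultimately show "\<rho> x u \<in> ?T" by (simp only:)
      qed
      moreover obtain u where "v = \<pi> u" using Q.quotient_surj by (rule surjE)
      ultimately show ?thesis by blast
    qed
    show "(YQ (?gen a) (-1) ^^ CHAR('f)) (\<pi> vac) = YQ (?gen (pmap a)) (- int CHAR('f)) (\<pi> vac)" for a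
    proof -
      \<comment> \<open>The generator of the ideal with \<open>m = 1\<close> is the relation for
        \<open>a(-1)\<close>.\<close>
      have "(\<rho> (loop_elt a (- int 1)) ^^ CHAR('f)) vac - \<rho> (loop_elt (pmap a) (- int (CHAR('f) * 1))) vac
          \<in> p_ideal pmap scaleV \<rho> vac"
        unfolding p_ideal_def by (rule hull_inc) (use zero_less_one in blast)
      then have "\<pi> ((\<rho> (loop_elt a (-1)) ^^ CHAR('f)) vac - \<rho> (loop_elt (pmap a) (- int CHAR('f))) vac) = 0"
        by (simp add: Q.quotient_kernel)
      then show ?thesis unfolding power gen by (simp add: \<pi>.diff)
    qed
    show "(YQ (?gen a) (-1) ^^ r) (\<pi> vac) \<in> \<pi> ` affine_component scaleV \<rho> vac (int r)" for a r
      unfolding power affine_component_def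
      by (intro imageI V.span_base CollectI exI[of _ "replicate r (a, -1)"])
        (simp add: foldr_replicate sum_list_replicate)
    show "finite B" by (rule gB.finite_Basis)
    show "g.span B = UNIV" by (rule gB.span_Basis)
    show "odd CHAR('f)" using p prime_odd_nat[of "CHAR('f)"] by simp
    show "1 < CHAR('f)" using p by simp
  qed
qed

theorem proposition6p6:
  fixes scale :: "'f::alg_closed_field \<Rightarrow> 'g::ab_group_add \<Rightarrow> 'g"
    and bracket :: "'g \<Rightarrow> 'g \<Rightarrow> 'g" and pmap :: "'g \<Rightarrow> 'g" and form :: "'g \<Rightarrow> 'g \<Rightarrow> 'f"
    and lev :: 'f
    and scaleV :: "'f \<Rightarrow> 'v::ab_group_add \<Rightarrow> 'v"
    and \<rho> :: "('f, 'g) affine \<Rightarrow> 'v \<Rightarrow> 'v"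
    and Y :: "'v \<Rightarrow> int \<Rightarrow> 'v \<Rightarrow> 'v" and vac :: 'v
    and scaleQ :: "'f \<Rightarrow> 'q::ab_group_add \<Rightarrow> 'q"
    and YQ :: "'q \<Rightarrow> int \<Rightarrow> 'q \<Rightarrow> 'q" and \<pi> :: "'v \<Rightarrow> 'q"
  assumes "prime CHAR('f)" and "CHAR('f) \<ge> 3"
    and "restricted_lie_algebra scale bracket pmap"
    and "\<exists>B. finite_dimensional_vector_space scale B"
    and "symmetric_invariant_form scale bracket form"
    and "affine_vertex_algebra scale bracket form lev scaleV \<rho> Y vac"
    and "quotient_vertex_algebra scaleV Y (p_ideal pmap scaleV \<rho> vac) scaleQ YQ \<pi>"
  shows "(\<exists>R :: ('f, 'q, nat \<Rightarrow>\<^sub>0 'f) graded_module set.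
            finite R \<and>
            (\<forall>M\<in>R. irreducible_nat_graded_module scaleQ YQ (\<pi> vac)
                      (\<lambda>n. \<pi> ` affine_component scaleV \<rho> vac n) M) \<and>
            (\<forall>W :: ('f, 'q, 'w::ab_group_add) graded_module.
               irreducible_nat_graded_module scaleQ YQ (\<pi> vac)
                 (\<lambda>n. \<pi> ` affine_component scaleV \<rho> vac n) W \<longrightarrow>
               (\<exists>M\<in>R. graded_module_equivalent W M)))
         \<and> C2_cofinite scaleQ YQ"
proof -
  obtain B where B: "finite_dimensional_vector_space scale B" using assms(4) by blast
  interpret restricted_current_algebra scaleQ YQ "\<pi> vac" scale bracket pmap form lev
    "\<lambda>a. \<pi> (\<rho> (loop_elt a (-1)) vac)" "\<lambda>n. \<pi> ` affine_component scaleV \<rho> vac n" B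
    by (rule quotient_restricted_current_algebra[OF assms(1-3) B assms(5-7)])
  show ?thesis using finitely_many_irreducible_copies C2_cofinite by (rule conjI)
qed

end
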